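(* Let $K$ be a Hardy-type function for the Landau solutions $v_c$, let $c_0>1$ be such that $K(c)<1$ for all $c\in\mathbb{R}$ with $|c|\geq c_0$, let $|c|>c_0$ and $w_0\in L^2_\sigma(\mathbb{R}^3)$. Then every global-in-time weak solution $w=w(x,t)$ of $$w_t-\Delta w+(w\cdot\nabla)w+(w\cdot\nabla)v_c+(v_c\cdot\nabla)w+\nabla\pi=0,\qquad \mathrm{div}\,w=0,\qquad w(x,0)=w_0(x)$$ on $\mathbb{R}^3\times(0,\infty)$ satisfying the strong energy inequality $$\|w(t)\|_2^2+2(1-K(c))\int_s^t\|\nabla\otimes w(\tau)\|_2^2\,d\tau\leq\|w(s)\|_2^2$$ for almost all $s\geq0$, including $s=0$, and all $t\geq s$, has the property $$\lim_{t\to\infty}\|w(t)\|_2=0.$$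
   Context: Landau solutions: for $c\in\mathbb{R}$, $|c|>1$, the vector field $v_c=(v_c^1,v_c^2,v_c^3)$ on $\mathbb{R}^3\setminus\{0\}$ is $$v_c^1(x)=2\frac{c|x|^2-2x_1|x|+cx_1^2}{|x|(c|x|-x_1)^2},\quad v_c^2(x)=2\frac{x_2(cx_1-|x|)}{|x|(c|x|-x_1)^2},\quad v_c^3(x)=2\frac{x_3(cx_1-|x|)}{|x|(c|x|-x_1)^2}.$$ Hardy-type function: a function $K:(-\infty,-1)\cup(1,\infty)\to(0,\infty)$ with $\lim_{|c|\to1}K(c)=+\infty$, $\lim_{|c|\to\infty}K(c)=0$ and $$\Big|\int_{\mathbb{R}^3}w\cdot(w\cdot\nabla)v_c\,dx\Big|\leq K(c)\|\nabla\otimes w\|_2^2$$ for all $|c|>1$ and all vector fields $w\in\dot H^1(\mathbb{R}^3)$ (the integrand being in $L^1(\mathbb{R}^3)$). Such a function exists. Here $w\cdot(w\cdot\nabla)v_c=\sum_{j,k}w_jw_k\,\partial_{x_j}v_c^k$ and $\|\nabla\otimes w\|_2^2=\sum_{j,k}\|\partial_{x_j}w_k\|_2^2$. Spaces (real vector fields): $\|\cdot\|_p$ is the $L^p(\mathbb{R}^3)$ norm; $L^2_\sigma(\mathbb{R}^3)$ is the space of divergence-free fields in $(L^2(\mathbb{R}^3))^3$; $H^1_\sigma(\mathbb{R}^3)$ is the space of divergence-free fields in $(H^1(\mathbb{R}^3))^3$; $\dot H^1(\mathbb{R}^3)$ is the homogeneous Sobolev space (completion of $C_c^\infty$ in the norm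 $\|\nabla f\|_2$), and $\dot H^1_\sigma$ its divergence-free vector version. Put $X_T=L^\infty_w([0,T],L^2_\sigma(\mathbb{R}^3))\cap L^2([0,T],\dot H^1_\sigma(\mathbb{R}^3))$, where $L^\infty_w([0,T],L^2_\sigma)$ denotes functions $w:[0,T]\to L^2_\sigma(\mathbb{R}^3)$, defined at every time, that are weakly measurable and essentially bounded. Weak solution (global in time): $w:[0,\infty)\to L^2_\sigma(\mathbb{R}^3)$ whose restriction to $[0,T]$ is in $X_T$ for every $T>0$, with $w(0)=w_0$ and $$\big(w(t),\varphi(t)\big)+\int_s^t\Big[(\nabla w,\nabla\varphi)+(w\cdot\nabla w,\varphi)+(w\cdot\nabla v_c,\varphi)+(v_c\cdot\nabla w,\varphi)\Big]d\tau=\big(w(s),\varphi(s)\big)+\int_s^t(w,\varphi_\tau)\,d\tau$$ for all $t\geq s\geq0$ and all $\varphi\in C([0,\infty),H^1_\sigma(\mathbb{R}^3))\cap C^1([0,\infty),L^2_\sigma(\mathbb{R}^3))$, where $(\cdot,\cdot)$ is the $L^2$-inner product. *)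

theory Defs
  imports "HOL-Analysis.Analysis"
begin

type_synonym vfield = "real^3 \<Rightarrow> real^3"

(* Index convention for gradients: the (j, k) entry is the j-th partial derivative of the
   k-th component. *)
type_synonym tfield = "real^3 \<Rightarrow> real^3^3"

section \<open>Test functions and classical derivatives\<close>

primrec Ck :: "nat \<Rightarrow> (real^3 \<Rightarrow> 'b::real_normed_vector) \<Rightarrow> bool" where
  "Ck 0 f \<longleftrightarrow> continuous_on UNIV f"
| "Ck (Suc n) f \<longleftrightarrow> (\<forall>x. f differentiable (at x)) \<and>
     (\<forall>i\<in>Basis. Ck n (\<lambda>x. frechet_derivative f (at x) i))"

definition test_fun :: "(real^3 \<Rightarrow> 'b::real_normed_vector) \<Rightarrow> bool" where
  "test_fun f \<longleftrightarrow> (\<forall>n. Ck n f) \<and> compact (closure {x. f x \<noteq> 0})"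

definition partial :: "3 \<Rightarrow> (real^3 \<Rightarrow> 'b::real_normed_vector) \<Rightarrow> real^3 \<Rightarrow> 'b" where
  "partial j f x = frechet_derivative f (at x) (axis j 1)"

definition classical_grad :: "vfield \<Rightarrow> tfield" where
  "classical_grad v x = (\<chi> j k. partial j v x $ k)"

section \<open>Lebesgue spaces\<close>

(* Elements of function spaces are Lebesgue measurable representatives; all notions below
   are invariant under changes on null sets. *)

definition loc_integrable :: "(real^3 \<Rightarrow> 'b::euclidean_space) \<Rightarrow> bool" where
  "loc_integrable f \<longleftrightarrow> (\<forall>C. compact C \<longrightarrow> set_integrable lebesgue C f)"

definition in_L2 :: "(real^3 \<Rightarrow> 'b::euclidean_space) \<Rightarrow> bool" where
  "in_L2 f \<longleftrightarrow> f \<in> borel_measurable lebesgue \<and> integrable lebesgue (\<lambda>x. (norm (f x))\<^sup>2)"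

definition l2_inner :: "(real^3 \<Rightarrow> 'b::euclidean_space) \<Rightarrow> (real^3 \<Rightarrow> 'b) \<Rightarrow> real" where
  "l2_inner f g = (LINT x|lebesgue. f x \<bullet> g x)"

(* For matrix-valued fields the pointwise norm is the Frobenius norm, so that the square of
   the norm of a gradient is the sum of the squared norms of all its entries. *)
definition l2_norm :: "(real^3 \<Rightarrow> 'b::euclidean_space) \<Rightarrow> real" where
  "l2_norm f = sqrt (LINT x|lebesgue. (norm (f x))\<^sup>2)"

section \<open>Weak derivatives and Sobolev spaces\<close>

definition has_weak_grad :: "vfield \<Rightarrow> tfield \<Rightarrow> bool" where
  "has_weak_grad w G \<longleftrightarrow> loc_integrable w \<and> loc_integrable G \<and>
     (\<forall>(\<phi>::real^3 \<Rightarrow> real) j k. test_fun \<phi> \<longrightarrow>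
        (LINT x|lebesgue. w x $ k * partial j \<phi> x) = - (LINT x|lebesgue. G x $ j $ k * \<phi> x))"

definition weak_grad :: "vfield \<Rightarrow> tfield" where
  "weak_grad w = (SOME G. has_weak_grad w G)"

definition div_free :: "vfield \<Rightarrow> bool" where
  "div_free w \<longleftrightarrow> (\<forall>\<phi>::real^3 \<Rightarrow> real. test_fun \<phi> \<longrightarrow>
     (LINT x|lebesgue. (\<Sum>k\<in>UNIV. w x $ k * partial k \<phi> x)) = 0)"

definition in_H1 :: "vfield \<Rightarrow> bool" where
  "in_H1 w \<longleftrightarrow> in_L2 w \<and> (\<exists>G. has_weak_grad w G \<and> in_L2 G)"

definition H1_norm :: "vfield \<Rightarrow> real" where
  "H1_norm w = sqrt ((l2_norm w)\<^sup>2 + (l2_norm (weak_grad w))\<^sup>2)"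

(* The completion of the test fields in the norm of the gradient, realised as a space of
   functions: by the Sobolev inequality every Cauchy sequence of test fields converges in L^6,
   hence locally in L^1, and equivalent Cauchy sequences are those with the same limit.  The
   norm of the completion is dotH1_norm. *)
definition in_dotH1 :: "vfield \<Rightarrow> bool" where
  "in_dotH1 w \<longleftrightarrow> loc_integrable w \<and>
     (\<exists>\<phi>::nat \<Rightarrow> vfield. (\<forall>n. test_fun (\<phi> n)) \<and>
        (\<forall>e>0. \<exists>N. \<forall>m\<ge>N. \<forall>n\<ge>N.
           l2_norm (\<lambda>x. classical_grad (\<phi> m) x - classical_grad (\<phi> n) x) < e) \<and>
        (\<forall>C. compact C \<longrightarrow>
           (\<lambda>n. LINT x:C|lebesgue. norm (\<phi> n x - w x)) \<longlonglongrightarrow> 0))"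

definition dotH1_norm :: "vfield \<Rightarrow> real" where
  "dotH1_norm w = l2_norm (weak_grad w)"

definition L2_sigma :: "vfield \<Rightarrow> bool" where
  "L2_sigma w \<longleftrightarrow> in_L2 w \<and> div_free w"

definition H1_sigma :: "vfield \<Rightarrow> bool" where
  "H1_sigma w \<longleftrightarrow> in_H1 w \<and> div_free w"

definition dotH1_sigma :: "vfield \<Rightarrow> bool" where
  "dotH1_sigma w \<longleftrightarrow> in_dotH1 w \<and> div_free w"

section \<open>Landau solutions and Hardy-type functions\<close>

definition landau :: "real \<Rightarrow> vfield" where
  "landau c x = vector
     [2 * ((c * (norm x)\<^sup>2 - 2 * x$1 * norm x + c * (x$1)\<^sup>2) / (norm x * (c * norm x - x$1)\<^sup>2)),
      2 * ((x$2 * (c * x$1 - norm x)) / (norm x * (c * norm x - x$1)\<^sup>2)),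
      2 * ((x$3 * (c * x$1 - norm x)) / (norm x * (c * norm x - x$1)\<^sup>2))]"

(* advect u G is (u . nabla) w when G is the gradient of w. *)
definition advect :: "vfield \<Rightarrow> tfield \<Rightarrow> vfield" where
  "advect u G x = (\<chi> k. \<Sum>j\<in>UNIV. u x $ j * G x $ j $ k)"

(* The values of K on [-1, 1] are irrelevant: the two limits only see 1 < |c|. *)
definition hardy_type :: "(real \<Rightarrow> real) \<Rightarrow> bool" where
  "hardy_type K \<longleftrightarrow>
     (\<forall>c. \<bar>c\<bar> > 1 \<longrightarrow> K c > 0) \<and>
     filterlim K at_top (filtercomap abs (at_right 1)) \<and>
     (K \<longlongrightarrow> 0) (filtercomap abs at_top) \<and>
     (\<forall>c w. \<bar>c\<bar> > 1 \<and> in_dotH1 w \<longrightarrow>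
        integrable lebesgue (\<lambda>x. w x \<bullet> advect w (classical_grad (landau c)) x) \<and>
        \<bar>LINT x|lebesgue. w x \<bullet> advect w (classical_grad (landau c)) x\<bar>
          \<le> K c * (dotH1_norm w)\<^sup>2)"

section \<open>Time-dependent fields and weak solutions\<close>

(* Weak measurability is tested with the dual of the space of divergence-free L^2 fields,
   which is that space itself. *)
definition Linf_weak_L2_sigma :: "real \<Rightarrow> (real \<Rightarrow> vfield) \<Rightarrow> bool" where
  "Linf_weak_L2_sigma T w \<longleftrightarrow>
     (\<forall>t\<in>{0..T}. L2_sigma (w t)) \<and>
     (\<forall>\<psi>. L2_sigma \<psi> \<longrightarrow> (\<lambda>t. l2_inner (w t) \<psi>) \<in> borel_measurable (lebesgue_on {0..T})) \<and>
     (\<exists>M. AE t in lebesgue_on {0..T}. l2_norm (w t) \<le> M)"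

(* The Bochner space: strong measurability is approximation almost everywhere by simple
   functions of time. *)
definition L2_dotH1_sigma :: "real \<Rightarrow> (real \<Rightarrow> vfield) \<Rightarrow> bool" where
  "L2_dotH1_sigma T w \<longleftrightarrow>
     (AE t in lebesgue_on {0..T}. dotH1_sigma (w t)) \<and>
     (\<exists>s::nat \<Rightarrow> real \<Rightarrow> vfield.
        (\<forall>n. simple_function (lebesgue_on {0..T}) (s n) \<and> (\<forall>t\<in>{0..T}. dotH1_sigma (s n t))) \<and>
        (AE t in lebesgue_on {0..T}. (\<lambda>n. dotH1_norm (\<lambda>x. s n t x - w t x)) \<longlonglongrightarrow> 0)) \<and>
     integrable (lebesgue_on {0..T}) (\<lambda>t. (dotH1_norm (w t))\<^sup>2)"

definition X_space :: "real \<Rightarrow> (real \<Rightarrow> vfield) \<Rightarrow> bool" where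
  "X_space T w \<longleftrightarrow> Linf_weak_L2_sigma T w \<and> L2_dotH1_sigma T w"

definition C_H1_sigma :: "(real \<Rightarrow> vfield) \<Rightarrow> bool" where
  "C_H1_sigma \<phi> \<longleftrightarrow> (\<forall>t\<ge>0. H1_sigma (\<phi> t)) \<and>
     (\<forall>t\<ge>0. ((\<lambda>r. H1_norm (\<lambda>x. \<phi> r x - \<phi> t x)) \<longlongrightarrow> 0) (at t within {0..}))"

(* \<phi>' is the time derivative of \<phi> in L^2 (one-sided at time 0). *)
definition C1_L2_sigma :: "(real \<Rightarrow> vfield) \<Rightarrow> (real \<Rightarrow> vfield) \<Rightarrow> bool" where
  "C1_L2_sigma \<phi> \<phi>' \<longleftrightarrow> (\<forall>t\<ge>0. L2_sigma (\<phi> t) \<and> L2_sigma (\<phi>' t)) \<and>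
     (\<forall>t\<ge>0. ((\<lambda>r. l2_norm (\<lambda>x. (\<phi> r x - \<phi> t x) /\<^sub>R (r - t) - \<phi>' t x)) \<longlongrightarrow> 0) (at t within {0..})) \<and>
     (\<forall>t\<ge>0. ((\<lambda>r. l2_norm (\<lambda>x. \<phi>' r x - \<phi>' t x)) \<longlongrightarrow> 0) (at t within {0..}))"

definition weak_solution :: "real \<Rightarrow> vfield \<Rightarrow> (real \<Rightarrow> vfield) \<Rightarrow> bool" where
  "weak_solution c w0 w \<longleftrightarrow>
     (\<forall>t\<ge>0. L2_sigma (w t)) \<and>
     (\<forall>T>0. X_space T w) \<and>
     (AE x in lebesgue. w 0 x = w0 x) \<and>
     (\<forall>\<phi> \<phi>'. C_H1_sigma \<phi> \<and> C1_L2_sigma \<phi> \<phi>' \<longrightarrow>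
       (\<forall>s t. 0 \<le> s \<and> s \<le> t \<longrightarrow>
          l2_inner (w t) (\<phi> t)
          + (LINT \<tau>:{s..t}|lebesgue.
               l2_inner (weak_grad (w \<tau>)) (weak_grad (\<phi> \<tau>))
               + l2_inner (advect (w \<tau>) (weak_grad (w \<tau>))) (\<phi> \<tau>)
               + l2_inner (advect (w \<tau>) (classical_grad (landau c))) (\<phi> \<tau>)
               + l2_inner (advect (landau c) (weak_grad (w \<tau>))) (\<phi> \<tau>))
          = l2_inner (w s) (\<phi> s)
          + (LINT \<tau>:{s..t}|lebesgue. l2_inner (w \<tau>) (\<phi>' \<tau>))))"

definition strong_energy_inequality :: "real \<Rightarrow> (real \<Rightarrow> vfield) \<Rightarrow> bool" where
  "strong_energy_inequality \<kappa> w \<longleftrightarrow>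
     (let E = (\<lambda>s. \<forall>t\<ge>s. (l2_norm (w t))\<^sup>2
                 + 2 * (1 - \<kappa>) * (LINT \<tau>:{s..t}|lebesgue. (dotH1_norm (w \<tau>))\<^sup>2)
                 \<le> (l2_norm (w s))\<^sup>2)
      in E 0 \<and> (AE s in lebesgue. s \<ge> 0 \<longrightarrow> E s))"

end

theory Submission
  imports Defs
begin

text \<open>
  It suffices to test the weak formulation on \<open>[0, t]\<close> with the time-independent field \<open>\<psi> = w(t)\<close>, for
  suitable times \<open>t\<close>.  The energy inequality bounds \<open>\<integral>\<^sub>0\<^sup>\<infinity> \<parallel>\<nabla>w\<parallel>\<^sup>2\<close>, so there are arbitrarily large
  \<open>t\<close> with \<open>t \<parallel>\<nabla>w(t)\<parallel>\<^sup>2\<close> as small as desired.  By Hardy's inequality and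
  \<open>\<bar>v\<^sub>c\<bar> \<le> C / \<bar>x\<bar>\<close>, \<open>\<bar>\<nabla>v\<^sub>c\<bar> \<le> C / \<bar>x\<bar>\<^sup>2\<close>, all linear terms are at most
  \<open>C' \<parallel>\<nabla>w(\<tau>)\<parallel> \<parallel>\<nabla>\<psi>\<parallel>\<close>, whose time integral is \<open>O(\<surd>t \<parallel>\<nabla>\<psi>\<parallel>)\<close>; by Sobolev's inequality the
  quadratic term is at most \<open>C' \<parallel>\<nabla>w(\<tau>)\<parallel>\<^sup>2 (\<parallel>\<psi>\<parallel> \<parallel>\<nabla>\<psi>\<parallel>)\<^bsup>1/2\<^esup>\<close>.  Hence
  \<open>\<parallel>w(t)\<parallel>\<^sup>2 \<le> \<bar>(w(0), w(t))\<bar> + o(1)\<close> along such times, and \<open>(w(0), w(t))\<close> tends to 0 because, by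
  Hardy again, \<open>w(t)\<close> is small in \<open>L\<^sup>2\<close> on every fixed ball.  The energy inequality started at these
  times makes the smallness persist.
\<close>

section \<open>Integration by parts for test functions\<close>

text \<open>A test field has to be continuous in time with values in H^1, which \<open>w\<close> is
  not known to be, so \<open>w\<close> cannot be tested against itself. A single value w(t), frozen
  in time, is admissible for almost every t; the price is the inner product (w(0), w(t)) in place of
  a square. Freezing costs a factor sqrt t in the linear terms, which is why t ||grad w(t)||^2 and
  not just ||grad w(t)|| has to be small. The homogeneous Sobolev space consists of local L^1 limits
  of test fields with Cauchy gradients, and \<open>weak_grad\<close> is a choice operator. Hence the
  uniqueness of weak gradients, the completeness of L^2 and a Fatou argument that carries Hardy's
  and Sobolev's inequalities from test fields to their limits. Of all constants only the finiteness
  matters. Since the integral of a non-integrable function is 0 by convention, a pointwise majorant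
  bounds the time integrals without any measurability in time.\<close>

lemma integrable_continuous_bounded_support:
  fixes f :: "'a::euclidean_space \<Rightarrow> 'b::{banach, second_countable_topology}"
  assumes "continuous_on UNIV f" and supp: "\<And>x. norm x > R \<Longrightarrow> f x = 0"
  shows "integrable lborel f"
proof -
  have "integrable lborel (\<lambda>x. indicator (cball 0 R) x *\<^sub>R f x)"
    using assms(1) by (intro borel_integrable_compact) (auto intro: continuous_on_subset)
  also have "(\<lambda>x. indicator (cball 0 R) x *\<^sub>R f x) = f"
    using supp by (auto simp: indicator_def fun_eq_iff)
  finally show ?thesis .
qed

lemma bounded_continuous_bounded_support:
  fixes f :: "'a::euclidean_space \<Rightarrow> 'b::real_normed_vector"
  assumes "continuous_on UNIV f" and supp: "\<And>x. norm x > R \<Longrightarrow> f x = 0"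
  obtains M where "M > 0" "\<And>x. norm (f x) \<le> M"
proof -
  have "compact (f ` cball 0 R)"
    using assms(1) by (intro compact_continuous_image) (auto intro: continuous_on_subset)
  then obtain M where "M > 0" and M: "\<And>y. y \<in> f ` cball 0 R \<Longrightarrow> norm y \<le> M"
    using bounded_pos compact_imp_bounded by metis
  moreover have "norm (f x) \<le> M" for x
    using M[of "f x"] supp[of x] \<open>M > 0\<close> by (cases "norm x \<le> R") auto
  ultimately show ?thesis using that by blast
qed

lemma has_derivative_zero_outside_support:
  fixes f :: "'a::euclidean_space \<Rightarrow> 'b::real_normed_vector"
  assumes "(f has_derivative f') (at x)" and supp: "\<And>x. norm x > R \<Longrightarrow> f x = 0" and "norm x > R"
  shows "f' h = 0"
proof -
  have "open {y::'a. norm y > R}"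
    by (intro open_Collect_less continuous_intros)
  then have "(f has_derivative (\<lambda>_. 0)) (at x)"
    by (rule has_derivative_transform_within_open[OF has_derivative_const[of 0]])
       (use assms in auto)
  from has_derivative_unique[OF this assms(1)] show ?thesis
    by (metis)
qed

text \<open>Translation invariance: every difference quotient of \<open>f\<close> has integral 0,
  and dominated convergence passes this to the derivative. No iterated integration is
  involved.\<close>

lemma integral_directional_derivative_zero:
  fixes f :: "'a::euclidean_space \<Rightarrow> real"
  assumes der: "\<And>x. (f has_derivative f' x) (at x)"
    and cont: "continuous_on UNIV (\<lambda>x. f' x e)"
    and supp: "\<And>x. norm x > R \<Longrightarrow> f x = 0"
  shows "(LINT x|lborel. f' x e) = 0"
proof -
  have cf: "continuous_on UNIV f"
    using der by (meson continuous_at_imp_continuous_on has_derivative_continuous)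
  then have [measurable]: "f \<in> borel_measurable borel"
    by (rule borel_measurable_continuous_onI)
  have [measurable]: "(\<lambda>x. f' x e) \<in> borel_measurable borel"
    using cont by (rule borel_measurable_continuous_onI)
  have supp': "f' x e = 0" if "norm x > R" for x
    using has_derivative_zero_outside_support[OF der supp that] .
  obtain M where "M > 0" and M: "\<And>x. norm (f' x e) \<le> M"
    using bounded_continuous_bounded_support[OF cont supp'] by blast
  define s where "s n x = real (Suc n) * (f (x + e /\<^sub>R real (Suc n)) - f x)" for n x
  have lim: "(\<lambda>n. s n x) \<longlonglongrightarrow> f' x e" for x
  proof -
    have "((\<lambda>t. f (x + t *\<^sub>R e)) has_derivative (\<lambda>t. f' x (t *\<^sub>R e))) (at 0)"
      by (rule has_derivative_compose[of "\<lambda>t. x + t *\<^sub>R e", where g = f])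
         (auto intro!: derivative_eq_intros der)
    moreover have "(\<lambda>t. f' x (t *\<^sub>R e)) = (\<lambda>t. f' x e * t)"
      using linear_scale[OF has_derivative_linear[OF der[of x]]] by (auto simp: mult.commute)
    ultimately have "((\<lambda>t. f (x + t *\<^sub>R e)) has_field_derivative f' x e) (at 0)"
      by (simp add: has_field_derivative_def)
    then have "((\<lambda>t. (f (x + t *\<^sub>R e) - f x) / t) \<longlongrightarrow> f' x e) (at 0)"
      by (simp add: has_field_derivative_iff)
    moreover have "filterlim (\<lambda>n. inverse (real (Suc n))) (at 0) sequentially"
      using LIMSEQ_inverse_real_of_nat by (simp add: filterlim_at)
    ultimately have "(\<lambda>n. (f (x + inverse (real (Suc n)) *\<^sub>R e) - f x) / inverse (real (Suc n))) \<longlonglongrightarrow> f' x e"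
      by (rule filterlim_compose)
    then show ?thesis
      by (simp add: s_def[abs_def] divide_inverse mult.commute)
  qed
  \<comment> \<open>The shift \<open>e /\<^sub>R real (Suc n)\<close> is no longer than
    \<open>e\<close>, so all quotients vanish outside the ball of radius \<open>R + norm e\<close>;
    inside it the mean value theorem bounds them by \<open>M\<close>.\<close>
  have bnd: "norm (s n x) \<le> M * indicator (cball 0 (R + norm e)) x" for n x
  proof (cases "norm x \<le> R + norm e")
    case True
    define h where "h = 1 / real (Suc n)"
    have h: "h > 0" by (simp add: h_def)
    have d: "((\<lambda>t. f (x + t *\<^sub>R e)) has_field_derivative f' (x + t *\<^sub>R e) e) (at t)" for t
    proof -
      have "((\<lambda>t. f (x + t *\<^sub>R e)) has_derivative (\<lambda>u. f' (x + t *\<^sub>R e) (u *\<^sub>R e))) (at t)"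
        by (rule has_derivative_compose[of "\<lambda>t. x + t *\<^sub>R e", where g = f])
           (auto intro!: derivative_eq_intros der)
      moreover have "(\<lambda>u. f' (x + t *\<^sub>R e) (u *\<^sub>R e)) = (\<lambda>u. f' (x + t *\<^sub>R e) e * u)"
        using linear_scale[OF has_derivative_linear[OF der[of "x + t *\<^sub>R e"]]] by (auto simp: mult.commute)
      ultimately show ?thesis by (simp add: has_field_derivative_def)
    qed
    have "\<exists>z>0. z < h \<and> f (x + h *\<^sub>R e) - f (x + 0 *\<^sub>R e) = (h - 0) * f' (x + z *\<^sub>R e) e"
      by (rule MVT2[OF h]) (rule d)
    then obtain z where "f (x + h *\<^sub>R e) - f x = h * f' (x + z *\<^sub>R e) e" by auto
    then have "s n x = f' (x + z *\<^sub>R e) e"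
      by (simp add: s_def h_def divide_inverse)
    then show ?thesis using M True by simp
  next
    case False
    have "norm (e /\<^sub>R real (Suc n)) \<le> norm e"
      by (simp add: divide_simps mult_left_le_one_le mult_le_cancel_left1 add_pos_nonneg)
    then have "norm (x + e /\<^sub>R real (Suc n)) > R"
      using False norm_triangle_ineq4[of "x + e /\<^sub>R real (Suc n)" "e /\<^sub>R real (Suc n)"] by simp
    moreover have "norm x > R" using False by (smt (verit) norm_ge_zero)
    ultimately show ?thesis using supp \<open>M > 0\<close> by (simp add: s_def)
  qed
  have int_f: "integrable lborel f"
    by (rule integrable_continuous_bounded_support[OF cf supp])
  have sh: "integrable lborel (\<lambda>x. f (x + a))" "(LINT x|lborel. f (x + a)) = (LINT x|lborel. f x)" for a
    using int_f integrable_distr_eq[of "(+) a" lborel borel f] integral_distr[of "(+) a" lborel borel f]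
    by (simp_all add: lborel_distr_plus add.commute)
  have "(LINT x|lborel. s n x) = 0" for n
    unfolding s_def using sh[of "e /\<^sub>R real (Suc n)"] int_f by simp
  moreover have "(\<lambda>n. LINT x|lborel. s n x) \<longlonglongrightarrow> (LINT x|lborel. f' x e)"
  proof (rule integral_dominated_convergence)
    show "integrable lborel (\<lambda>x::'a. M * indicator (cball 0 (R + norm e)) x)"
      by (intro integrable_mult_right integrable_real_indicator) (use emeasure_lborel_cball_finite[of "0::'a" "R + norm e"] in auto)
    show "AE x in lborel. (\<lambda>n. s n x) \<longlonglongrightarrow> f' x e" using lim by simp
    show "AE x in lborel. norm (s n x) \<le> M * indicator (cball 0 (R + norm e)) x" for n
      using bnd by simp
    show "s n \<in> borel_measurable lborel" for n unfolding s_def by measurable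
  qed simp
  ultimately show ?thesis by (simp add: LIMSEQ_const_iff)
qed

section \<open>Test functions: derivatives, supports, gradients\<close>

lemma test_fun_Ck: "test_fun f \<Longrightarrow> Ck n f"
  by (simp add: test_fun_def)

lemma test_fun_has_derivative:
  "test_fun f \<Longrightarrow> (f has_derivative frechet_derivative f (at x)) (at x)"
  using test_fun_Ck[of f 1] by (simp add: frechet_derivative_works[symmetric])

lemma test_fun_continuous: "test_fun f \<Longrightarrow> continuous_on UNIV f"
  using test_fun_Ck[of f 0] by simp

lemma test_fun_bounded_support:
  assumes "test_fun f"
  obtains R where "\<And>x. norm x > R \<Longrightarrow> f x = 0"
proof -
  have "bounded (closure {x. f x \<noteq> 0})"
    using assms by (simp add: test_fun_def compact_imp_bounded)
  then have "bounded {x. f x \<noteq> 0}"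
    using bounded_subset closure_subset by blast
  then obtain R where "\<And>x. f x \<noteq> 0 \<Longrightarrow> norm x \<le> R"
    by (auto simp: bounded_iff)
  then show ?thesis using that[of R] by force
qed

lemma test_funI:
  assumes "\<And>n. Ck n f" "\<And>x. norm x > R \<Longrightarrow> f x = 0"
  shows "test_fun f"
proof -
  have "bounded {x. f x \<noteq> 0}"
    unfolding bounded_iff using assms(2) by (intro exI[of _ R]) force
  then show ?thesis using assms(1) by (simp add: test_fun_def compact_closure)
qed

lemma test_fun_partial:
  assumes "test_fun f"
  shows "test_fun (partial j f)"
proof -
  obtain R where R: "\<And>x. norm x > R \<Longrightarrow> f x = 0" using test_fun_bounded_support[OF assms] by blast
  show ?thesis
  proof (rule test_funI[of _ R])
    show "Ck n (partial j f)" for n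
      using test_fun_Ck[OF assms, of "Suc n"] by (simp add: partial_def[abs_def])
    show "partial j f x = 0" if "norm x > R" for x
      unfolding partial_def
      by (rule has_derivative_zero_outside_support[OF test_fun_has_derivative[OF assms] R that])
  qed
qed

lemma classical_grad_row: "classical_grad v x $ j = partial j v x"
  by (simp add: classical_grad_def vec_eq_iff)

lemma continuous_classical_grad:
  assumes "test_fun \<phi>"
  shows "continuous_on UNIV (classical_grad \<phi>)"
proof -
  have "continuous_on UNIV (\<lambda>x. \<chi> j. partial j \<phi> x)"
    using test_fun_continuous[OF test_fun_partial[OF assms]]
    by (intro continuous_on_vec_lambda) auto
  also have "(\<lambda>x. \<chi> j. partial j \<phi> x) = classical_grad \<phi>"
    by (simp add: fun_eq_iff vec_eq_iff classical_grad_row)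
  finally show ?thesis .
qed

lemma classical_grad_bounded_support:
  assumes "test_fun \<phi>"
  obtains R where "\<And>x. norm x > R \<Longrightarrow> \<phi> x = 0" "\<And>x. norm x > R \<Longrightarrow> classical_grad \<phi> x = 0"
proof -
  obtain R where R: "\<And>x. norm x > R \<Longrightarrow> \<phi> x = 0" using test_fun_bounded_support[OF assms] by blast
  moreover have "classical_grad \<phi> x = 0" if "norm x > R" for x
    using has_derivative_zero_outside_support[OF test_fun_has_derivative[OF assms] R that]
    by (simp add: vec_eq_iff[of "classical_grad \<phi> x"] classical_grad_row partial_def)
  ultimately show ?thesis using that by blast
qed

text \<open>Cauchy-Schwarz in the row index, the norm of \<open>A\<close> being the Euclidean norm
  of its row norms; for matrices this is the Frobenius norm.\<close>

lemma norm_sum_scaleR_rows_le: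
  fixes A :: "'a::real_normed_vector^'n"
  shows "norm (\<Sum>j\<in>UNIV. u $ j *\<^sub>R A $ j) \<le> norm u * norm A"
proof -
  have "norm (\<Sum>j\<in>UNIV. u $ j *\<^sub>R A $ j) \<le> (\<Sum>j\<in>UNIV. \<bar>norm (u $ j)\<bar> * \<bar>norm (A $ j)\<bar>)"
    by (rule order_trans[OF norm_sum]) simp
  also have "\<dots> \<le> norm u * norm A"
    unfolding norm_vec_def by (rule L2_set_mult_ineq)
  finally show ?thesis .
qed

lemma norm_advect_le: "norm (advect u G x) \<le> norm (u x) * norm (G x)"
proof -
  have "advect u G x = (\<Sum>j\<in>UNIV. u x $ j *\<^sub>R G x $ j)"
    by (simp add: advect_def vec_eq_iff sum_component)
  then show ?thesis by (simp add: norm_sum_scaleR_rows_le)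
qed

text \<open>By the product rule the two integrands add up to a directional derivative of a compactly
  supported function, whose integral vanishes.\<close>

lemma integral_by_parts_test_fun:
  fixes \<phi> :: vfield and \<eta> :: "real^3 \<Rightarrow> real"
  assumes "test_fun \<phi>" "test_fun \<eta>"
  shows "(LINT x|lborel. \<phi> x $ k * partial j \<eta> x) = - (LINT x|lborel. classical_grad \<phi> x $ j $ k * \<eta> x)"
proof -
  define f' where "f' x h = \<phi> x $ k * frechet_derivative \<eta> (at x) h + frechet_derivative \<phi> (at x) h $ k * \<eta> x" for x h
  obtain R where R: "\<And>x. norm x > R \<Longrightarrow> \<eta> x = 0" using test_fun_bounded_support[OF assms(2)] by blast
  have R': "partial j \<eta> x = 0" if "norm x > R" for x
    unfolding partial_def
    by (rule has_derivative_zero_outside_support[OF test_fun_has_derivative[OF assms(2)] R that])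
  note c = test_fun_continuous[OF assms(1)] test_fun_continuous[OF assms(2)]
    test_fun_continuous[OF test_fun_partial[OF assms(1)], of j] test_fun_continuous[OF test_fun_partial[OF assms(2)], of j]
  have d: "((\<lambda>x. \<phi> x $ k * \<eta> x) has_derivative f' x) (at x)" for x
    unfolding f'_def
    by (rule derivative_eq_intros test_fun_has_derivative[OF assms(1)] test_fun_has_derivative[OF assms(2)] bounded_linear.has_derivative[OF bounded_linear_vec_nth])+ simp
  have e: "f' x (axis j 1) = \<phi> x $ k * partial j \<eta> x + classical_grad \<phi> x $ j $ k * \<eta> x" for x
    by (simp add: f'_def classical_grad_row partial_def)
  have "(LINT x|lborel. f' x (axis j 1)) = 0"
    by (rule integral_directional_derivative_zero[OF d, of _ R])
       (use R in \<open>auto simp: e classical_grad_row intro!: continuous_intros c\<close>)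
  moreover have "integrable lborel (\<lambda>x. \<phi> x $ k * partial j \<eta> x)" "integrable lborel (\<lambda>x. classical_grad \<phi> x $ j $ k * \<eta> x)"
    using R R' by (auto intro!: integrable_continuous_bounded_support[of _ R] continuous_intros c simp: classical_grad_row)
  ultimately show ?thesis by (simp add: e)
qed

section \<open>Smooth bump functions\<close>

text \<open>The classical flat function exp(-1/t) with a polynomial factor in 1/t. The factor makes
  the family closed under differentiation, so that smoothness at 0 takes a single
  computation.\<close>

definition flat :: "real poly \<Rightarrow> real \<Rightarrow> real" where
  "flat p t = (if t > 0 then poly p (1 / t) * exp (- (1 / t)) else 0)"

lemma poly_div_exp_tendsto_0: "((\<lambda>s::real. poly p s / exp s) \<longlongrightarrow> 0) at_top"
proof -
  have "((\<lambda>s::real. \<Sum>i\<le>degree p. coeff p i * (s ^ i / exp s)) \<longlongrightarrow> (\<Sum>i\<le>degree p. coeff p i * 0)) at_top"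
    by (intro tendsto_intros tendsto_power_div_exp_0)
  moreover have "(\<lambda>s::real. \<Sum>i\<le>degree p. coeff p i * (s ^ i / exp s)) = (\<lambda>s. poly p s / exp s)"
    by (simp add: poly_altdef sum_divide_distrib)
  ultimately show ?thesis by simp
qed

text \<open>With s = 1/t, the derivative of p(s) exp(-s) in t is s^2 (p(s) - p'(s)) exp(-s), and
  \<open>monom 1 2\<close> is the factor s^2. At t = 0 the exponential beats every
  polynomial.\<close>

lemma flat_has_real_derivative:
  "(flat p has_real_derivative flat (monom 1 2 * (p - pderiv p)) t) (at t)"
proof -
  consider "t > 0" | "t < 0" | "t = 0" by linarith
  then show ?thesis
  proof cases
    case 1
    have "((\<lambda>t. poly p (1 / t) * exp (- (1 / t))) has_real_derivative
        flat (monom 1 2 * (p - pderiv p)) t) (at t)"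
      using 1 by (auto intro!: derivative_eq_intros DERIV_chain'[where g = "poly p", OF _ poly_DERIV]
          simp: flat_def poly_monom field_simps power2_eq_square)
    then show ?thesis
      by (rule DERIV_cong_ev[THEN iffD1, OF refl _ refl, rotated])
         (use 1 in \<open>auto simp: flat_def intro!: eventually_mono[OF eventually_nhds_in_open[of "{0<..}"]]\<close>)
  next
    case 2
    have "((\<lambda>_. 0) has_real_derivative flat (monom 1 2 * (p - pderiv p)) t) (at t)"
      using 2 by (simp add: flat_def)
    then show ?thesis
      by (rule DERIV_cong_ev[THEN iffD1, OF refl _ refl, rotated])
         (use 2 in \<open>auto simp: flat_def intro!: eventually_mono[OF eventually_nhds_in_open[of "{..<0}"]]\<close>)
  next
    case 3
    \<comment> \<open>For h > 0 and s = 1/h the quotient \<open>flat p h / h\<close> is s p(s) / exp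
      s, and \<open>pCons 0 p\<close> is the polynomial s p(s).\<close>
    have "((\<lambda>h. poly (pCons 0 p) (inverse h) / exp (inverse h)) \<longlongrightarrow> 0) (at_right 0)"
      by (rule filterlim_compose[OF poly_div_exp_tendsto_0 filterlim_inverse_at_top_right])
    then have "((\<lambda>h. flat p h / h) \<longlongrightarrow> 0) (at_right 0)"
      by (rule Lim_transform_eventually)
         (auto simp: eventually_at_right_field flat_def exp_minus divide_inverse intro!: exI[of _ 1])
    moreover have "((\<lambda>h. flat p h / h) \<longlongrightarrow> 0) (at_left 0)"
      by (rule tendsto_eventually) (auto simp: eventually_at_left_field flat_def intro!: exI[of _ "-1"])
    ultimately have "((\<lambda>h. flat p h / h) \<longlongrightarrow> 0) (at 0)"
      by (simp add: filterlim_split_at)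
    then show ?thesis
      using 3 by (simp add: has_field_derivative_iff flat_def)
  qed
qed

text \<open>\<open>Ck\<close> recurses through directional derivatives, so smoothness comes cheaply
  for a class of differentiable functions closed under them. Sums belong to the class because the
  product rule creates them.\<close>

inductive flat_algebra :: "('a::real_inner \<Rightarrow> real) \<Rightarrow> bool" where
  flat: "flat_algebra (\<lambda>x. flat p (u \<bullet> x + r))"
| add: "flat_algebra f \<Longrightarrow> flat_algebra g \<Longrightarrow> flat_algebra (\<lambda>x. f x + g x)"
| mult: "flat_algebra f \<Longrightarrow> flat_algebra g \<Longrightarrow> flat_algebra (\<lambda>x. f x * g x)"

lemma flat_algebra_derivative:
  "flat_algebra f \<Longrightarrow> \<exists>f'. (\<forall>x. (f has_derivative f' x) (at x)) \<and> (\<forall>e. flat_algebra (\<lambda>x. f' x e))"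
proof (induction rule: flat_algebra.induct)
  case (flat p u r)
  define q where "q = monom 1 2 * (p - pderiv p)"
  show ?case
  proof (intro exI conjI allI)
    \<comment> \<open>The derivative \<open>u \<bullet> h\<close> of the affine argument is absorbed
      into the polynomial by \<open>smult\<close>; thus constants need not belong to the
      class.\<close>
    show "((\<lambda>x. flat p (u \<bullet> x + r)) has_derivative (\<lambda>h. flat (smult (u \<bullet> h) q) (u \<bullet> x + r))) (at x)" for x
      by (rule has_derivative_eq_rhs[OF has_derivative_compose[OF _
            flat_has_real_derivative[unfolded has_field_derivative_def], of "\<lambda>x. u \<bullet> x + r"]])
         (auto intro!: derivative_eq_intros simp: q_def flat_def mult_ac)
    show "flat_algebra (\<lambda>x. flat (smult (u \<bullet> e) q) (u \<bullet> x + r))" for e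
      by (rule flat_algebra.flat)
  qed
next
  case (add f g)
  then obtain f' g' where "\<And>x. (f has_derivative f' x) (at x)" "\<And>e. flat_algebra (\<lambda>x. f' x e)"
    "\<And>x. (g has_derivative g' x) (at x)" "\<And>e. flat_algebra (\<lambda>x. g' x e)" by blast
  then show ?case
    by (intro exI[of _ "\<lambda>x h. f' x h + g' x h"]) (auto intro!: derivative_intros flat_algebra.add)
next
  case (mult f g)
  then obtain f' g' where *: "\<And>x. (f has_derivative f' x) (at x)" "\<And>e. flat_algebra (\<lambda>x. f' x e)"
    "\<And>x. (g has_derivative g' x) (at x)" "\<And>e. flat_algebra (\<lambda>x. g' x e)" by blast
  show ?case
    by (intro exI[of _ "\<lambda>x h. f x * g' x h + f' x h * g x"] conjI allI)
       (intro has_derivative_mult flat_algebra.add flat_algebra.mult mult *)+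
qed

lemma flat_algebra_Ck: "flat_algebra f \<Longrightarrow> Ck n f"
proof (induction n arbitrary: f)
  case 0
  then obtain f' where "\<And>x. (f has_derivative f' x) (at x)" using flat_algebra_derivative by blast
  then show ?case by (auto intro!: continuous_at_imp_continuous_on dest: has_derivative_continuous)
next
  case (Suc n)
  then obtain f' where f': "\<And>x. (f has_derivative f' x) (at x)" "\<And>e. flat_algebra (\<lambda>x. f' x e)"
    using flat_algebra_derivative by blast
  then have "frechet_derivative f (at x) = f' x" for x
    by (metis frechet_derivative_at)
  with f' Suc.IH show ?case by (auto simp: differentiable_def)
qed

text \<open>As \<open>m \<rightarrow> \<infinity>\<close> these test functions increase to the indicator of the open box.\<close>
definition box_bump :: "real^3 \<Rightarrow> real^3 \<Rightarrow> nat \<Rightarrow> real^3 \<Rightarrow> real" where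
  "box_bump a b m x = (\<Prod>i\<in>UNIV. flat 1 (real (Suc m) * (x $ i - a $ i)) * flat 1 (real (Suc m) * (b $ i - x $ i)))"

lemma flat_1_bounds: "0 \<le> flat 1 t" "flat 1 t \<le> 1"
  by (auto simp: flat_def)

lemma box_bump_eq_0:
  assumes "x \<notin> box a b"
  shows "box_bump a b m x = 0"
proof -
  obtain i where "\<not> (a $ i < x $ i \<and> x $ i < b $ i)"
    using assms by (auto simp: mem_box_cart)
  then have "flat 1 (real (Suc m) * (x $ i - a $ i)) * flat 1 (real (Suc m) * (b $ i - x $ i)) = 0"
    by (auto simp: flat_def zero_less_mult_iff)
  then show ?thesis
    unfolding box_bump_def by (intro prod_zero) auto
qed

lemma test_fun_box_bump: "test_fun (box_bump a b m)"
proof (rule test_funI)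
  define f where "f i x = flat 1 ((real (Suc m) *\<^sub>R axis i 1) \<bullet> x + (- real (Suc m) * a $ i))
      * flat 1 ((- real (Suc m) *\<^sub>R axis i 1) \<bullet> x + real (Suc m) * b $ i)" for i :: 3 and x :: "real^3"
  have f: "flat_algebra (f i)" for i
    unfolding f_def[abs_def] by (rule flat_algebra.mult[OF flat_algebra.flat flat_algebra.flat])
  have f_eq: "f i x = flat 1 (real (Suc m) * (x $ i - a $ i)) * flat 1 (real (Suc m) * (b $ i - x $ i))" for i x
    unfolding f_def by (simp only: inner_scaleR_left inner_axis' inner_real_def right_diff_distrib mult_1)
      (simp only: mult_minus_left diff_conv_add_uminus add.commute)
  have "box_bump a b m = (\<lambda>x. \<Prod>i\<in>UNIV. f i x)"
    unfolding f_eq by (rule ext) (rule box_bump_def)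
  also have "\<dots> = (\<lambda>x. f 1 x * (f 2 x * f 3 x))"
    unfolding UNIV_3 by simp
  finally have "box_bump a b m = (\<lambda>x. f 1 x * (f 2 x * f 3 x))" .
  then show "Ck n (box_bump a b m)" for n
    by (simp only:) (intro flat_algebra_Ck flat_algebra.mult f)
  show "box_bump a b m x = 0" if "norm x > norm a + norm b + norm (b - a)" for x
  proof (rule ccontr)
    assume "box_bump a b m x \<noteq> 0"
    then have "x \<in> box a b" using box_bump_eq_0 by blast
    then have "a $ i < x $ i \<and> x $ i < b $ i" for i by (simp add: mem_box_cart)
    then have "\<bar>(x - a) $ i\<bar> \<le> \<bar>(b - a) $ i\<bar>" for i
      by (smt (verit) vector_minus_component)
    then have "norm (x - a) \<le> norm (b - a)"
      by (intro norm_le_componentwise_cart) simp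
    then show False using that norm_triangle_sub[of x a] norm_ge_zero[of b] by linarith
  qed
qed

lemma box_bump_bounds: "0 \<le> box_bump a b m x" "box_bump a b m x \<le> 1"
proof -
  show "0 \<le> box_bump a b m x"
    unfolding box_bump_def by (intro prod_nonneg mult_nonneg_nonneg flat_1_bounds)
  show "box_bump a b m x \<le> 1"
    unfolding box_bump_def by (intro prod_le_1 conjI mult_le_one mult_nonneg_nonneg flat_1_bounds)
qed

lemma box_bump_tendsto: "(\<lambda>m. box_bump a b m x) \<longlonglongrightarrow> indicator (box a b) x"
proof (cases "x \<in> box a b")
  case True
  have flat: "(\<lambda>m. flat 1 (real (Suc m) * t)) \<longlonglongrightarrow> 1" if "t > 0" for t
  proof -
    have "(\<lambda>m. exp (- (inverse (real (Suc m)) * inverse t))) \<longlonglongrightarrow> exp (- (0 * inverse t))"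
      by (intro tendsto_intros LIMSEQ_inverse_real_of_nat)
    then show ?thesis using that by (simp add: flat_def zero_less_mult_iff divide_inverse mult_ac)
  qed
  have "(\<lambda>m. box_bump a b m x) \<longlonglongrightarrow> (\<Prod>i\<in>(UNIV::3 set). 1 * 1)"
    unfolding box_bump_def using True
    by (intro tendsto_prod tendsto_mult flat) (auto simp: mem_box_cart)
  then show ?thesis using True by simp
qed (simp add: box_bump_eq_0)

section \<open>The space of square-integrable fields\<close>

lemma l2_norm_nonneg: "0 \<le> l2_norm f"
  by (simp add: l2_norm_def)

lemma l2_norm_power2: "(l2_norm f)\<^sup>2 = (LINT x|lebesgue. (norm (f x))\<^sup>2)"
  by (simp add: l2_norm_def)

lemma in_L2_measurable: "in_L2 f \<Longrightarrow> f \<in> borel_measurable lebesgue"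
  by (simp add: in_L2_def)

lemma nn_integral_L2:
  "in_L2 f \<Longrightarrow> (\<integral>\<^sup>+x. ennreal ((norm (f x))\<^sup>2) \<partial>lebesgue) = ennreal ((l2_norm f)\<^sup>2)"
  unfolding l2_norm_power2 by (rule nn_integral_eq_integral) (auto simp: in_L2_def)

text \<open>A bound on a non-negative integral yields membership and norm at once; this is how
  limits obtained from Fatou's lemma return to the space.\<close>

lemma in_L2I_nn_integral:
  assumes "f \<in> borel_measurable lebesgue"
    and "(\<integral>\<^sup>+x. ennreal ((norm (f x))\<^sup>2) \<partial>lebesgue) \<le> ennreal (B\<^sup>2)" and "0 \<le> B"
  shows "in_L2 f" "l2_norm f \<le> B"
proof -
  have "integrable lebesgue (\<lambda>x. (norm (f x))\<^sup>2)"
    using assms by (intro integrableI_nonneg) (auto intro: le_less_trans)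
  then show L2: "in_L2 f" using assms(1) by (simp add: in_L2_def)
  have "ennreal ((l2_norm f)\<^sup>2) \<le> ennreal (B\<^sup>2)"
    using nn_integral_L2[OF L2] assms(2) by simp
  then show "l2_norm f \<le> B"
    using assms(3) by (auto intro: power2_le_imp_le)
qed

lemma in_L2_cong_AE:
  assumes "in_L2 f" "g \<in> borel_measurable lebesgue" "AE x in lebesgue. f x = g x"
  shows "in_L2 g" "l2_norm g = l2_norm f"
proof -
  have ae: "AE x in lebesgue. (norm (f x))\<^sup>2 = (norm (g x))\<^sup>2" using assms(3) by eventually_elim simp
  have [measurable]: "f \<in> borel_measurable lebesgue" "g \<in> borel_measurable lebesgue"
    using assms in_L2_measurable by auto
  show "in_L2 g"
    using assms(1) ae unfolding in_L2_def
    by (auto intro: integrable_cong_AE_imp[of lebesgue "\<lambda>x. (norm (f x))\<^sup>2"])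
  show "l2_norm g = l2_norm f"
    unfolding l2_norm_def using ae by (intro arg_cong[of _ _ sqrt] integral_cong_AE) auto
qed

lemma in_L2_zero: "in_L2 (\<lambda>x. 0)"
  by (simp add: in_L2_def)

lemma l2_norm_zero: "l2_norm (\<lambda>x. 0) = 0"
  by (simp add: l2_norm_def)

lemma l2_norm_minus_commute: "l2_norm (\<lambda>x. f x - g x) = l2_norm (\<lambda>x. g x - f x)"
  by (simp add: l2_norm_def norm_minus_commute)

lemma in_L2_scale_bound:
  assumes "in_L2 g" "f \<in> borel_measurable lebesgue" "AE x in lebesgue. norm (f x) \<le> C * norm (g x)" "0 \<le> C"
  shows "in_L2 f" "l2_norm f \<le> C * l2_norm g"
proof -
  have [measurable]: "g \<in> borel_measurable lebesgue" using assms(1) in_L2_measurable by auto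
  have "(\<integral>\<^sup>+x. ennreal ((norm (f x))\<^sup>2) \<partial>lebesgue) \<le> (\<integral>\<^sup>+x. ennreal (C\<^sup>2) * ennreal ((norm (g x))\<^sup>2) \<partial>lebesgue)"
  proof (rule nn_integral_mono_AE)
    show "AE x in lebesgue. ennreal ((norm (f x))\<^sup>2) \<le> ennreal (C\<^sup>2) * ennreal ((norm (g x))\<^sup>2)"
      using assms(3)
    proof eventually_elim
      case (elim x)
      then have "(norm (f x))\<^sup>2 \<le> (C * norm (g x))\<^sup>2" by (intro power_mono) auto
      then show ?case by (simp add: ennreal_mult[symmetric] power_mult_distrib)
    qed
  qed
  also have "\<dots> = ennreal (C\<^sup>2) * ennreal ((l2_norm g)\<^sup>2)"
    using nn_integral_L2[OF assms(1)] by (simp add: nn_integral_cmult)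
  also have "\<dots> = ennreal ((C * l2_norm g)\<^sup>2)"
    by (simp add: ennreal_mult[symmetric] power_mult_distrib)
  finally show "in_L2 f" "l2_norm f \<le> C * l2_norm g"
    using in_L2I_nn_integral[OF assms(2), of "C * l2_norm g"] assms(4) l2_norm_nonneg[of g] by auto
qed

lemma ennreal_power2_le_imp_le:
  assumes "x\<^sup>2 \<le> (ennreal b)\<^sup>2" "0 \<le> b"
  shows "x \<le> ennreal b"
proof (cases x)
  case (real a)
  then show ?thesis using assms by (auto simp: ennreal_power intro: power2_le_imp_le)
next
  case top
  then have "top \<le> ennreal (b\<^sup>2)"
    using assms by (simp add: ennreal_power power2_eq_square[of top])
  then show ?thesis by (simp add: top_unique)
qed

lemma
  assumes f: "in_L2 f" and g: "in_L2 g"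
  shows L2_integrable_product: "integrable lebesgue (\<lambda>x. norm (f x) * norm (g x))"
    and L2_Cauchy_Schwarz: "(LINT x|lebesgue. norm (f x) * norm (g x)) \<le> l2_norm f * l2_norm g"
proof -
  have [measurable]: "f \<in> borel_measurable lebesgue" "g \<in> borel_measurable lebesgue"
    using assms in_L2_measurable by auto
  have "(\<integral>\<^sup>+x. ennreal (norm (f x) * norm (g x)) \<partial>lebesgue)\<^sup>2
      = (\<integral>\<^sup>+x. ennreal (norm (f x)) * ennreal (norm (g x)) \<partial>lebesgue)\<^sup>2"
    by (simp add: ennreal_mult)
  also have "\<dots> \<le> (\<integral>\<^sup>+x. ennreal (norm (f x)) ^ 2 \<partial>lebesgue) * (\<integral>\<^sup>+x. ennreal (norm (g x)) ^ 2 \<partial>lebesgue)"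
    by (rule Cauchy_Schwarz_nn_integral) auto
  also have "\<dots> = ennreal ((l2_norm f)\<^sup>2) * ennreal ((l2_norm g)\<^sup>2)"
    using nn_integral_L2[OF f] nn_integral_L2[OF g] by (simp add: ennreal_power)
  also have "\<dots> = (ennreal (l2_norm f * l2_norm g))\<^sup>2"
    by (simp add: l2_norm_nonneg ennreal_mult[symmetric] ennreal_power power_mult_distrib)
  finally have le: "(\<integral>\<^sup>+x. ennreal (norm (f x) * norm (g x)) \<partial>lebesgue) \<le> ennreal (l2_norm f * l2_norm g)"
    by (rule ennreal_power2_le_imp_le) (simp add: l2_norm_nonneg)
  then show int: "integrable lebesgue (\<lambda>x. norm (f x) * norm (g x))"
    by (intro integrableI_nonneg) (auto intro: le_less_trans)
  have "ennreal (LINT x|lebesgue. norm (f x) * norm (g x)) \<le> ennreal (l2_norm f * l2_norm g)"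
    using le nn_integral_eq_integral[OF int] by simp
  then show "(LINT x|lebesgue. norm (f x) * norm (g x)) \<le> l2_norm f * l2_norm g"
    by (simp add: l2_norm_nonneg)
qed

text \<open>For non-integrable \<open>h\<close> this relies on the convention that its integral is 0.\<close>
lemma abs_integral_le:
  fixes h g :: "'a \<Rightarrow> real"
  assumes "integrable M g" "AE x in M. \<bar>h x\<bar> \<le> g x"
  shows "\<bar>integral\<^sup>L M h\<bar> \<le> integral\<^sup>L M g"
proof (cases "integrable M h")
  case True
  have "\<bar>integral\<^sup>L M h\<bar> \<le> (LINT x|M. \<bar>h x\<bar>)" by (rule integral_abs_bound)
  also have "\<dots> \<le> integral\<^sup>L M g" using True assms by (intro integral_mono_AE) auto
  finally show ?thesis .
next
  case False
  have "0 \<le> integral\<^sup>L M g"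
    using assms(2) by (intro integral_nonneg_AE) (auto elim!: eventually_mono)
  then show ?thesis using False by (simp add: not_integrable_integral_eq)
qed

lemma L2_abs_integral_le:
  assumes f: "in_L2 f" and g: "in_L2 g" and h: "AE x in lebesgue. \<bar>h x\<bar> \<le> norm (f x) * norm (g x)"
  shows "\<bar>LINT x|lebesgue. h x\<bar> \<le> l2_norm f * l2_norm g"
  using abs_integral_le[OF L2_integrable_product[OF f g] h] L2_Cauchy_Schwarz[OF f g] by linarith

lemma
  assumes f: "in_L2 f" and g: "in_L2 g"
  shows in_L2_add: "in_L2 (\<lambda>x. f x + g x)"
    and l2_norm_triangle: "l2_norm (\<lambda>x. f x + g x) \<le> l2_norm f + l2_norm g"
proof -
  have [measurable]: "f \<in> borel_measurable lebesgue" "g \<in> borel_measurable lebesgue"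
    and int: "integrable lebesgue (\<lambda>x. (norm (f x))\<^sup>2)" "integrable lebesgue (\<lambda>x. (norm (g x))\<^sup>2)"
    using assms by (auto simp: in_L2_def)
  define h where "h x = (norm (f x))\<^sup>2 + 2 * (norm (f x) * norm (g x)) + (norm (g x))\<^sup>2" for x
  have int_h: "integrable lebesgue h"
    unfolding h_def using int L2_integrable_product[OF f g] by auto
  have le: "(norm (f x + g x))\<^sup>2 \<le> h x" for x
  proof -
    have "(norm (f x + g x))\<^sup>2 \<le> (norm (f x) + norm (g x))\<^sup>2"
      by (intro power_mono norm_triangle_ineq) auto
    then show ?thesis by (simp add: h_def power2_sum)
  qed
  have int_fg: "integrable lebesgue (\<lambda>x. (norm (f x + g x))\<^sup>2)"
    by (rule Bochner_Integration.integrable_bound[OF int_h]) (use le in \<open>auto intro: order_trans abs_ge_self\<close>)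
  then show "in_L2 (\<lambda>x. f x + g x)" by (simp add: in_L2_def)
  have "(l2_norm (\<lambda>x. f x + g x))\<^sup>2 \<le> integral\<^sup>L lebesgue h"
    unfolding l2_norm_power2 using le int_fg int_h by (intro integral_mono) auto
  also have "\<dots> = (l2_norm f)\<^sup>2 + 2 * (LINT x|lebesgue. norm (f x) * norm (g x)) + (l2_norm g)\<^sup>2"
    unfolding h_def l2_norm_power2 using int L2_integrable_product[OF f g] by simp
  also have "\<dots> \<le> (l2_norm f + l2_norm g)\<^sup>2"
    using L2_Cauchy_Schwarz[OF f g] by (simp add: power2_sum)
  finally show "l2_norm (\<lambda>x. f x + g x) \<le> l2_norm f + l2_norm g"
    by (rule power2_le_imp_le) (simp add: l2_norm_nonneg)
qed

lemma in_L2_uminus: "in_L2 f \<Longrightarrow> in_L2 (\<lambda>x. - f x)"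
  by (simp add: in_L2_def)

lemma in_L2_diff: "in_L2 f \<Longrightarrow> in_L2 g \<Longrightarrow> in_L2 (\<lambda>x. f x - g x)"
  using in_L2_add[of f "\<lambda>x. - g x"] in_L2_uminus[of g] by simp

lemma l2_norm_le_add_diff:
  assumes "in_L2 f" "in_L2 g"
  shows "l2_norm f \<le> l2_norm g + l2_norm (\<lambda>x. f x - g x)"
  using l2_norm_triangle[OF assms(2) in_L2_diff[OF assms]] by simp

lemma tendsto_l2_norm:
  assumes "\<And>n. in_L2 (f n)" "in_L2 g" "(\<lambda>n. l2_norm (\<lambda>x. f n x - g x)) \<longlonglongrightarrow> 0"
  shows "(\<lambda>n. l2_norm (f n)) \<longlonglongrightarrow> l2_norm g"
proof (rule LIMSEQ_I)
  fix e :: real assume "e > 0"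
  then obtain N where N: "\<And>n. n \<ge> N \<Longrightarrow> l2_norm (\<lambda>x. f n x - g x) < e"
    using order_tendstoD(2)[OF assms(3), of e] by (auto simp: eventually_sequentially)
  have "norm (l2_norm (f n) - l2_norm g) < e" if "n \<ge> N" for n
    using N[OF that] l2_norm_le_add_diff[OF assms(1)[of n] assms(2)] l2_norm_le_add_diff[OF assms(2) assms(1)[of n]]
      l2_norm_minus_commute[of g "f n"] by auto
  then show "\<exists>N. \<forall>n\<ge>N. norm (l2_norm (f n) - l2_norm g) < e" by blast
qed

lemma summable_norm_telescope_convergent:
  fixes u :: "nat \<Rightarrow> 'b::banach"
  assumes "summable (\<lambda>k. norm (u (Suc k) - u k))"
  shows "convergent u"
proof -
  have "summable (\<lambda>k. u (Suc k) - u k)" using assms by (rule summable_norm_cancel)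
  then have "convergent (\<lambda>n. \<Sum>k<n. u (Suc k) - u k)" by (simp add: summable_iff_convergent)
  then have "convergent (\<lambda>n. u n - u 0)" by (simp add: sum_lessThan_telescope)
  then show ?thesis by (simp add: convergent_diff_const_right_iff)
qed

text \<open>Riesz-Fischer: a subsequence with geometrically small increments converges almost
  everywhere, and Fatou's lemma identifies the pointwise limit as the limit in norm.\<close>

lemma L2_complete:
  fixes f :: "nat \<Rightarrow> real^3 \<Rightarrow> 'b::euclidean_space"
  assumes L2: "\<And>n. in_L2 (f n)"
    and cauchy: "\<And>e. e > 0 \<Longrightarrow> \<exists>N. \<forall>m\<ge>N. \<forall>n\<ge>N. l2_norm (\<lambda>x. f m x - f n x) < e"
  obtains g where "in_L2 g" "(\<lambda>n. l2_norm (\<lambda>x. f n x - g x)) \<longlonglongrightarrow> 0"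
proof -
  have [measurable]: "f n \<in> borel_measurable lebesgue" for n using L2 in_L2_measurable by auto
  have "\<exists>N. \<forall>m\<ge>N. \<forall>n\<ge>N. l2_norm (\<lambda>x. f m x - f n x) < (1/4) ^ k" for k :: nat
    by (rule cauchy) simp
  then obtain N where N: "\<And>k m n. m \<ge> N k \<Longrightarrow> n \<ge> N k \<Longrightarrow> l2_norm (\<lambda>x. f m x - f n x) < (1/4) ^ k"
    by metis
  \<comment> \<open>A partial sum dominates each of its terms, so all indices \<open>r l\<close>
    with l \<ge> k are at least \<open>N k\<close>.\<close>
  define r where "r k = (\<Sum>i\<le>k. N i)" for k
  have r: "N k \<le> r l" if "k \<le> l" for k l
    using member_le_sum[of k "{..l}" N] that by (simp add: r_def)
  define d where "d k x = f (r (Suc k)) x - f (r k) x" for k x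
  have [measurable]: "d k \<in> borel_measurable lebesgue" for k unfolding d_def by measurable
  have dL2: "in_L2 (d k)" for k unfolding d_def by (intro in_L2_diff L2)
  have dle: "l2_norm (d k) < (1/4) ^ k" for k
    unfolding d_def by (rule N) (auto intro: r)
  \<comment> \<open>The weight 4^k turns squared increments below 16^-k into the summable 4^-k, and
    still forces pointwise increments of order 2^-k almost everywhere.\<close>
  have "(\<integral>\<^sup>+x. (\<Sum>k. ennreal (4 ^ k * (norm (d k x))\<^sup>2)) \<partial>lebesgue)
      = (\<Sum>k. \<integral>\<^sup>+x. ennreal (4 ^ k * (norm (d k x))\<^sup>2) \<partial>lebesgue)"
    by (rule nn_integral_suminf) measurable
  also have "\<dots> \<le> (\<Sum>k. ennreal ((1/4) ^ k))"
  proof (rule suminf_le)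
    fix k
    have "(\<integral>\<^sup>+x. ennreal (4 ^ k * (norm (d k x))\<^sup>2) \<partial>lebesgue) = ennreal (4 ^ k) * ennreal ((l2_norm (d k))\<^sup>2)"
      using nn_integral_L2[OF dL2[of k]] by (simp add: ennreal_mult nn_integral_cmult)
    also have "\<dots> \<le> ennreal (4 ^ k) * ennreal (((1/4) ^ k)\<^sup>2)"
      using dle[of k] by (intro mult_left_mono ennreal_leI power_mono) (auto simp: l2_norm_nonneg)
    also have "\<dots> = ennreal (4 ^ k * ((1/4) ^ k)\<^sup>2)" by (simp add: ennreal_mult)
    also have "4 ^ k * ((1/4) ^ k)\<^sup>2 = (1/4 :: real) ^ k"
      by (simp add: power2_eq_square power_divide)
    finally show "(\<integral>\<^sup>+x. ennreal (4 ^ k * (norm (d k x))\<^sup>2) \<partial>lebesgue) \<le> ennreal ((1/4) ^ k)" .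
  qed auto
  also have "\<dots> < \<infinity>"
    by (subst suminf_ennreal2) (auto intro!: summable_geometric)
  finally have "AE x in lebesgue. (\<Sum>k. ennreal (4 ^ k * (norm (d k x))\<^sup>2)) \<noteq> \<infinity>"
    by (intro nn_integral_PInf_AE) auto
  then have conv: "AE x in lebesgue. convergent (\<lambda>k. f (r k) x)"
  proof eventually_elim
    case (elim x)
    then have "summable (\<lambda>k. 4 ^ k * (norm (d k x))\<^sup>2)"
      by (intro summable_suminf_not_top) auto
    then have "Bseq (\<lambda>k. 4 ^ k * (norm (d k x))\<^sup>2)"
      by (rule convergent_imp_Bseq[OF convergentI[OF summable_LIMSEQ_zero]])
    then obtain C where C: "\<And>k. norm (4 ^ k * (norm (d k x))\<^sup>2) \<le> C"
      by (rule BseqE) blast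
    have "norm (d k x) \<le> sqrt C * (1/2) ^ k" for k
    proof -
      have "(2::real) ^ k * 2 ^ k = 4 ^ k" by (subst power_mult_distrib[symmetric]) simp
      then have "(2 ^ k * norm (d k x))\<^sup>2 = 4 ^ k * (norm (d k x))\<^sup>2"
        by (simp only: power_mult_distrib) (simp only: power2_eq_square)
      then have "(2 ^ k * norm (d k x))\<^sup>2 \<le> C" using C[of k] by simp
      then have "2 ^ k * norm (d k x) \<le> sqrt C" by (rule real_le_rsqrt)
      then show ?thesis by (simp add: power_divide field_simps)
    qed
    then have "norm (norm (d k x)) \<le> sqrt C * (1/2) ^ k" for k by simp
    moreover have "summable (\<lambda>k. sqrt C * (1/2) ^ k)"
      by (intro summable_mult summable_geometric) simp
    ultimately have "summable (\<lambda>k. norm (d k x))"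
      by (rule summable_comparison_test'[where N = 0, rotated])
    then show ?case
      unfolding d_def by (rule summable_norm_telescope_convergent)
  qed
  \<comment> \<open>Where the subsequence diverges, on a null set, the value of \<open>lim\<close>
    is unspecified; \<open>g\<close> is measurable all the same.\<close>
  define g where "g x = lim (\<lambda>k. f (r k) x)" for x
  have [measurable]: "g \<in> borel_measurable lebesgue" unfolding g_def by measurable
  have lim: "AE x in lebesgue. (\<lambda>k. f (r k) x) \<longlonglongrightarrow> g x"
    using conv unfolding g_def by eventually_elim (rule convergent_LIMSEQ_iff[THEN iffD1])
  \<comment> \<open>Fatou's lemma along the subsequence, with \<open>n\<close> fixed, gives
    membership and rate together; as \<open>n\<close> ranges over all indices from
    \<open>N k\<close> on, the whole sequence converges.\<close>
  have bound: "in_L2 (\<lambda>x. f n x - g x)" "l2_norm (\<lambda>x. f n x - g x) \<le> (1/4) ^ k" if n: "n \<ge> N k" for n k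
  proof -
    have "(\<integral>\<^sup>+x. ennreal ((norm (f n x - g x))\<^sup>2) \<partial>lebesgue)
        = (\<integral>\<^sup>+x. liminf (\<lambda>l. ennreal ((norm (f n x - f (r l) x))\<^sup>2)) \<partial>lebesgue)"
    proof (rule nn_integral_cong_AE)
      show "AE x in lebesgue. ennreal ((norm (f n x - g x))\<^sup>2) = liminf (\<lambda>l. ennreal ((norm (f n x - f (r l) x))\<^sup>2))"
        using lim
      proof eventually_elim
        case (elim x)
        have "(\<lambda>l. ennreal ((norm (f n x - f (r l) x))\<^sup>2)) \<longlonglongrightarrow> ennreal ((norm (f n x - g x))\<^sup>2)"
          by (intro tendsto_intros elim tendsto_ennrealI)
        then show ?case using lim_imp_Liminf[OF sequentially_bot] by metis
      qed
    qed
    also have "\<dots> \<le> liminf (\<lambda>l. \<integral>\<^sup>+x. ennreal ((norm (f n x - f (r l) x))\<^sup>2) \<partial>lebesgue)"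
      by (rule nn_integral_liminf) measurable
    also have "\<dots> \<le> ennreal (((1/4) ^ k)\<^sup>2)"
    proof (rule Liminf_le)
      show "\<forall>\<^sub>F l in sequentially. (\<integral>\<^sup>+x. ennreal ((norm (f n x - f (r l) x))\<^sup>2) \<partial>lebesgue) \<le> ennreal (((1/4) ^ k)\<^sup>2)"
        using eventually_ge_at_top[of k]
      proof eventually_elim
        case (elim l)
        have "l2_norm (\<lambda>x. f n x - f (r l) x) < (1/4) ^ k"
          using n elim by (intro N) (auto intro: r)
        then show ?case
          by (subst nn_integral_L2[OF in_L2_diff[OF L2 L2]]) (intro ennreal_leI power_mono, auto simp: l2_norm_nonneg)
      qed
    qed simp
    finally show "in_L2 (\<lambda>x. f n x - g x)" "l2_norm (\<lambda>x. f n x - g x) \<le> (1/4) ^ k"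
      using in_L2I_nn_integral[of "\<lambda>x. f n x - g x" "(1/4) ^ k"] by auto
  qed
  show ?thesis
  proof
    have "in_L2 (\<lambda>x. f (N 0) x - (f (N 0) x - g x))"
      by (rule in_L2_diff[OF L2 bound(1)[of 0]]) simp
    then show "in_L2 g" by simp
    show "(\<lambda>n. l2_norm (\<lambda>x. f n x - g x)) \<longlonglongrightarrow> 0"
    proof (rule LIMSEQ_I)
      fix e :: real assume "e > 0"
      then obtain k where "(1/4::real) ^ k < e" using real_arch_pow_inv[of e "1/4"] by auto
      then show "\<exists>M. \<forall>n\<ge>M. norm (l2_norm (\<lambda>x. f n x - g x) - 0) < e"
        using bound(2)[of k] by (intro exI[of _ "N k"] allI impI) (fastforce simp: l2_norm_nonneg)
    qed
  qed
qed

section \<open>Uniqueness of weak gradients\<close>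

text \<open>\<open>ennreal\<close> truncates negative values to 0, so \<open>M1\<close> and
  \<open>M2\<close> have the positive and the negative part of \<open>g\<close> as densities. They
  agree on boxes, an intersection-stable generator, hence everywhere, and densities are unique
  almost everywhere.\<close>

lemma AE_zero_if_box_integrals_zero:
  fixes g :: "'a::euclidean_space \<Rightarrow> real"
  assumes [measurable]: "g \<in> borel_measurable borel"
    and int: "\<And>a b. integrable lborel (\<lambda>x. indicator (box a b) x * g x)"
    and zero: "\<And>a b. (LINT x|lborel. indicator (box a b) x * g x) = 0"
  shows "AE x in lborel. g x = 0"
proof -
  define M1 where "M1 = density lborel (\<lambda>x. ennreal (g x))"
  define M2 where "M2 = density lborel (\<lambda>x. ennreal (- g x))"
  have em: "emeasure M1 (box a b) = emeasure M2 (box a b)" "emeasure M1 (box a b) \<noteq> \<infinity>" for a b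
  proof -
    let ?h = "\<lambda>x. indicator (box a b) x * g x"
    have 1: "emeasure M1 (box a b) = (\<integral>\<^sup>+x. ennreal (?h x) \<partial>lborel)"
      unfolding M1_def by (subst emeasure_density) (auto intro!: nn_integral_cong split: split_indicator)
    have 2: "emeasure M2 (box a b) = (\<integral>\<^sup>+x. ennreal (- ?h x) \<partial>lborel)"
      unfolding M2_def by (subst emeasure_density) (auto intro!: nn_integral_cong split: split_indicator)
    have fin: "(\<integral>\<^sup>+x. ennreal (?h x) \<partial>lborel) \<noteq> \<infinity>" "(\<integral>\<^sup>+x. ennreal (- ?h x) \<partial>lborel) \<noteq> \<infinity>"
      using int[of a b] by (auto simp: real_integrable_def)
    have "enn2real (\<integral>\<^sup>+x. ennreal (?h x) \<partial>lborel) = enn2real (\<integral>\<^sup>+x. ennreal (- ?h x) \<partial>lborel)"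
      using zero[of a b] int[of a b] by (simp add: real_lebesgue_integral_def)
    then have "ennreal (enn2real (\<integral>\<^sup>+x. ennreal (?h x) \<partial>lborel)) = ennreal (enn2real (\<integral>\<^sup>+x. ennreal (- ?h x) \<partial>lborel))"
      by simp
    with fin show "emeasure M1 (box a b) = emeasure M2 (box a b)" "emeasure M1 (box a b) \<noteq> \<infinity>"
      unfolding 1 2 by (simp_all add: ennreal_enn2real_if)
  qed
  have "M1 = M2"
  proof (rule measure_eqI_generator_eq)
    let ?E = "range (\<lambda>(a, b). box a b::'a set)"
    let ?A = "\<lambda>n::nat. box (- (real n *\<^sub>R One)) (real n *\<^sub>R One) :: 'a set"
    show "Int_stable ?E" by (auto simp: Int_stable_def box_Int_box)
    show "?E \<subseteq> Pow UNIV" "sets M1 = sigma_sets UNIV ?E" "sets M2 = sigma_sets UNIV ?E"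
      by (simp_all add: borel_eq_box M1_def M2_def)
    show "range ?A \<subseteq> ?E" "(\<Union>i. ?A i) = UNIV" unfolding UN_box_eq_UNIV by auto
    show "emeasure M1 X = emeasure M2 X" if "X \<in> ?E" for X using that em(1) by auto
    show "emeasure M1 (?A i) \<noteq> \<infinity>" for i by (rule em(2))
  qed
  then have "AE x in lborel. ennreal (g x) = ennreal (- g x)"
    unfolding M1_def M2_def by (intro sigma_finite_measure.density_unique[OF sigma_finite_lborel]) auto
  then show ?thesis
  proof eventually_elim
    case (elim x)
    then show ?case by (cases "g x \<ge> 0"; cases "- g x \<ge> 0") (auto simp: ennreal_neg ennreal_eq_0_iff dest: sym)
  qed
qed

section \<open>Locally integrable functions and the fundamental lemma of the calculus of
  variations\<close>

lemma loc_integrableD: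
  "loc_integrable f \<Longrightarrow> compact C \<Longrightarrow> integrable lebesgue (\<lambda>x. indicator C x *\<^sub>R f x)"
  by (simp add: loc_integrable_def set_integrable_def)

lemma loc_integrable_measurable:
  fixes f :: "real^3 \<Rightarrow> 'b::euclidean_space"
  assumes "loc_integrable f"
  shows "f \<in> borel_measurable lebesgue"
proof (rule borel_measurable_LIMSEQ_metric)
  show "(\<lambda>x. indicator (cball 0 (real n)) x *\<^sub>R f x) \<in> borel_measurable lebesgue" for n
    by (rule borel_measurable_integrable[OF loc_integrableD[OF assms compact_cball]])
  fix x :: "real^3"
  obtain n0 where "norm x \<le> real n0" using real_arch_simple by blast
  then have "\<forall>\<^sub>F n in sequentially. indicator (cball 0 (real n)) x *\<^sub>R f x = f x"
    unfolding eventually_sequentially by (intro exI[of _ n0]) (auto simp: indicator_def)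
  then show "(\<lambda>n. indicator (cball 0 (real n)) x *\<^sub>R f x) \<longlonglongrightarrow> f x"
    by (rule tendsto_eventually)
qed

lemma loc_integrable_bounded_linear:
  assumes "bounded_linear T" "loc_integrable f"
  shows "loc_integrable (\<lambda>x. T (f x))"
  unfolding loc_integrable_def set_integrable_def
proof (intro allI impI)
  fix C :: "(real^3) set" assume "compact C"
  then have "integrable lebesgue (\<lambda>x. T (indicator C x *\<^sub>R f x))"
    by (rule integrable_bounded_linear[OF assms(1) loc_integrableD[OF assms(2)]])
  then show "integrable lebesgue (\<lambda>x. indicator C x *\<^sub>R T (f x))"
    using linear_scale[OF bounded_linear.linear[OF assms(1)]] by simp
qed

lemma loc_integrable_diff:
  "loc_integrable f \<Longrightarrow> loc_integrable g \<Longrightarrow> loc_integrable (\<lambda>x. f x - g x)"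
  by (simp add: loc_integrable_def set_integrable_def scaleR_diff_right)

lemma loc_integrable_mult_test_fun:
  fixes g :: "real^3 \<Rightarrow> real"
  assumes "loc_integrable g" "test_fun \<eta>"
  shows "integrable lebesgue (\<lambda>x. g x * \<eta> x)"
proof -
  obtain R where R: "\<And>x. norm x > R \<Longrightarrow> \<eta> x = 0" using test_fun_bounded_support[OF assms(2)] by blast
  obtain B where B: "\<And>x. norm (\<eta> x) \<le> B"
    using bounded_continuous_bounded_support[OF test_fun_continuous[OF assms(2)] R] by blast
  have [measurable]: "g \<in> borel_measurable lebesgue" "\<eta> \<in> borel_measurable lebesgue"
    using loc_integrable_measurable[OF assms(1)] test_fun_continuous[OF assms(2)]
    by (auto intro!: measurable_completion simp: borel_measurable_continuous_onI)
  have "integrable lebesgue (\<lambda>x. indicator (cball 0 R) x *\<^sub>R g x)"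
    using assms(1) by (auto simp: loc_integrable_def set_integrable_def)
  then have "integrable lebesgue (\<lambda>x. B * (indicator (cball 0 R) x *\<^sub>R g x))" by simp
  then show ?thesis
  proof (rule Bochner_Integration.integrable_bound)
    have "norm (g x * \<eta> x) \<le> norm (B * (indicator (cball 0 R) x *\<^sub>R g x))" for x
    proof (cases "norm x > R")
      case False
      have "\<bar>\<eta> x\<bar> \<le> \<bar>B\<bar>" using B[of x] by auto
      then show ?thesis using False by (auto simp: abs_mult mult.commute intro!: mult_right_mono)
    qed (simp add: R)
    then show "AE x in lebesgue. norm (g x * \<eta> x) \<le> norm (B * (indicator (cball 0 R) x *\<^sub>R g x))" by simp
  qed measurable
qed

text \<open>Testing with \<open>box_bump\<close> and letting \<open>m\<close> tend to infinity shows
  that the integral of \<open>g\<close> over every box vanishes.\<close>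

lemma fundamental_lemma:
  fixes g :: "real^3 \<Rightarrow> real"
  assumes g: "loc_integrable g"
    and zero: "\<And>\<eta>. test_fun \<eta> \<Longrightarrow> (LINT x|lebesgue. g x * \<eta> x) = 0"
  shows "AE x in lebesgue. g x = 0"
proof -
  have meas [measurable]: "g \<in> borel_measurable lebesgue" by (rule loc_integrable_measurable[OF g])
  \<comment> \<open>Boxes generate only the Borel sets, so the measure comparison runs on a Borel
    function equal to \<open>g\<close> almost everywhere.\<close>
  obtain g' where [measurable]: "g' \<in> borel_measurable lborel" and g': "AE x in lborel. g x = g' x"
    using completion_ex_borel_measurable_real[OF meas] by blast
  then have [measurable]: "g' \<in> borel_measurable borel" by simp
  have g'_leb: "g' \<in> borel_measurable lebesgue" by (rule measurable_completion) simp
  have ae: "AE x in lebesgue. g x = g' x" using g' by (simp add: AE_completion_iff)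
  have intc: "integrable lebesgue (\<lambda>x. indicator (cbox a b) x * g x)" for a b
    using g unfolding loc_integrable_def set_integrable_def by simp
  have int: "integrable lebesgue (\<lambda>x. indicator (box a b) x * g x)" for a b
  proof (rule Bochner_Integration.integrable_bound[OF intc[of a b]])
    show "(\<lambda>x. indicator (box a b) x * g x) \<in> borel_measurable lebesgue"
      by (intro borel_measurable_times borel_measurable_indicator) auto
  qed (use box_subset_cbox[of a b] in \<open>auto simp: indicator_def\<close>)
  have "(LINT x|lebesgue. indicator (box a b) x * g x) = 0" for a b
  proof -
    have "(\<lambda>m. LINT x|lebesgue. g x * box_bump a b m x) \<longlonglongrightarrow> (LINT x|lebesgue. indicator (box a b) x * g x)"
    proof (rule integral_dominated_convergence)
      show "integrable lebesgue (\<lambda>x. norm (indicator (cbox a b) x * g x))" using intc by (rule integrable_norm)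
      show "(\<lambda>x. g x * box_bump a b m x) \<in> borel_measurable lebesgue" for m
        using loc_integrable_mult_test_fun[OF g test_fun_box_bump] by blast
      have "(\<lambda>m. g x * box_bump a b m x) \<longlonglongrightarrow> indicator (box a b) x * g x" for x
        using tendsto_mult_left[OF box_bump_tendsto[of a b x], of "g x"] by (simp add: mult.commute)
      then show "AE x in lebesgue. (\<lambda>m. g x * box_bump a b m x) \<longlonglongrightarrow> indicator (box a b) x * g x" by simp
      have "norm (g x * box_bump a b m x) \<le> norm (indicator (cbox a b) x * g x)" for x m
      proof (cases "x \<in> box a b")
        case True
        then have "x \<in> cbox a b" using box_subset_cbox by blast
        then show ?thesis using box_bump_bounds[of a b m x] by (simp add: abs_mult mult_left_le)
      qed (simp add: box_bump_eq_0)
      then show "AE x in lebesgue. norm (g x * box_bump a b m x) \<le> norm (indicator (cbox a b) x * g x)" for m by simp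
    qed (use int in auto)
    then show ?thesis using zero[OF test_fun_box_bump] by (simp add: LIMSEQ_const_iff)
  qed
  moreover have "(LINT x|lebesgue. indicator (box a b) x * g x) = (LINT x|lborel. indicator (box a b) x * g' x)"
    "integrable lborel (\<lambda>x. indicator (box a b) x * g' x)" for a b
  proof -
    have m: "(\<lambda>x. indicator (box a b) x * g' x) \<in> borel_measurable lborel" by measurable
    note m' = measurable_completion[OF m]
    have ae': "AE x in lebesgue. indicator (box a b) x * g x = indicator (box a b) x * g' x"
      using ae by eventually_elim simp
    show "integrable lborel (\<lambda>x. indicator (box a b) x * g' x)"
      using integrable_cong_AE_imp[OF int m' ae'] by (simp add: integrable_completion[OF m])
    show "(LINT x|lebesgue. indicator (box a b) x * g x) = (LINT x|lborel. indicator (box a b) x * g' x)"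
      using integral_cong_AE[OF _ m' ae'] int integral_completion[OF m] by auto
  qed
  ultimately have "AE x in lborel. g' x = 0"
    by (intro AE_zero_if_box_integrals_zero) auto
  then have "AE x in lebesgue. g' x = 0" by (simp add: AE_completion_iff)
  with ae show ?thesis by eventually_elim simp
qed

section \<open>Weak gradients and their chosen representative\<close>

lemma has_weak_gradD:
  "has_weak_grad w G \<Longrightarrow> test_fun \<eta> \<Longrightarrow>
    (LINT x|lebesgue. w x $ k * partial j \<eta> x) = - (LINT x|lebesgue. G x $ j $ k * \<eta> x)"
  by (simp add: has_weak_grad_def)

text \<open>\<open>weak_grad\<close> picks an unspecified weak gradient; uniqueness lets any weak
  gradient that has been constructed determine its norm.\<close>

lemma has_weak_grad_unique:
  assumes "has_weak_grad w G" "has_weak_grad w G'"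
  shows "AE x in lebesgue. G x = G' x"
proof -
  have loc: "loc_integrable G" "loc_integrable G'" using assms by (auto simp: has_weak_grad_def)
  have comp: "loc_integrable (\<lambda>x. G x $ j $ k)" if "loc_integrable G" for G :: tfield and j k
    by (rule loc_integrable_bounded_linear[OF _ that, of "\<lambda>A. A $ j $ k"])
       (rule bounded_linear_compose[OF bounded_linear_vec_nth bounded_linear_vec_nth])
  have "AE x in lebesgue. G x $ j $ k - G' x $ j $ k = 0" for j k
  proof (rule fundamental_lemma)
    show "loc_integrable (\<lambda>x. G x $ j $ k - G' x $ j $ k)"
      by (intro loc_integrable_diff comp loc)
    fix \<eta> :: "real^3 \<Rightarrow> real" assume \<eta>: "test_fun \<eta>"
    have "(LINT x|lebesgue. G x $ j $ k * \<eta> x) = (LINT x|lebesgue. G' x $ j $ k * \<eta> x)"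
      using has_weak_gradD[OF assms(1) \<eta>, of k j] has_weak_gradD[OF assms(2) \<eta>, of k j] by simp
    then show "(LINT x|lebesgue. (G x $ j $ k - G' x $ j $ k) * \<eta> x) = 0"
      using loc_integrable_mult_test_fun[OF comp[OF loc(1)] \<eta>] loc_integrable_mult_test_fun[OF comp[OF loc(2)] \<eta>]
      by (simp add: left_diff_distrib)
  qed
  then have "AE x in lebesgue. \<forall>j k. G x $ j $ k - G' x $ j $ k = 0"
    by (simp add: AE_all_countable)
  then show ?thesis by eventually_elim (simp add: vec_eq_iff)
qed

text \<open>a \<le> 1 + a^2, and compact sets have finite measure.\<close>

lemma in_L2_loc_integrable:
  fixes f :: "real^3 \<Rightarrow> 'b::euclidean_space"
  assumes "in_L2 f"
  shows "loc_integrable f"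
  unfolding loc_integrable_def set_integrable_def
proof (intro allI impI)
  fix C :: "(real^3) set" assume C: "compact C"
  have [measurable]: "f \<in> borel_measurable lebesgue" using assms in_L2_measurable by auto
  have [measurable]: "C \<in> sets lebesgue" using C by (simp add: lmeasurable_compact fmeasurableD)
  have fin: "emeasure lebesgue C < \<infinity>"
    using fmeasurableD2[OF lmeasurable_compact[OF C]] by (simp add: less_top del: emeasure_completion)
  have "integrable lebesgue (\<lambda>x. indicator C x + (norm (f x))\<^sup>2)"
    using assms fin by (intro Bochner_Integration.integrable_add integrable_real_indicator)
      (auto simp: in_L2_def simp del: emeasure_completion)
  then show "integrable lebesgue (\<lambda>x. indicator C x *\<^sub>R f x)"
  proof (rule Bochner_Integration.integrable_bound)
    have "norm (indicator C x *\<^sub>R f x) \<le> norm (indicator C x + (norm (f x))\<^sup>2)" for x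
    proof -
      have "norm (f x) \<le> 1 + (norm (f x))\<^sup>2"
        using sum_squares_bound[of 1 "norm (f x)"] norm_ge_zero[of "f x"] unfolding one_power2 by linarith
      then show ?thesis by (auto simp: indicator_def)
    qed
    then show "AE x in lebesgue. norm (indicator C x *\<^sub>R f x) \<le> norm (indicator C x + (norm (f x))\<^sup>2)" by simp
  qed measurable
qed

lemma has_weak_grad_weak_grad: "has_weak_grad w G \<Longrightarrow> has_weak_grad w (weak_grad w)"
  unfolding weak_grad_def by (rule someI[of "has_weak_grad w"])

lemma weak_grad_AE_eq: "has_weak_grad w G \<Longrightarrow> AE x in lebesgue. G x = weak_grad w x"
  using has_weak_grad_unique has_weak_grad_weak_grad by blast

lemma
  assumes "has_weak_grad w G" "in_L2 G"
  shows in_L2_weak_grad: "in_L2 (weak_grad w)"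
    and l2_norm_weak_grad: "l2_norm (weak_grad w) = l2_norm G"
proof -
  have "weak_grad w \<in> borel_measurable lebesgue"
    using has_weak_grad_weak_grad[OF assms(1)] loc_integrable_measurable by (auto simp: has_weak_grad_def)
  then show "in_L2 (weak_grad w)" "l2_norm (weak_grad w) = l2_norm G"
    using in_L2_cong_AE[OF assms(2) _ weak_grad_AE_eq[OF assms(1)]] by auto
qed

text \<open>The chosen weak gradient of the zero field is 0 only almost everywhere, which suffices
  for the norm. This is needed for the H^1 continuity of a test field that is constant in
  time.\<close>

lemma l2_norm_weak_grad_zero: "l2_norm (weak_grad (\<lambda>x. 0)) = 0"
proof -
  have "has_weak_grad (\<lambda>x. 0) (\<lambda>x. 0)"
    by (simp add: has_weak_grad_def in_L2_loc_integrable[OF in_L2_zero])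
  from l2_norm_weak_grad[OF this in_L2_zero] show ?thesis by (simp add: l2_norm_zero)
qed

section \<open>Weak gradients of fields in the homogeneous Sobolev space\<close>

lemma continuous_bounded_support_in_L2:
  fixes f :: "real^3 \<Rightarrow> 'b::euclidean_space"
  assumes "continuous_on UNIV f" "\<And>x. norm x > R \<Longrightarrow> f x = 0"
  shows "in_L2 f"
proof -
  have 1: "f \<in> borel_measurable lborel" using assms(1) by (simp add: borel_measurable_continuous_onI)
  have 2: "integrable lborel (\<lambda>x. (norm (f x))\<^sup>2)"
    by (rule integrable_continuous_bounded_support[of _ R]) (auto intro!: continuous_intros assms)
  show ?thesis
    using 2 measurable_completion[OF 1] integrable_completion[OF borel_measurable_integrable[OF 2]]
    by (simp add: in_L2_def)
qed

lemma test_fun_in_L2: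
  fixes f :: "real^3 \<Rightarrow> 'b::euclidean_space"
  assumes "test_fun f"
  shows "in_L2 f"
proof -
  obtain R where "\<And>x. norm x > R \<Longrightarrow> f x = 0" using test_fun_bounded_support[OF assms] by blast
  then show ?thesis by (rule continuous_bounded_support_in_L2[OF test_fun_continuous[OF assms]])
qed

lemma classical_grad_in_L2:
  assumes "test_fun \<phi>"
  shows "in_L2 (classical_grad \<phi>)"
proof -
  obtain R where "\<And>x. norm x > R \<Longrightarrow> classical_grad \<phi> x = 0"
    using classical_grad_bounded_support[OF assms] by blast
  then show ?thesis by (rule continuous_bounded_support_in_L2[OF continuous_classical_grad[OF assms]])
qed

lemma integral_by_parts_lebesgue:
  fixes \<phi> :: vfield and \<eta> :: "real^3 \<Rightarrow> real"
  assumes "test_fun \<phi>" "test_fun \<eta>"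
  shows "(LINT x|lebesgue. \<phi> x $ k * partial j \<eta> x) = - (LINT x|lebesgue. classical_grad \<phi> x $ j $ k * \<eta> x)"
proof -
  note c = test_fun_continuous[OF assms(1)] test_fun_continuous[OF assms(2)]
    test_fun_continuous[OF test_fun_partial[OF assms(2)], of j] continuous_classical_grad[OF assms(1)]
  have "(\<lambda>x. \<phi> x $ k * partial j \<eta> x) \<in> borel_measurable lborel"
       "(\<lambda>x. classical_grad \<phi> x $ j $ k * \<eta> x) \<in> borel_measurable lborel"
    by (auto intro!: borel_measurable_continuous_onI continuous_intros c)
  then show ?thesis
    using integral_by_parts_test_fun[OF assms] by (simp add: integral_completion)
qed

text \<open>Both sides of the integration by parts converge: the left one by local L^1 convergence
  against the bounded, compactly supported derivative of the test function, the right one by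
  Cauchy-Schwarz.\<close>

lemma has_weak_grad_limit:
  fixes \<phi> :: "nat \<Rightarrow> vfield"
  assumes test: "\<And>n. test_fun (\<phi> n)" and w: "loc_integrable w" and G: "in_L2 G"
    and conv: "\<And>C. compact C \<Longrightarrow> (\<lambda>n. LINT x:C|lebesgue. norm (\<phi> n x - w x)) \<longlonglongrightarrow> 0"
    and conv_grad: "(\<lambda>n. l2_norm (\<lambda>x. classical_grad (\<phi> n) x - G x)) \<longlonglongrightarrow> 0"
  shows "has_weak_grad w G"
  unfolding has_weak_grad_def
proof (intro conjI allI impI)
  show "loc_integrable w" by (rule w)
  show "loc_integrable G" by (rule in_L2_loc_integrable[OF G])
  fix \<eta> :: "real^3 \<Rightarrow> real" and j k :: 3 assume \<eta>: "test_fun \<eta>"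
  note p\<eta> = test_fun_partial[OF \<eta>, of j]
  obtain R where R: "\<And>x. norm x > R \<Longrightarrow> partial j \<eta> x = 0" using test_fun_bounded_support[OF p\<eta>] by blast
  obtain B where B: "\<And>x. norm (partial j \<eta> x) \<le> B"
    using bounded_continuous_bounded_support[OF test_fun_continuous[OF p\<eta>] R] by blast
  have loc_vec: "loc_integrable (\<lambda>x. f x $ k)" if "loc_integrable f" for f :: vfield
    by (rule loc_integrable_bounded_linear[OF bounded_linear_vec_nth that])
  have loc_mat: "loc_integrable (\<lambda>x. G x $ j $ k)" if "loc_integrable G" for G :: tfield
    by (rule loc_integrable_bounded_linear[OF _ that, of "\<lambda>A. A $ j $ k"])
       (rule bounded_linear_compose[OF bounded_linear_vec_nth bounded_linear_vec_nth])
  have loc_\<phi>: "loc_integrable (\<phi> n)" for n by (rule in_L2_loc_integrable[OF test_fun_in_L2[OF test]])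
  have "(\<lambda>n. (LINT x|lebesgue. \<phi> n x $ k * partial j \<eta> x)) \<longlonglongrightarrow> (LINT x|lebesgue. w x $ k * partial j \<eta> x)"
  proof (rule LIM_zero_cancel, rule Lim_null_comparison)
    show "(\<lambda>n. B * (LINT x:cball 0 R|lebesgue. norm (\<phi> n x - w x))) \<longlonglongrightarrow> 0"
      using tendsto_mult_right_zero[OF conv[OF compact_cball]] by simp
    have "norm ((LINT x|lebesgue. \<phi> n x $ k * partial j \<eta> x) - (LINT x|lebesgue. w x $ k * partial j \<eta> x))
        \<le> B * (LINT x:cball 0 R|lebesgue. norm (\<phi> n x - w x))" for n
    proof -
      have "(LINT x|lebesgue. \<phi> n x $ k * partial j \<eta> x) - (LINT x|lebesgue. w x $ k * partial j \<eta> x)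
          = (LINT x|lebesgue. (\<phi> n x - w x) $ k * partial j \<eta> x)"
        using loc_integrable_mult_test_fun[OF loc_vec[OF loc_\<phi>[of n]] p\<eta>] loc_integrable_mult_test_fun[OF loc_vec[OF w] p\<eta>]
        by (simp add: left_diff_distrib)
      moreover have "\<bar>LINT x|lebesgue. (\<phi> n x - w x) $ k * partial j \<eta> x\<bar>
          \<le> (LINT x|lebesgue. B * (indicator (cball 0 R) x *\<^sub>R norm (\<phi> n x - w x)))"
      proof (rule abs_integral_le)
        have "integrable lebesgue (\<lambda>x. norm (indicator (cball 0 R) x *\<^sub>R (\<phi> n x - w x)))"
          by (intro integrable_norm loc_integrableD loc_integrable_diff loc_\<phi> w compact_cball)
        then show "integrable lebesgue (\<lambda>x. B * (indicator (cball 0 R) x *\<^sub>R norm (\<phi> n x - w x)))"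
          by (intro integrable_mult_right) simp
        have "\<bar>(\<phi> n x - w x) $ k * partial j \<eta> x\<bar> \<le> B * (indicator (cball 0 R) x *\<^sub>R norm (\<phi> n x - w x))" for x
        proof (cases "norm x > R")
          case False
          have "\<bar>(\<phi> n x - w x) $ k\<bar> * \<bar>partial j \<eta> x\<bar> \<le> norm (\<phi> n x - w x) * B"
            using B[of x] component_le_norm_cart[of "\<phi> n x - w x" k] by (intro mult_mono) auto
          then show ?thesis using False by (simp add: abs_mult mult.commute)
        qed (simp add: R)
        then show "AE x in lebesgue. \<bar>(\<phi> n x - w x) $ k * partial j \<eta> x\<bar> \<le> B * (indicator (cball 0 R) x *\<^sub>R norm (\<phi> n x - w x))"
          by simp
      qed
      ultimately show ?thesis by (simp add: set_lebesgue_integral_def)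
    qed
    then show "\<forall>\<^sub>F n in sequentially. norm ((LINT x|lebesgue. \<phi> n x $ k * partial j \<eta> x) - (LINT x|lebesgue. w x $ k * partial j \<eta> x))
        \<le> B * (LINT x:cball 0 R|lebesgue. norm (\<phi> n x - w x))" by simp
  qed
  moreover have "(\<lambda>n. (LINT x|lebesgue. classical_grad (\<phi> n) x $ j $ k * \<eta> x)) \<longlonglongrightarrow> (LINT x|lebesgue. G x $ j $ k * \<eta> x)"
  proof (rule LIM_zero_cancel, rule Lim_null_comparison)
    show "(\<lambda>n. l2_norm (\<lambda>x. classical_grad (\<phi> n) x - G x) * l2_norm \<eta>) \<longlonglongrightarrow> 0"
      by (rule tendsto_mult_left_zero[OF conv_grad])
    have "norm ((LINT x|lebesgue. classical_grad (\<phi> n) x $ j $ k * \<eta> x) - (LINT x|lebesgue. G x $ j $ k * \<eta> x))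
        \<le> l2_norm (\<lambda>x. classical_grad (\<phi> n) x - G x) * l2_norm \<eta>" for n
    proof -
      have "(LINT x|lebesgue. classical_grad (\<phi> n) x $ j $ k * \<eta> x) - (LINT x|lebesgue. G x $ j $ k * \<eta> x)
          = (LINT x|lebesgue. (classical_grad (\<phi> n) x - G x) $ j $ k * \<eta> x)"
        using loc_integrable_mult_test_fun[OF loc_mat[OF in_L2_loc_integrable[OF classical_grad_in_L2[OF test[of n]]]] \<eta>]
          loc_integrable_mult_test_fun[OF loc_mat[OF in_L2_loc_integrable[OF G]] \<eta>]
        by (simp add: left_diff_distrib)
      moreover have "\<bar>LINT x|lebesgue. (classical_grad (\<phi> n) x - G x) $ j $ k * \<eta> x\<bar>
          \<le> l2_norm (\<lambda>x. classical_grad (\<phi> n) x - G x) * l2_norm \<eta>"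
      proof (rule L2_abs_integral_le)
        have entry: "\<bar>A $ j $ k\<bar> \<le> norm A" for A :: "real^3^3"
          by (rule order_trans[OF component_le_norm_cart Finite_Cartesian_Product.norm_nth_le])
        then show "AE x in lebesgue. \<bar>(classical_grad (\<phi> n) x - G x) $ j $ k * \<eta> x\<bar> \<le> norm (classical_grad (\<phi> n) x - G x) * norm (\<eta> x)"
          unfolding abs_mult real_norm_def by (intro AE_I2 mult_right_mono entry abs_ge_zero)
      qed (intro in_L2_diff classical_grad_in_L2 test test_fun_in_L2 \<eta> G)+
      ultimately show ?thesis by simp
    qed
    then show "\<forall>\<^sub>F n in sequentially. norm ((LINT x|lebesgue. classical_grad (\<phi> n) x $ j $ k * \<eta> x) - (LINT x|lebesgue. G x $ j $ k * \<eta> x))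
        \<le> l2_norm (\<lambda>x. classical_grad (\<phi> n) x - G x) * l2_norm \<eta>" by simp
  qed
  ultimately show "(LINT x|lebesgue. w x $ k * partial j \<eta> x) = - (LINT x|lebesgue. G x $ j $ k * \<eta> x)"
    using integral_by_parts_lebesgue[OF test \<eta>] by (auto dest: tendsto_minus intro: LIMSEQ_unique)
qed

text \<open>By completeness the Cauchy gradients have an L^2 limit, which is a weak gradient of
  \<open>w\<close>. Gradient norms of the test fields therefore converge to that of
  \<open>w\<close>, so inequalities proved for test fields carry over.\<close>

lemma in_dotH1_approximation:
  assumes "in_dotH1 w"
  obtains \<phi> :: "nat \<Rightarrow> vfield" where "\<And>n. test_fun (\<phi> n)"
    "\<And>C. compact C \<Longrightarrow> (\<lambda>n. LINT x:C|lebesgue. norm (\<phi> n x - w x)) \<longlonglongrightarrow> 0"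
    "(\<lambda>n. l2_norm (classical_grad (\<phi> n))) \<longlonglongrightarrow> l2_norm (weak_grad w)"
    "has_weak_grad w (weak_grad w)" "in_L2 (weak_grad w)"
proof -
  from assms obtain \<phi> :: "nat \<Rightarrow> vfield" where w: "loc_integrable w" and test: "\<And>n. test_fun (\<phi> n)"
    and cauchy: "\<And>e. e > 0 \<Longrightarrow> \<exists>N. \<forall>m\<ge>N. \<forall>n\<ge>N. l2_norm (\<lambda>x. classical_grad (\<phi> m) x - classical_grad (\<phi> n) x) < e"
    and conv: "\<And>C. compact C \<Longrightarrow> (\<lambda>n. LINT x:C|lebesgue. norm (\<phi> n x - w x)) \<longlonglongrightarrow> 0"
    by (auto simp: in_dotH1_def)
  obtain G where G: "in_L2 G" and lim: "(\<lambda>n. l2_norm (\<lambda>x. classical_grad (\<phi> n) x - G x)) \<longlonglongrightarrow> 0"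
    using L2_complete[OF classical_grad_in_L2[OF test] cauchy] by blast
  have wG: "has_weak_grad w G"
    by (rule has_weak_grad_limit[OF test w G conv lim])
  show ?thesis
  proof (rule that[OF test conv])
    show "(\<lambda>n. l2_norm (classical_grad (\<phi> n))) \<longlonglongrightarrow> l2_norm (weak_grad w)"
      unfolding l2_norm_weak_grad[OF wG G]
      by (rule tendsto_l2_norm[OF classical_grad_in_L2[OF test] G lim])
  qed (use has_weak_grad_weak_grad[OF wG] in_L2_weak_grad[OF wG G] in auto)
qed

text \<open>Transfers weighted power integrals from test fields to their limit; it serves Hardy's
  inequality with k = 1 / |x|^2, p = 2, and Sobolev's with k = 1, p = 6.\<close>

lemma Fatou_loc_L1:
  fixes \<phi> :: "nat \<Rightarrow> vfield" and k :: "real^3 \<Rightarrow> real"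
  assumes test: "\<And>n. test_fun (\<phi> n)" and w: "loc_integrable w"
    and conv: "\<And>C. compact C \<Longrightarrow> (\<lambda>n. LINT x:C|lebesgue. norm (\<phi> n x - w x)) \<longlonglongrightarrow> 0"
    and k [measurable]: "k \<in> borel_measurable lebesgue"
    and bound: "\<And>n. (\<integral>\<^sup>+x. ennreal (k x * norm (\<phi> n x) ^ p) \<partial>lebesgue) \<le> ennreal (b n)"
    and b: "b \<longlonglongrightarrow> L"
  shows "(\<integral>\<^sup>+x. ennreal (k x * norm (w x) ^ p) \<partial>lebesgue) \<le> ennreal L"
proof -
  have [measurable]: "w \<in> borel_measurable lebesgue" by (rule loc_integrable_measurable[OF w])
  have [measurable]: "\<phi> n \<in> borel_measurable lebesgue" for n
    by (rule in_L2_measurable[OF test_fun_in_L2[OF test]])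
  have ind [measurable]: "(indicator (cball 0 (real m)) :: real^3 \<Rightarrow> ennreal) \<in> borel_measurable lebesgue" for m
    by (rule borel_measurable_indicator) simp
  have ball: "(\<integral>\<^sup>+x. indicator (cball 0 (real m)) x * ennreal (k x * norm (w x) ^ p) \<partial>lebesgue) \<le> ennreal L" for m :: nat
  proof -
    let ?u = "\<lambda>n x. indicator (cball 0 (real m)) x *\<^sub>R (\<phi> n x - w x)"
    have int: "integrable lebesgue (?u n)" for n
      by (intro loc_integrableD loc_integrable_diff in_L2_loc_integrable test_fun_in_L2 test w compact_cball)
    have "(\<lambda>n. LINT x|lebesgue. norm (?u n x)) \<longlonglongrightarrow> 0"
      using conv[OF compact_cball[of 0 "real m"]] by (simp add: set_lebesgue_integral_def)
    \<comment> \<open>The subsequence depends on the ball, but the bound \<open>L\<close> does not;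
      so Fatou's lemma is applied on each ball, and once more as the balls grow.\<close>
    from tendsto_L1_AE_subseq[OF int this] obtain r :: "nat \<Rightarrow> nat"
      where r: "strict_mono r" and ae: "AE x in lebesgue. (\<lambda>n. ?u (r n) x) \<longlonglongrightarrow> 0" by blast
    have "(\<integral>\<^sup>+x. indicator (cball 0 (real m)) x * ennreal (k x * norm (w x) ^ p) \<partial>lebesgue)
        \<le> (\<integral>\<^sup>+x. liminf (\<lambda>n. ennreal (k x * norm (\<phi> (r n) x) ^ p)) \<partial>lebesgue)"
    proof (rule nn_integral_mono_AE)
      show "AE x in lebesgue. indicator (cball 0 (real m)) x * ennreal (k x * norm (w x) ^ p)
          \<le> liminf (\<lambda>n. ennreal (k x * norm (\<phi> (r n) x) ^ p))"
        using ae
      proof eventually_elim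
        case (elim x)
        show ?case
        proof (cases "x \<in> cball 0 (real m)")
          case True
          then have "(\<lambda>n. \<phi> (r n) x - w x) \<longlonglongrightarrow> 0" using elim by simp
          then have "(\<lambda>n. \<phi> (r n) x) \<longlonglongrightarrow> w x" by (rule LIM_zero_cancel)
          then have "(\<lambda>n. ennreal (k x * norm (\<phi> (r n) x) ^ p)) \<longlonglongrightarrow> ennreal (k x * norm (w x) ^ p)"
            by (intro tendsto_intros tendsto_ennrealI)
          then have "liminf (\<lambda>n. ennreal (k x * norm (\<phi> (r n) x) ^ p)) = ennreal (k x * norm (w x) ^ p)"
            by (rule lim_imp_Liminf[OF sequentially_bot])
          then show ?thesis using True by simp
        qed simp
      qed
    qed
    also have "\<dots> \<le> liminf (\<lambda>n. \<integral>\<^sup>+x. ennreal (k x * norm (\<phi> (r n) x) ^ p) \<partial>lebesgue)"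
      by (rule nn_integral_liminf) measurable
    also have "\<dots> \<le> liminf (\<lambda>n. ennreal (b (r n)))"
      by (intro Liminf_mono) (simp add: bound)
    also have "\<dots> = ennreal L"
      using LIMSEQ_subseq_LIMSEQ[OF b r] by (intro lim_imp_Liminf) (auto simp: o_def)
    finally show ?thesis .
  qed
  have "(\<integral>\<^sup>+x. ennreal (k x * norm (w x) ^ p) \<partial>lebesgue)
      \<le> (\<integral>\<^sup>+x. liminf (\<lambda>m. indicator (cball 0 (real m)) x * ennreal (k x * norm (w x) ^ p)) \<partial>lebesgue)"
  proof (rule nn_integral_mono)
    fix x :: "real^3"
    obtain n0 where "norm x \<le> real n0" using real_arch_simple by blast
    then have "\<forall>\<^sub>F m in sequentially. indicator (cball 0 (real m)) x * ennreal (k x * norm (w x) ^ p) = ennreal (k x * norm (w x) ^ p)"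
      unfolding eventually_sequentially by (intro exI[of _ n0]) (auto simp: indicator_def)
    then have "liminf (\<lambda>m. indicator (cball 0 (real m)) x * ennreal (k x * norm (w x) ^ p)) = ennreal (k x * norm (w x) ^ p)"
      by (intro lim_imp_Liminf tendsto_eventually) auto
    then show "ennreal (k x * norm (w x) ^ p) \<le> liminf (\<lambda>m. indicator (cball 0 (real m)) x * ennreal (k x * norm (w x) ^ p))"
      by simp
  qed
  also have "\<dots> \<le> liminf (\<lambda>m. \<integral>\<^sup>+x. indicator (cball 0 (real m)) x * ennreal (k x * norm (w x) ^ p) \<partial>lebesgue)"
    by (rule nn_integral_liminf) measurable
  also have "\<dots> \<le> ennreal L"
    by (rule Liminf_le) (simp_all add: ball)
  finally show ?thesis .
qed

section \<open>Hardy's inequality\<close>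

text \<open>Integrate the divergence of \<open>\<bar>\<phi>\<bar>\<^sup>2 x / (\<bar>x\<bar>\<^sup>2 + \<epsilon>)\<close>, whose field part has divergence at least \<open>1 / (\<bar>x\<bar>\<^sup>2 + \<epsilon>)\<close> in dimension three.\<close>
lemma Hardy_regularized:
  fixes \<phi> :: vfield
  assumes \<phi>: "test_fun \<phi>" and \<epsilon>: "\<epsilon> > 0"
  shows "(\<integral>\<^sup>+x. ennreal (1 / ((norm x)\<^sup>2 + \<epsilon>) * (norm (\<phi> x))\<^sup>2) \<partial>lebesgue) \<le> ennreal (4 * (l2_norm (classical_grad \<phi>))\<^sup>2)"
proof -
  define q where "q x = x \<bullet> x + \<epsilon>" for x :: "real^3"
  have q: "q x > 0" for x using \<epsilon> by (simp add: q_def add_nonneg_pos)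
  have q0: "q x \<noteq> 0" for x using q[of x] by simp
  have cq: "continuous_on UNIV q" unfolding q_def[abs_def] by (intro continuous_intros)
  \<comment> \<open>\<open>F j\<close> is the j-th component of the field |phi|^2 x / q. Evaluating
    \<open>F' j x\<close> at \<open>axis j 1\<close> and summing over \<open>j\<close> gives its
    divergence.\<close>
  define F where "F j x = (\<phi> x \<bullet> \<phi> x) * (x $ j / q x)" for j x
  define F' where "F' j x h = (\<phi> x \<bullet> \<phi> x) * ((h $ j * q x - x $ j * (2 * (x \<bullet> h))) / (q x * q x))
      + 2 * (\<phi> x \<bullet> frechet_derivative \<phi> (at x) h) * (x $ j / q x)" for j x h
  obtain R where R: "\<And>x. norm x > R \<Longrightarrow> \<phi> x = 0" "\<And>x. norm x > R \<Longrightarrow> classical_grad \<phi> x = 0"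
    using classical_grad_bounded_support[OF \<phi>] by blast
  note c = test_fun_continuous[OF \<phi>] test_fun_continuous[OF test_fun_partial[OF \<phi>]] continuous_classical_grad[OF \<phi>] cq
  have dF: "(F j has_derivative F' j x) (at x)" for j x
  proof -
    have "((\<lambda>x. x $ j / q x) has_derivative (\<lambda>h. (h $ j * q x - x $ j * (2 * (x \<bullet> h))) / (q x * q x))) (at x)"
      unfolding q_def using q0[of x, unfolded q_def]
      by (auto intro!: derivative_eq_intros bounded_linear.has_derivative[OF bounded_linear_vec_nth] simp: inner_commute)
    moreover have "((\<lambda>x. \<phi> x \<bullet> \<phi> x) has_derivative (\<lambda>h. 2 * (\<phi> x \<bullet> frechet_derivative \<phi> (at x) h))) (at x)"
      by (auto intro!: derivative_eq_intros test_fun_has_derivative[OF \<phi>] simp: inner_commute)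
    ultimately show ?thesis
      unfolding F_def F'_def by (rule has_derivative_eq_rhs[OF has_derivative_mult[rotated]]) (simp add: mult_ac)
  qed
  have F'_axis: "F' j x (axis j 1) = (\<phi> x \<bullet> \<phi> x) * ((q x - 2 * (x $ j)\<^sup>2) / (q x * q x)) + 2 * (\<phi> x \<bullet> partial j \<phi> x) * (x $ j / q x)" for j x
    by (simp add: F'_def inner_axis partial_def power2_eq_square)
  have cF': "continuous_on UNIV (\<lambda>x. F' j x (axis j 1))" for j
    unfolding F'_axis by (intro continuous_intros c) (auto simp: q0)
  have suppF': "F' j x (axis j 1) = 0" if "norm x > R" for j x
    using R(1)[OF that] by (simp add: F'_axis)
  have "(LINT x|lborel. F' j x (axis j 1)) = 0" for j
    by (rule integral_directional_derivative_zero[OF dF cF', where R = R]) (simp add: F_def R(1))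
  moreover have intF': "integrable lborel (\<lambda>x. F' j x (axis j 1))" for j
    by (rule integrable_continuous_bounded_support[OF cF' suppF'])
  ultimately have zero: "(LINT x|lborel. (\<Sum>j\<in>UNIV. F' j x (axis j 1))) = 0"
    by (subst Bochner_Integration.integral_sum) auto
  define H where "H x = 1 / ((norm x)\<^sup>2 + \<epsilon>) * (norm (\<phi> x))\<^sup>2" for x
  define D where "D x = (norm (classical_grad \<phi> x))\<^sup>2" for x
  have qn: "(norm x)\<^sup>2 + \<epsilon> = q x" for x by (simp add: q_def power2_norm_eq_inner)
  \<comment> \<open>The divergence is |phi|^2 (3q - 2 |x|^2) / q^2, at least \<open>H\<close>, plus
    the cross term 2 phi . (x . grad) phi / q. Half of \<open>H\<close> and 2 \<open>D\<close>
    absorb the cross term; since the divergence integrates to 0, the integral of \<open>H\<close> is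
    at most 4 times that of \<open>D\<close>.\<close>
  have low: "H x / 2 - 2 * D x \<le> (\<Sum>j\<in>UNIV. F' j x (axis j 1))" for x
  proof -
    let ?v = "\<Sum>j\<in>UNIV. x $ j *\<^sub>R partial j \<phi> x"
    have nsq: "(norm x)\<^sup>2 = (\<Sum>j\<in>UNIV. (x $ j)\<^sup>2)"
      unfolding power2_norm_eq_inner inner_vec_def by (simp add: power2_eq_square)
    have "(\<Sum>j\<in>UNIV. F' j x (axis j 1))
        = (norm (\<phi> x))\<^sup>2 * ((3 * q x - 2 * (norm x)\<^sup>2) / (q x * q x)) + 2 * (\<phi> x \<bullet> ?v) / q x"
    proof -
      have "(\<Sum>j\<in>UNIV. (\<phi> x \<bullet> \<phi> x) * ((q x - 2 * (x $ j)\<^sup>2) / (q x * q x)))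
          = (norm (\<phi> x))\<^sup>2 * ((3 * q x - 2 * (norm x)\<^sup>2) / (q x * q x))"
        unfolding sum_distrib_left[symmetric] sum_divide_distrib[symmetric] sum_subtractf nsq power2_norm_eq_inner[of "\<phi> x"]
        by simp
      moreover have "(\<Sum>j\<in>UNIV. 2 * (\<phi> x \<bullet> partial j \<phi> x) * (x $ j / q x)) = 2 * (\<phi> x \<bullet> ?v) / q x"
        unfolding inner_sum_right sum_distrib_left sum_divide_distrib by (intro sum.cong refl) simp
      ultimately show ?thesis unfolding F'_axis sum.distrib by simp
    qed
    moreover have "norm ?v \<le> norm x * norm (classical_grad \<phi> x)"
      using norm_sum_scaleR_rows_le[of x "classical_grad \<phi> x"] by (simp add: classical_grad_row)
    then have inner_le: "\<bar>\<phi> x \<bullet> ?v\<bar> \<le> norm (\<phi> x) * (norm x * norm (classical_grad \<phi> x))"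
      by (intro order_trans[OF Cauchy_Schwarz_ineq2] mult_left_mono) auto
    moreover have "2 * (norm (\<phi> x) * (norm x * norm (classical_grad \<phi> x))) / q x \<le> (norm (\<phi> x))\<^sup>2 / q x / 2 + 2 * D x"
    proof -
      \<comment> \<open>Young's inequality is applied to s and 2g: then only half of s^2 is spent,
        and s^2 \<le> |phi|^2 / q because |x|^2 \<le> q.\<close>
      define s where "s = norm (\<phi> x) * norm x / q x"
      define g where "g = norm (classical_grad \<phi> x)"
      have "s\<^sup>2 = (norm (\<phi> x))\<^sup>2 / q x * ((norm x)\<^sup>2 / q x)"
        by (simp add: s_def power_divide power_mult_distrib power2_eq_square)
      also have "\<dots> \<le> (norm (\<phi> x))\<^sup>2 / q x"
        using \<epsilon> q[of x] by (intro mult_left_le) (auto simp flip: qn)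
      finally have "s\<^sup>2 \<le> (norm (\<phi> x))\<^sup>2 / q x" .
      moreover have "2 * s * (2 * g) \<le> s\<^sup>2 + (2 * g)\<^sup>2"
        by (rule sum_squares_bound)
      ultimately have "2 * (s * g) \<le> (norm (\<phi> x))\<^sup>2 / q x / 2 + 2 * g\<^sup>2"
        by (simp add: power_mult_distrib)
      moreover have "2 * (norm (\<phi> x) * (norm x * norm (classical_grad \<phi> x))) / q x = 2 * (s * g)"
        by (simp add: s_def g_def)
      ultimately show ?thesis by (simp only: g_def D_def)
    qed
    moreover have "(norm (\<phi> x))\<^sup>2 * (1 / q x) \<le> (norm (\<phi> x))\<^sup>2 * ((3 * q x - 2 * (norm x)\<^sup>2) / (q x * q x))"
    proof (rule mult_left_mono)
      \<comment> \<open>3q - 2 |x|^2 = q + 2 \<epsilon>, where the 3 is the dimension.\<close>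
      have "q x \<le> 3 * q x - 2 * (norm x)\<^sup>2" using \<epsilon> qn[of x] by linarith
      then have "q x / (q x * q x) \<le> (3 * q x - 2 * (norm x)\<^sup>2) / (q x * q x)"
        by (rule divide_right_mono) simp
      then show "1 / q x \<le> (3 * q x - 2 * (norm x)\<^sup>2) / (q x * q x)"
        using q0[of x] by simp
    qed simp
    moreover have "- (2 * (\<phi> x \<bullet> ?v)) / q x \<le> 2 * (norm (\<phi> x) * (norm x * norm (classical_grad \<phi> x))) / q x"
      using inner_le q[of x] by (intro divide_right_mono) linarith+
    ultimately show ?thesis unfolding H_def qn minus_divide_left[symmetric] by simp
  qed
  have intH: "integrable lborel H"
    unfolding H_def[abs_def] qn
  proof (rule integrable_continuous_bounded_support[of _ R])
    show "continuous_on UNIV (\<lambda>x. 1 / q x * (norm (\<phi> x))\<^sup>2)"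
      using q0 by (intro continuous_intros c) auto
  qed (simp add: R)
  have intD: "integrable lborel D"
    unfolding D_def[abs_def]
    by (rule integrable_continuous_bounded_support[of _ R]) (intro continuous_intros c, simp add: R)
  have "(LINT x|lborel. H x / 2 - 2 * D x) \<le> (LINT x|lborel. (\<Sum>j\<in>UNIV. F' j x (axis j 1)))"
    using low by (intro integral_mono Bochner_Integration.integrable_diff integrable_divide integrable_mult_right
        Bochner_Integration.integrable_sum intH intD intF')
  then have "(LINT x|lborel. H x) \<le> 4 * (LINT x|lborel. D x)"
    using intH intD zero by simp
  moreover have "(LINT x|lborel. D x) = (l2_norm (classical_grad \<phi>))\<^sup>2"
    unfolding l2_norm_power2 D_def[symmetric]
    by (rule integral_completion[symmetric]) (use intD in simp)
  moreover have "(\<integral>\<^sup>+x. ennreal (H x) \<partial>lebesgue) = ennreal (LINT x|lborel. H x)"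
    unfolding nn_integral_completion
    by (rule nn_integral_eq_integral[OF intH]) (simp add: H_def qn less_imp_le[OF q])
  ultimately show ?thesis unfolding H_def[symmetric] by (simp add: ennreal_leI)
qed

text \<open>Fatou's lemma as the regularization tends to 0. At the origin the left integrand is 0,
  because division by zero gives 0.\<close>

lemma Hardy_test_fun:
  fixes \<phi> :: vfield
  assumes \<phi>: "test_fun \<phi>"
  shows "(\<integral>\<^sup>+x. ennreal (1 / (norm x)\<^sup>2 * (norm (\<phi> x))\<^sup>2) \<partial>lebesgue) \<le> ennreal (4 * (l2_norm (classical_grad \<phi>))\<^sup>2)"
proof -
  let ?H = "\<lambda>n x. ennreal (1 / ((norm x)\<^sup>2 + inverse (real (Suc n))) * (norm (\<phi> x))\<^sup>2)"
  have [measurable]: "\<phi> \<in> borel_measurable borel"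
    by (rule borel_measurable_continuous_onI[OF test_fun_continuous[OF \<phi>]])
  have "(\<integral>\<^sup>+x. ennreal (1 / (norm x)\<^sup>2 * (norm (\<phi> x))\<^sup>2) \<partial>lborel) \<le> (\<integral>\<^sup>+x. liminf (\<lambda>n. ?H n x) \<partial>lborel)"
  proof (rule nn_integral_mono)
    fix x :: "real^3"
    show "ennreal (1 / (norm x)\<^sup>2 * (norm (\<phi> x))\<^sup>2) \<le> liminf (\<lambda>n. ?H n x)"
    proof (cases "x = 0")
      case False
      then have "(\<lambda>n. ?H n x) \<longlonglongrightarrow> ennreal (1 / ((norm x)\<^sup>2 + 0) * (norm (\<phi> x))\<^sup>2)"
        by (intro tendsto_intros tendsto_ennrealI LIMSEQ_inverse_real_of_nat) auto
      from lim_imp_Liminf[OF sequentially_bot this] show ?thesis by simp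
    qed simp
  qed
  also have "\<dots> \<le> liminf (\<lambda>n. \<integral>\<^sup>+x. ?H n x \<partial>lborel)"
    by (rule nn_integral_liminf) measurable
  also have "\<dots> \<le> ennreal (4 * (l2_norm (classical_grad \<phi>))\<^sup>2)"
    using Hardy_regularized[OF \<phi>, of "inverse (real (Suc _))"]
    by (intro Liminf_le) (auto simp: nn_integral_completion simp del: of_nat_Suc)
  finally show ?thesis by (simp add: nn_integral_completion)
qed

text \<open>The constant 4 for squares becomes 2 for norms. In this form each factor 1 / |x| in the
  bounds of the Landau field can be handed over to a field in the homogeneous space.\<close>

lemma
  assumes "in_dotH1 w"
  shows Hardy_in_L2: "in_L2 (\<lambda>x. w x /\<^sub>R norm x)"
    and Hardy_inequality: "l2_norm (\<lambda>x. w x /\<^sub>R norm x) \<le> 2 * dotH1_norm w"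
proof -
  obtain \<phi> :: "nat \<Rightarrow> vfield" where test: "\<And>n. test_fun (\<phi> n)"
    and conv: "\<And>C. compact C \<Longrightarrow> (\<lambda>n. LINT x:C|lebesgue. norm (\<phi> n x - w x)) \<longlonglongrightarrow> 0"
    and lim: "(\<lambda>n. l2_norm (classical_grad (\<phi> n))) \<longlonglongrightarrow> l2_norm (weak_grad w)"
    by (rule in_dotH1_approximation[OF assms]) (rule that, assumption+)
  have w: "loc_integrable w" using assms by (simp add: in_dotH1_def)
  have nm: "(\<lambda>x::real^3. norm x) \<in> borel_measurable lebesgue"
    by (rule measurable_completion) simp
  have "(\<integral>\<^sup>+x. ennreal (1 / (norm x)\<^sup>2 * (norm (w x))\<^sup>2) \<partial>lebesgue) \<le> ennreal (4 * (l2_norm (weak_grad w))\<^sup>2)"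
  proof (rule Fatou_loc_L1[OF test w conv])
    show "(\<lambda>x::real^3. 1 / (norm x)\<^sup>2) \<in> borel_measurable lebesgue" using nm by measurable
    show "(\<lambda>n. 4 * (l2_norm (classical_grad (\<phi> n)))\<^sup>2) \<longlonglongrightarrow> 4 * (l2_norm (weak_grad w))\<^sup>2"
      by (intro tendsto_intros lim)
  qed (assumption | rule Hardy_test_fun[OF test])+
  moreover have "(norm (w x /\<^sub>R norm x))\<^sup>2 = 1 / (norm x)\<^sup>2 * (norm (w x))\<^sup>2" for x
    by (simp add: power_mult_distrib divide_inverse power_inverse)
  ultimately have "(\<integral>\<^sup>+x. ennreal ((norm (w x /\<^sub>R norm x))\<^sup>2) \<partial>lebesgue) \<le> ennreal ((2 * dotH1_norm w)\<^sup>2)"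
    by (simp only: dotH1_norm_def power_mult_distrib) simp
  moreover have "(\<lambda>x. w x /\<^sub>R norm x) \<in> borel_measurable lebesgue"
    using nm loc_integrable_measurable[OF w] by measurable
  ultimately show "in_L2 (\<lambda>x. w x /\<^sub>R norm x)" "l2_norm (\<lambda>x. w x /\<^sub>R norm x) \<le> 2 * dotH1_norm w"
    using in_L2I_nn_integral[of "\<lambda>x. w x /\<^sub>R norm x" "2 * dotH1_norm w"] by (auto simp: dotH1_norm_def l2_norm_nonneg)
qed

section \<open>Sobolev's inequality\<close>

text \<open>An exponent of at least 2 makes the power of the norm differentiable at the origin too,
  and the factor \<open>v \<bullet> h\<close>, in place of the direction \<open>sgn v\<close>,
  covers both cases by one formula.\<close>

lemma has_derivative_norm_power:
  fixes v :: "'a::real_inner"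
  shows "((\<lambda>v. norm v ^ Suc (Suc m)) has_derivative (\<lambda>h. real (Suc (Suc m)) * norm v ^ m * (v \<bullet> h))) (at v)"
proof (cases "v = 0")
  case False
  then have "(h \<bullet> sgn v) * norm v ^ Suc m = norm v ^ m * (v \<bullet> h)" for h
    by (simp add: sgn_div_norm inner_commute)
  then show ?thesis
    using has_derivative_power[OF has_derivative_norm[OF False], of "Suc (Suc m)"]
    by (elim has_derivative_eq_rhs) (simp add: fun_eq_iff mult.assoc del: power_Suc of_nat_Suc)
next
  case True
  have "((\<lambda>h::'a. norm h ^ Suc m) \<longlongrightarrow> norm (0::'a) ^ Suc m) (at 0)"
    by (intro tendsto_intros)
  then have "((\<lambda>h::'a. norm h ^ Suc m) \<longlongrightarrow> 0) (at 0)" by simp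
  then have "((\<lambda>h::'a. norm (norm h ^ Suc (Suc m)) / norm h) \<longlongrightarrow> 0) (at 0)"
    by (rule Lim_transform_eventually) (auto simp: eventually_at intro!: exI[of _ 1])
  then show ?thesis using True by (simp add: has_derivative_iff_norm)
qed

text \<open>The fundamental theorem of calculus, started to the left of the support. The bound is a
  non-negative integral so that the order of integration can later be exchanged without
  integrability conditions.\<close>

lemma bounded_by_integral_derivative:
  fixes f :: "real \<Rightarrow> real"
  assumes der: "\<And>s. (f has_real_derivative f' s) (at s)" and cont: "continuous_on UNIV f'"
    and supp: "\<And>s. \<bar>s\<bar> > R \<Longrightarrow> f s = 0" and le: "\<And>s. \<bar>f' s\<bar> \<le> H s"
  shows "ennreal (f t) \<le> (\<integral>\<^sup>+s. ennreal (H s) \<partial>lborel)"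
proof -
  \<comment> \<open>To the left of \<open>t\<close> and of the support, whatever the sign of
    \<open>R\<close>.\<close>
  define a where "a = - \<bar>R\<bar> - \<bar>t\<bar> - 1"
  have "a \<le> t" and "f a = 0" by (auto simp: a_def intro!: supp)
  have "has_bochner_integral lborel (\<lambda>x. f' x * indicator {a..t} x) (f t - f a)"
    using cont \<open>a \<le> t\<close> der by (intro has_bochner_integral_FTC_Icc_real) (auto simp: continuous_on_eq_continuous_at)
  then have "f t = (LINT x|lborel. f' x * indicator {a..t} x)" "integrable lborel (\<lambda>x. f' x * indicator {a..t} x)"
    using \<open>f a = 0\<close> by (auto simp: has_bochner_integral_iff)
  then have "ennreal (f t) \<le> (\<integral>\<^sup>+x. norm (f' x * indicator {a..t} x) \<partial>lborel)"
    using integral_norm_bound_ennreal[of lborel "\<lambda>x. f' x * indicator {a..t} x"]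
    by (auto intro: order_trans[OF ennreal_leI[OF abs_ge_self]])
  also have "\<dots> \<le> (\<integral>\<^sup>+x. ennreal (H x) \<partial>lborel)"
    using le by (intro nn_integral_mono ennreal_leI) (auto simp: indicator_def intro: order_trans[OF abs_ge_zero])
  finally show ?thesis .
qed

text \<open>Used on vertical lines with m = 2, to bound |phi|^4 by the integral of 4 |phi|^3 |grad
  phi|, and on horizontal ones with m = 1, to bound |phi|^3 by that of 3 |phi|^2 |grad phi|.\<close>

lemma test_fun_norm_power_le_line_integral:
  fixes \<phi> :: vfield
  assumes \<phi>: "test_fun \<phi>"
  shows "ennreal (norm (\<phi> (p + t *\<^sub>R axis j 1)) ^ Suc (Suc m))
    \<le> (\<integral>\<^sup>+s. ennreal (real (Suc (Suc m)) * norm (\<phi> (p + s *\<^sub>R axis j 1)) ^ Suc m * norm (classical_grad \<phi> (p + s *\<^sub>R axis j 1))) \<partial>lborel)"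
proof -
  let ?x = "\<lambda>s. p + s *\<^sub>R axis j (1::real)"
  define f' where "f' s = real (Suc (Suc m)) * norm (\<phi> (?x s)) ^ m * (\<phi> (?x s) \<bullet> partial j \<phi> (?x s))" for s
  obtain R where R: "\<And>x. norm x > R \<Longrightarrow> \<phi> x = 0" using test_fun_bounded_support[OF \<phi>] by blast
  show ?thesis
  proof (rule bounded_by_integral_derivative[where f = "\<lambda>s. norm (\<phi> (?x s)) ^ Suc (Suc m)" and f' = f' and R = "R + norm p"])
    fix s
    have lin: "linear (frechet_derivative \<phi> (at (?x s)))"
      using test_fun_has_derivative[OF \<phi>] by (rule has_derivative_linear)
    have "((\<lambda>s. \<phi> (?x s)) has_derivative (\<lambda>h. frechet_derivative \<phi> (at (?x s)) (h *\<^sub>R axis j 1))) (at s)"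
      by (rule has_derivative_compose[of ?x, OF _ test_fun_has_derivative[OF \<phi>]]) (auto intro!: derivative_eq_intros)
    from has_derivative_compose[OF this has_derivative_norm_power]
    have "((\<lambda>s. norm (\<phi> (?x s)) ^ Suc (Suc m)) has_derivative (\<lambda>h. f' s * h)) (at s)"
      by (rule has_derivative_eq_rhs) (simp add: f'_def linear_scale[OF lin] partial_def fun_eq_iff del: of_nat_Suc)
    then show "((\<lambda>s. norm (\<phi> (?x s)) ^ Suc (Suc m)) has_real_derivative f' s) (at s)"
      by (simp add: has_field_derivative_def)
    have "norm (partial j \<phi> (?x s)) \<le> norm (classical_grad \<phi> (?x s))"
      using Finite_Cartesian_Product.norm_nth_le[of "classical_grad \<phi> (?x s)" j] by (simp add: classical_grad_row)
    then have "\<bar>\<phi> (?x s) \<bullet> partial j \<phi> (?x s)\<bar> \<le> norm (\<phi> (?x s)) * norm (classical_grad \<phi> (?x s))"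
      by (intro order_trans[OF Cauchy_Schwarz_ineq2] mult_left_mono) auto
    then have "\<bar>f' s\<bar> \<le> real (Suc (Suc m)) * norm (\<phi> (?x s)) ^ m * (norm (\<phi> (?x s)) * norm (classical_grad \<phi> (?x s)))"
      unfolding f'_def abs_mult by (intro mult_mono) auto
    also have "\<dots> = real (Suc (Suc m)) * (norm (\<phi> (?x s)) ^ m * norm (\<phi> (?x s))) * norm (classical_grad \<phi> (?x s))" by simp
    also have "norm (\<phi> (?x s)) ^ m * norm (\<phi> (?x s)) = norm (\<phi> (?x s)) ^ Suc m"
      by (simp add: mult.commute)
    finally show "\<bar>f' s\<bar> \<le> real (Suc (Suc m)) * norm (\<phi> (?x s)) ^ Suc m * norm (classical_grad \<phi> (?x s))" .
  next
    fix s assume "\<bar>s\<bar> > R + norm p"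
    moreover have "\<bar>s\<bar> \<le> norm (?x s) + norm p"
      using norm_triangle_ineq4[of "?x s" p] by (simp add: norm_axis_1)
    ultimately show "norm (\<phi> (?x s)) ^ Suc (Suc m) = 0" using R by simp
  next
    have "continuous_on UNIV (\<lambda>s. f (?x s))" if "continuous_on UNIV f" for f :: vfield
      by (rule continuous_on_compose2[OF that]) (auto intro!: continuous_intros)
    then show "continuous_on UNIV f'"
      unfolding f'_def[abs_def] using test_fun_continuous[OF \<phi>] test_fun_continuous[OF test_fun_partial[OF \<phi>]]
      by (intro continuous_intros) auto
  qed
qed

text \<open>The third coordinate stands outermost because Sobolev's inequality is proved on
  horizontal planes, with (x, y) as one variable.\<close>

definition coord_triple :: "real \<times> real \<times> real \<Rightarrow> real^3" where
  "coord_triple = (\<lambda>(z, x, y). x *\<^sub>R axis 1 1 + y *\<^sub>R axis 2 1 + z *\<^sub>R axis 3 1)"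

lemma coord_triple_measurable [measurable]: "coord_triple \<in> borel_measurable (lborel \<Otimes>\<^sub>M (lborel \<Otimes>\<^sub>M lborel))"
  unfolding coord_triple_def by measurable

text \<open>Lebesgue measure is determined by the volumes of boxes, and the preimage of a box is a
  product of three intervals.\<close>

lemma lborel_eq_distr_coord_triple:
  "lborel = distr (lborel \<Otimes>\<^sub>M (lborel \<Otimes>\<^sub>M lborel)) borel coord_triple"
proof (rule lborel_eqI)
  fix l u :: "real^3" assume lu: "\<And>b. b \<in> Basis \<Longrightarrow> l \<bullet> b \<le> u \<bullet> b"
  have le: "l $ i \<le> u $ i" for i
    using lu[of "axis i 1"] by (simp add: inner_axis)
  have vim: "coord_triple -` box l u \<inter> space (lborel \<Otimes>\<^sub>M (lborel \<Otimes>\<^sub>M lborel))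
      = {l $ 3<..<u $ 3} \<times> ({l $ 1<..<u $ 1} \<times> {l $ 2<..<u $ 2})"
    by (auto simp: space_pair_measure coord_triple_def mem_box_cart forall_3 axis_def)
  have "emeasure (distr (lborel \<Otimes>\<^sub>M (lborel \<Otimes>\<^sub>M lborel)) borel coord_triple) (box l u)
      = ennreal (u $ 3 - l $ 3) * (ennreal (u $ 1 - l $ 1) * ennreal (u $ 2 - l $ 2))"
    using le by (subst emeasure_distr) (auto simp: vim lborel.emeasure_pair_measure_Times
        sigma_finite_measure.emeasure_pair_measure_Times[OF lborel_pair.sigma_finite_measure_axioms])
  also have "\<dots> = ennreal (\<Prod>i\<in>UNIV. (u - l) $ i)"
    using le[of 1] le[of 2] le[of 3] unfolding UNIV_3 by (simp add: ennreal_mult mult.assoc mult.commute[of "ennreal (u $ 3 - l $ 3)"])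
  also have "(\<Prod>i\<in>UNIV. (u - l) $ i) = (\<Prod>b\<in>Basis. (u - l) \<bullet> b)"
  proof -
    have Basis: "(Basis :: (real^3) set) = (\<lambda>i. axis i 1) ` UNIV" by (auto simp: Basis_vec_def)
    have inj: "inj (\<lambda>i::3. axis i (1::real))" by (auto simp: inj_def axis_eq_axis)
    show ?thesis unfolding Basis prod.reindex[OF inj] by (simp add: inner_axis)
  qed
  finally show "emeasure (distr (lborel \<Otimes>\<^sub>M (lborel \<Otimes>\<^sub>M lborel)) borel coord_triple) (box l u) = ennreal (\<Prod>b\<in>Basis. (u - l) \<bullet> b)" .
qed simp

lemma nn_integral_coord_triple:
  fixes f :: "real^3 \<Rightarrow> ennreal"
  assumes [measurable]: "f \<in> borel_measurable borel"
  shows "(\<integral>\<^sup>+v. f v \<partial>lborel) = (\<integral>\<^sup>+z. \<integral>\<^sup>+q. f (coord_triple (z, q)) \<partial>(lborel \<Otimes>\<^sub>M lborel) \<partial>lborel)"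
proof -
  have "(\<integral>\<^sup>+v. f v \<partial>lborel) = (\<integral>\<^sup>+p. f (coord_triple p) \<partial>(lborel \<Otimes>\<^sub>M (lborel \<Otimes>\<^sub>M lborel)))"
    by (subst lborel_eq_distr_coord_triple, subst nn_integral_distr) simp_all
  also have "\<dots> = (\<integral>\<^sup>+z. \<integral>\<^sup>+q. f (coord_triple (z, q)) \<partial>(lborel \<Otimes>\<^sub>M lborel) \<partial>lborel)"
    by (rule sigma_finite_measure.nn_integral_fst[OF lborel_pair.sigma_finite_measure_axioms, symmetric]) simp
  finally show ?thesis .
qed

text \<open>A slicing argument of Gagliardo-Nirenberg type. Let J, S, D be the integrals of |phi|^6,
  |phi|^3 |grad phi| and |grad phi|^2. Slicing gives J \<le> 36 S D, Cauchy-Schwarz gives S^2 \<le>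
  J D; together J^2 \<le> 1296 J D^3, and J cancels.\<close>

lemma Sobolev_test_fun:
  fixes \<phi> :: vfield
  assumes \<phi>: "test_fun \<phi>"
  shows "(\<integral>\<^sup>+v. ennreal (norm (\<phi> v) ^ 6) \<partial>lebesgue) \<le> ennreal (1296 * l2_norm (classical_grad \<phi>) ^ 6)"
proof -
  define a where "a v = norm (\<phi> v)" for v
  define g where "g v = norm (classical_grad \<phi> v)" for v
  have nonneg: "0 \<le> a v" "0 \<le> g v" for v by (auto simp: a_def g_def)
  have ca: "continuous_on UNIV a" and cg: "continuous_on UNIV g"
    unfolding a_def[abs_def] g_def[abs_def]
    by (intro continuous_intros test_fun_continuous[OF \<phi>] continuous_classical_grad[OF \<phi>])+
  then have [measurable]: "a \<in> borel_measurable borel" "g \<in> borel_measurable borel"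
    by (auto intro: borel_measurable_continuous_onI)
  define J where "J = (\<integral>\<^sup>+v. ennreal (a v ^ 6) \<partial>lborel)"
  define S where "S = (\<integral>\<^sup>+v. ennreal (a v ^ 3 * g v) \<partial>lborel)"
  define D where "D = (\<integral>\<^sup>+v. ennreal ((g v)\<^sup>2) \<partial>lborel)"
  let ?P = "lborel \<Otimes>\<^sub>M lborel :: (real \<times> real) measure"
  let ?T = coord_triple
  have line: "ennreal (a (p + t *\<^sub>R axis j 1) ^ Suc (Suc m))
      \<le> (\<integral>\<^sup>+s. ennreal (real (Suc (Suc m)) * a (p + s *\<^sub>R axis j 1) ^ Suc m * g (p + s *\<^sub>R axis j 1)) \<partial>lborel)" for p t j m
    unfolding a_def g_def by (rule test_fun_norm_power_le_line_integral[OF \<phi>])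
  \<comment> \<open>The integral over a whole vertical line does not depend on the height, so all
    horizontal slices share the bound 4 S.\<close>
  have slice4: "(\<integral>\<^sup>+q. ennreal (a (?T (z, q)) ^ 4) \<partial>?P) \<le> 4 * S" for z
  proof -
    have "ennreal (a (?T (z, q)) ^ 4) \<le> (\<integral>\<^sup>+s. ennreal (4 * (a (?T (s, q)) ^ 3 * g (?T (s, q)))) \<partial>lborel)" for q
      using line[of "fst q *\<^sub>R axis 1 1 + snd q *\<^sub>R axis 2 1" z 3 2]
      by (simp add: coord_triple_def case_prod_beta eval_nat_numeral mult.assoc)
    then have "(\<integral>\<^sup>+q. ennreal (a (?T (z, q)) ^ 4) \<partial>?P)
        \<le> (\<integral>\<^sup>+q. \<integral>\<^sup>+s. ennreal (4 * (a (?T (s, q)) ^ 3 * g (?T (s, q)))) \<partial>lborel \<partial>?P)"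
      by (intro nn_integral_mono)
    also have "\<dots> = (\<integral>\<^sup>+s. \<integral>\<^sup>+q. ennreal (4 * (a (?T (s, q)) ^ 3 * g (?T (s, q)))) \<partial>?P \<partial>lborel)"
      by (rule pair_sigma_finite.Fubini'[OF pair_sigma_finite.intro[OF sigma_finite_lborel lborel_pair.sigma_finite_measure_axioms]])
        measurable
    also have "\<dots> = (\<integral>\<^sup>+v. ennreal (4 * (a v ^ 3 * g v)) \<partial>lborel)"
      by (rule nn_integral_coord_triple[symmetric]) measurable
    also have "\<dots> = 4 * S"
      unfolding S_def using nonneg by (simp add: ennreal_mult nn_integral_cmult)
    finally show ?thesis .
  qed
  \<comment> \<open>In a horizontal plane |phi|^3 is at most a function \<open>C\<close> of x alone
    and at most a function \<open>B\<close> of y alone. So |phi|^6 has a product majorant, whose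
    integral is the square of the planar integral of 3 |phi|^2 |grad phi|. Cauchy-Schwarz and
    \<open>slice4\<close> give the factor 36 = 9 times 4.\<close>
  have slice6: "(\<integral>\<^sup>+q. ennreal (a (?T (z, q)) ^ 6) \<partial>?P) \<le> 36 * S * (\<integral>\<^sup>+q. ennreal ((g (?T (z, q)))\<^sup>2) \<partial>?P)" for z
  proof -
    define k where "k q = ennreal (3 * (a (?T (z, q)))\<^sup>2 * g (?T (z, q)))" for q
    have [measurable]: "k \<in> borel_measurable ?P" unfolding k_def by measurable
    define C where "C x = (\<integral>\<^sup>+s. k (x, s) \<partial>lborel)" for x
    define B where "B y = (\<integral>\<^sup>+s. k (s, y) \<partial>lborel)" for y
    have [measurable]: "C \<in> borel_measurable lborel" "B \<in> borel_measurable lborel"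
      unfolding C_def B_def by measurable
    have leC: "ennreal (a (?T (z, (x, y))) ^ 3) \<le> C x" for x y
      using line[of "x *\<^sub>R axis 1 1 + z *\<^sub>R axis 3 1" y 2 1]
      by (simp add: C_def k_def coord_triple_def eval_nat_numeral add_ac)
    have leB: "ennreal (a (?T (z, (x, y))) ^ 3) \<le> B y" for x y
      using line[of "y *\<^sub>R axis 2 1 + z *\<^sub>R axis 3 1" x 1 1]
      by (simp add: B_def k_def coord_triple_def eval_nat_numeral add_ac)
    have "ennreal (a (?T (z, q)) ^ 6) \<le> C (fst q) * B (snd q)" for q
    proof -
      have "ennreal (a (?T (z, q)) ^ 6) = ennreal (a (?T (z, q)) ^ 3) * ennreal (a (?T (z, q)) ^ 3)"
        using nonneg by (simp flip: ennreal_mult power_add)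
      also have "\<dots> \<le> C (fst q) * B (snd q)"
        using leC[of "fst q" "snd q"] leB[of "fst q" "snd q"] by (intro mult_mono) auto
      finally show ?thesis .
    qed
    then have "(\<integral>\<^sup>+q. ennreal (a (?T (z, q)) ^ 6) \<partial>?P) \<le> (\<integral>\<^sup>+q. C (fst q) * B (snd q) \<partial>?P)"
      by (intro nn_integral_mono)
    also have "\<dots> = (\<integral>\<^sup>+x. \<integral>\<^sup>+y. C x * B y \<partial>lborel \<partial>lborel)"
      by (subst lborel.nn_integral_fst[symmetric]) auto
    also have "\<dots> = (\<integral>\<^sup>+x. C x \<partial>lborel) * (\<integral>\<^sup>+y. B y \<partial>lborel)"
      by (simp add: nn_integral_cmult nn_integral_multc)
    also have "(\<integral>\<^sup>+x. C x \<partial>lborel) = (\<integral>\<^sup>+q. k q \<partial>?P)"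
      unfolding C_def by (rule lborel.nn_integral_fst) simp
    also have "(\<integral>\<^sup>+y. B y \<partial>lborel) = (\<integral>\<^sup>+q. k q \<partial>?P)"
      unfolding B_def by (rule lborel_pair.nn_integral_snd) simp
    also have "(\<integral>\<^sup>+q. k q \<partial>?P) * (\<integral>\<^sup>+q. k q \<partial>?P) = (\<integral>\<^sup>+q. ennreal (3 * (a (?T (z, q)))\<^sup>2) * ennreal (g (?T (z, q))) \<partial>?P)\<^sup>2"
      unfolding k_def power2_eq_square[of "nn_integral _ _"] using nonneg by (simp add: ennreal_mult)
    also have "\<dots> \<le> (\<integral>\<^sup>+q. (ennreal (3 * (a (?T (z, q)))\<^sup>2))\<^sup>2 \<partial>?P) * (\<integral>\<^sup>+q. (ennreal (g (?T (z, q))))\<^sup>2 \<partial>?P)"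
      by (rule Cauchy_Schwarz_nn_integral) measurable
    also have "(\<integral>\<^sup>+q. (ennreal (3 * (a (?T (z, q)))\<^sup>2))\<^sup>2 \<partial>?P) = 9 * (\<integral>\<^sup>+q. ennreal (a (?T (z, q)) ^ 4) \<partial>?P)"
    proof -
      have "(ennreal (3 * (a (?T (z, q)))\<^sup>2))\<^sup>2 = 9 * ennreal (a (?T (z, q)) ^ 4)" for q
      proof -
        have "(3 * (a (?T (z, q)))\<^sup>2)\<^sup>2 = 9 * a (?T (z, q)) ^ 4" by (simp add: power_mult_distrib)
        then show ?thesis using nonneg by (simp add: ennreal_power ennreal_mult)
      qed
      then show ?thesis by (simp add: nn_integral_cmult)
    qed
    also have "(\<integral>\<^sup>+q. (ennreal (g (?T (z, q))))\<^sup>2 \<partial>?P) = (\<integral>\<^sup>+q. ennreal ((g (?T (z, q)))\<^sup>2) \<partial>?P)"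
      using nonneg by (simp add: ennreal_power)
    also have "9 * (\<integral>\<^sup>+q. ennreal (a (?T (z, q)) ^ 4) \<partial>?P) * (\<integral>\<^sup>+q. ennreal ((g (?T (z, q)))\<^sup>2) \<partial>?P)
        \<le> 9 * (4 * S) * (\<integral>\<^sup>+q. ennreal ((g (?T (z, q)))\<^sup>2) \<partial>?P)"
      by (intro mult_right_mono mult_left_mono slice4) auto
    also have "9 * (4 * S) = 36 * S" by (simp flip: mult.assoc)
    finally show ?thesis .
  qed
  have "J = (\<integral>\<^sup>+z. \<integral>\<^sup>+q. ennreal (a (?T (z, q)) ^ 6) \<partial>?P \<partial>lborel)"
    unfolding J_def by (rule nn_integral_coord_triple) measurable
  also have "\<dots> \<le> (\<integral>\<^sup>+z. 36 * S * (\<integral>\<^sup>+q. ennreal ((g (?T (z, q)))\<^sup>2) \<partial>?P) \<partial>lborel)"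
    by (intro nn_integral_mono slice6)
  also have "\<dots> = 36 * S * (\<integral>\<^sup>+z. \<integral>\<^sup>+q. ennreal ((g (?T (z, q)))\<^sup>2) \<partial>?P \<partial>lborel)"
    by (rule nn_integral_cmult)
      (rule sigma_finite_measure.borel_measurable_nn_integral_fst[OF lborel_pair.sigma_finite_measure_axioms], measurable)
  also have "(\<integral>\<^sup>+z. \<integral>\<^sup>+q. ennreal ((g (?T (z, q)))\<^sup>2) \<partial>?P \<partial>lborel) = D"
    unfolding D_def by (rule nn_integral_coord_triple[symmetric]) measurable
  finally have JSD: "J \<le> 36 * S * D" .
  have SJD: "S\<^sup>2 \<le> J * D"
  proof -
    have "S\<^sup>2 = (\<integral>\<^sup>+v. ennreal (a v ^ 3) * ennreal (g v) \<partial>lborel)\<^sup>2"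
      unfolding S_def using nonneg by (simp add: ennreal_mult)
    also have "\<dots> \<le> (\<integral>\<^sup>+v. (ennreal (a v ^ 3))\<^sup>2 \<partial>lborel) * (\<integral>\<^sup>+v. (ennreal (g v))\<^sup>2 \<partial>lborel)"
      by (rule Cauchy_Schwarz_nn_integral) measurable
    also have "\<dots> = J * D"
      unfolding J_def D_def using nonneg by (simp add: ennreal_power flip: power_mult)
    finally show ?thesis .
  qed
  obtain R where R: "\<And>x. norm x > R \<Longrightarrow> \<phi> x = 0" using test_fun_bounded_support[OF \<phi>] by blast
  \<comment> \<open>Compact support makes J finite, as the cancellation of J at the end
    requires.\<close>
  have "integrable lborel (\<lambda>v. a v ^ 6)"
    by (rule integrable_continuous_bounded_support[of _ R]) (intro continuous_intros ca, simp add: a_def R)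
  then have J: "J = ennreal (LINT v|lborel. a v ^ 6)"
    unfolding J_def by (rule nn_integral_eq_integral) (simp add: nonneg)
  define j where "j = (LINT v|lborel. a v ^ 6)"
  have j0: "j \<ge> 0" unfolding j_def by (simp add: nonneg)
  define d where "d = (l2_norm (classical_grad \<phi>))\<^sup>2"
  have d0: "d \<ge> 0" by (simp add: d_def)
  have D: "D = ennreal d"
    unfolding D_def d_def g_def nn_integral_L2[OF classical_grad_in_L2[OF \<phi>], symmetric] by (simp add: nn_integral_completion)
  have "J\<^sup>2 \<le> (36 * S * D)\<^sup>2" by (intro power_mono JSD) auto
  also have "\<dots> = 1296 * S\<^sup>2 * D\<^sup>2" by (simp add: power_mult_distrib)
  also have "\<dots> \<le> 1296 * (J * D) * D\<^sup>2" by (intro mult_right_mono mult_left_mono SJD) auto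
  finally have "ennreal (j\<^sup>2) \<le> ennreal (1296 * (j * d) * d\<^sup>2)"
    unfolding J[folded j_def] D using j0 d0 by (simp add: ennreal_power ennreal_mult)
  then have "j\<^sup>2 \<le> 1296 * (j * d) * d\<^sup>2" using j0 d0 by simp
  then have "j * j \<le> j * (1296 * d ^ 3)" by (simp add: power2_eq_square power3_eq_cube mult_ac)
  then have "j \<le> 1296 * d ^ 3"
    using j0 d0 by (cases "j = 0") (auto simp: mult_le_cancel_left)
  then have "J \<le> ennreal (1296 * d ^ 3)" unfolding J[folded j_def] by (rule ennreal_leI)
  also have "d ^ 3 = l2_norm (classical_grad \<phi>) ^ 6" unfolding d_def by (simp flip: power_mult)
  finally show ?thesis unfolding J_def a_def by (simp add: nn_integral_completion)
qed

section \<open>Pointwise bounds for the Landau solutions\<close>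

text \<open>Size and derivative estimates as for a function homogeneous of degree \<open>d\<close>.
  The class is closed under sums, products and suitable reciprocals, so the Landau field need not be
  differentiated explicitly; an integer degree is used because negative ones occur.\<close>

definition homogeneous_bound :: "int \<Rightarrow> (real^3 \<Rightarrow> real) \<Rightarrow> bool" where
  "homogeneous_bound d f \<longleftrightarrow> (\<exists>C f'. C \<ge> 0 \<and> (\<forall>x. x \<noteq> 0 \<longrightarrow> \<bar>f x\<bar> \<le> C * norm x powi d) \<and>
     (\<forall>x. x \<noteq> 0 \<longrightarrow> (f has_derivative f' x) (at x)) \<and>
     (\<forall>x h. x \<noteq> 0 \<longrightarrow> \<bar>f' x h\<bar> \<le> C * norm x powi (d - 1) * norm h))"

lemma homogeneous_boundE:
  assumes "homogeneous_bound d f"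
  obtains C f' where "C \<ge> 0" "\<And>x. x \<noteq> 0 \<Longrightarrow> \<bar>f x\<bar> \<le> C * norm x powi d"
    "\<And>x. x \<noteq> 0 \<Longrightarrow> (f has_derivative f' x) (at x)"
    "\<And>x h. x \<noteq> 0 \<Longrightarrow> \<bar>f' x h\<bar> \<le> C * norm x powi (d - 1) * norm h"
proof -
  from assms obtain C f' where *: "C \<ge> 0 \<and> (\<forall>x. x \<noteq> 0 \<longrightarrow> \<bar>f x\<bar> \<le> C * norm x powi d) \<and>
     (\<forall>x. x \<noteq> 0 \<longrightarrow> (f has_derivative f' x) (at x)) \<and>
     (\<forall>x h. x \<noteq> 0 \<longrightarrow> \<bar>f' x h\<bar> \<le> C * norm x powi (d - 1) * norm h)"
    unfolding homogeneous_bound_def by (elim exE)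
  show ?thesis by (rule that[of C f']) (use * in blast)+
qed

lemma homogeneous_boundI:
  assumes C: "C1 \<ge> 0" "C2 \<ge> 0"
    and f: "\<And>x. x \<noteq> 0 \<Longrightarrow> \<bar>f x\<bar> \<le> C1 * norm x powi d"
    and f': "\<And>x. x \<noteq> 0 \<Longrightarrow> (f has_derivative f' x) (at x)"
      "\<And>x h. x \<noteq> 0 \<Longrightarrow> \<bar>f' x h\<bar> \<le> C2 * norm x powi (d - 1) * norm h"
  shows "homogeneous_bound d f"
  unfolding homogeneous_bound_def
proof (intro exI[of _ "C1 + C2"] exI[of _ f'] conjI allI impI)
  fix x :: "real^3" assume x: "x \<noteq> 0"
  have "C1 * norm x powi d \<le> (C1 + C2) * norm x powi d"
    using C by (intro mult_right_mono) auto
  then show "\<bar>f x\<bar> \<le> (C1 + C2) * norm x powi d" using f[OF x] by linarith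
  show "(f has_derivative f' x) (at x)" by (rule f'(1)[OF x])
  fix h :: "real^3"
  have "C2 * norm x powi (d - 1) * norm h \<le> (C1 + C2) * norm x powi (d - 1) * norm h"
    using C by (intro mult_right_mono) auto
  then show "\<bar>f' x h\<bar> \<le> (C1 + C2) * norm x powi (d - 1) * norm h"
    using f'(2)[OF x, of h] by linarith
qed (use C in simp)

lemma homogeneous_bound_const: "homogeneous_bound 0 (\<lambda>x. a)"
  by (rule homogeneous_boundI[of "\<bar>a\<bar>" 0 _ _ "\<lambda>_ _. 0"]) auto

lemma homogeneous_bound_component: "homogeneous_bound 1 (\<lambda>x. x $ i)"
  by (rule homogeneous_boundI[of 1 1 _ _ "\<lambda>_ h. h $ i"])
    (auto intro!: bounded_linear_imp_has_derivative bounded_linear_vec_nth simp: component_le_norm_cart)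

lemma homogeneous_bound_norm: "homogeneous_bound 1 (\<lambda>x. norm x)"
proof (rule homogeneous_boundI[of 1 1 _ _ "\<lambda>x h. h \<bullet> sgn x"])
  show "\<bar>h \<bullet> sgn x\<bar> \<le> 1 * norm x powi (1 - 1) * norm h" if "x \<noteq> 0" for x h :: "real^3"
    using Cauchy_Schwarz_ineq2[of h "sgn x"] that by (simp add: norm_sgn)
qed (auto intro: has_derivative_norm)

lemma homogeneous_bound_add:
  assumes "homogeneous_bound d f" "homogeneous_bound d g"
  shows "homogeneous_bound d (\<lambda>x. f x + g x)"
proof -
  from assms obtain C f' D g' where
    f: "C \<ge> 0" "\<And>x. x \<noteq> 0 \<Longrightarrow> \<bar>f x\<bar> \<le> C * norm x powi d" "\<And>x. x \<noteq> 0 \<Longrightarrow> (f has_derivative f' x) (at x)"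
      "\<And>x h. x \<noteq> 0 \<Longrightarrow> \<bar>f' x h\<bar> \<le> C * norm x powi (d - 1) * norm h" and
    g: "D \<ge> 0" "\<And>x. x \<noteq> 0 \<Longrightarrow> \<bar>g x\<bar> \<le> D * norm x powi d" "\<And>x. x \<noteq> 0 \<Longrightarrow> (g has_derivative g' x) (at x)"
      "\<And>x h. x \<noteq> 0 \<Longrightarrow> \<bar>g' x h\<bar> \<le> D * norm x powi (d - 1) * norm h"
    by (elim homogeneous_boundE) blast
  show ?thesis
  proof (rule homogeneous_boundI[of "C + D" "C + D" _ _ "\<lambda>x h. f' x h + g' x h"])
    fix x :: "real^3" assume x: "x \<noteq> 0"
    show "\<bar>f x + g x\<bar> \<le> (C + D) * norm x powi d"
      using f(2)[OF x] g(2)[OF x] by (simp add: distrib_right)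
    show "\<bar>f' x h + g' x h\<bar> \<le> (C + D) * norm x powi (d - 1) * norm h" for h
      using f(4)[OF x, of h] g(4)[OF x, of h] by (simp add: distrib_right)
    show "((\<lambda>x. f x + g x) has_derivative (\<lambda>h. f' x h + g' x h)) (at x)"
      by (rule has_derivative_add[OF f(3)[OF x] g(3)[OF x]])
  qed (use f g in simp_all)
qed

lemma homogeneous_bound_mult:
  assumes "homogeneous_bound d f" "homogeneous_bound e g"
  shows "homogeneous_bound (d + e) (\<lambda>x. f x * g x)"
proof -
  from assms obtain C f' D g' where
    f: "C \<ge> 0" "\<And>x. x \<noteq> 0 \<Longrightarrow> \<bar>f x\<bar> \<le> C * norm x powi d" "\<And>x. x \<noteq> 0 \<Longrightarrow> (f has_derivative f' x) (at x)"
      "\<And>x h. x \<noteq> 0 \<Longrightarrow> \<bar>f' x h\<bar> \<le> C * norm x powi (d - 1) * norm h" and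
    g: "D \<ge> 0" "\<And>x. x \<noteq> 0 \<Longrightarrow> \<bar>g x\<bar> \<le> D * norm x powi e" "\<And>x. x \<noteq> 0 \<Longrightarrow> (g has_derivative g' x) (at x)"
      "\<And>x h. x \<noteq> 0 \<Longrightarrow> \<bar>g' x h\<bar> \<le> D * norm x powi (e - 1) * norm h"
    by (elim homogeneous_boundE) blast
  show ?thesis
  proof (rule homogeneous_boundI[of "C * D" "2 * (C * D)" _ _ "\<lambda>x h. f x * g' x h + f' x h * g x"])
    fix x :: "real^3" assume x: "x \<noteq> 0"
    have "\<bar>f x * g x\<bar> \<le> (C * norm x powi d) * (D * norm x powi e)"
      unfolding abs_mult using f(1) by (intro mult_mono f(2) g(2) x) auto
    then show "\<bar>f x * g x\<bar> \<le> (C * D) * norm x powi (d + e)"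
      using x by (simp add: power_int_add mult_ac)
    show "\<bar>f x * g' x h + f' x h * g x\<bar> \<le> 2 * (C * D) * norm x powi (d + e - 1) * norm h" for h
    proof -
      have "\<bar>f x * g' x h\<bar> \<le> (C * norm x powi d) * (D * norm x powi (e - 1) * norm h)"
        unfolding abs_mult using f(1) by (intro mult_mono f(2) g(4) x) auto
      moreover have "\<bar>f' x h * g x\<bar> \<le> (C * norm x powi (d - 1) * norm h) * (D * norm x powi e)"
        unfolding abs_mult using f(1) by (intro mult_mono f(4) g(2) x) auto
      moreover have "norm x powi (d + e - 1) = norm x powi d * norm x powi (e - 1)"
        "norm x powi (d + e - 1) = norm x powi (d - 1) * norm x powi e"
        using x by (simp_all flip: power_int_add add: algebra_simps)
      ultimately show ?thesis by (simp add: mult_ac)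
    qed
    show "((\<lambda>x. f x * g x) has_derivative (\<lambda>h. f x * g' x h + f' x h * g x)) (at x)"
      by (rule has_derivative_mult[OF f(3)[OF x] g(3)[OF x]])
  qed (use f g in simp_all)
qed

lemma homogeneous_bound_cmult: "homogeneous_bound d f \<Longrightarrow> homogeneous_bound d (\<lambda>x. a * f x)"
  using homogeneous_bound_mult[OF homogeneous_bound_const[of a]] by (simp only: add_0)

text \<open>The lower bound on g has the degree of its upper bound, so 1/g has degree -e, and its
  derivative -g' / g^2 has degree (e - 1) - 2e = -e - 1.\<close>

lemma homogeneous_bound_inverse:
  assumes "homogeneous_bound e g" and m: "m > 0" "\<And>x. x \<noteq> 0 \<Longrightarrow> m * norm x powi e \<le> \<bar>g x\<bar>"
  shows "homogeneous_bound (- e) (\<lambda>x. inverse (g x))"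
proof -
  from assms(1) obtain D g' where
    g: "D \<ge> 0" "\<And>x. x \<noteq> 0 \<Longrightarrow> \<bar>g x\<bar> \<le> D * norm x powi e" "\<And>x. x \<noteq> 0 \<Longrightarrow> (g has_derivative g' x) (at x)"
      "\<And>x h. x \<noteq> 0 \<Longrightarrow> \<bar>g' x h\<bar> \<le> D * norm x powi (e - 1) * norm h"
    by (elim homogeneous_boundE) blast
  have inv: "\<bar>inverse (g x)\<bar> \<le> inverse m * norm x powi (- e)" and g0: "g x \<noteq> 0" if x: "x \<noteq> 0" for x
  proof -
    have pos: "0 < m * norm x powi e" using m(1) x by simp
    then show "g x \<noteq> 0" using m(2)[OF x] by auto
    have "inverse \<bar>g x\<bar> \<le> inverse (m * norm x powi e)"
      by (rule le_imp_inverse_le[OF m(2)[OF x] pos])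
    then show "\<bar>inverse (g x)\<bar> \<le> inverse m * norm x powi (- e)"
      by (simp add: power_int_minus)
  qed
  show ?thesis
  proof (rule homogeneous_boundI[of "inverse m" "inverse m * D * inverse m" _ _ "\<lambda>x h. - (inverse (g x) * g' x h * inverse (g x))"])
    fix x :: "real^3" assume x: "x \<noteq> 0"
    show "\<bar>inverse (g x)\<bar> \<le> inverse m * norm x powi (- e)" by (rule inv[OF x])
    show "\<bar>- (inverse (g x) * g' x h * inverse (g x))\<bar> \<le> inverse m * D * inverse m * norm x powi (- e - 1) * norm h" for h
    proof -
      have "\<bar>inverse (g x)\<bar> * \<bar>g' x h\<bar> * \<bar>inverse (g x)\<bar>
          \<le> (inverse m * norm x powi (- e)) * (D * norm x powi (e - 1) * norm h) * (inverse m * norm x powi (- e))"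
        using m(1) g(1) by (intro mult_mono inv g(4) x mult_nonneg_nonneg) auto
      moreover have "norm x powi (- e - 1) = norm x powi (- e) * norm x powi (e - 1) * norm x powi (- e)"
      proof -
        have "norm x powi (- e) * norm x powi (e - 1) = norm x powi (- 1)"
          using x by (subst power_int_add[symmetric]) auto
        moreover have "norm x powi (- 1) * norm x powi (- e) = norm x powi (- 1 + - e)"
          using x by (subst power_int_add[symmetric]) auto
        moreover have "- e - 1 = - 1 + - e" by simp
        ultimately show ?thesis by (simp only:)
      qed
      ultimately show ?thesis by (simp add: abs_mult mult_ac)
    qed
    show "((\<lambda>x. inverse (g x)) has_derivative (\<lambda>h. - (inverse (g x) * g' x h * inverse (g x)))) (at x)"
      by (rule Deriv.has_derivative_inverse[OF g0[OF x] g(3)[OF x]])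
  qed (use m g in simp_all)
qed

text \<open>Numerators of degree 2 over a denominator of degree 3. The latter vanishes only at the
  origin, since |c| |x| - |x_1| \<ge> (|c| - 1) |x|; this is where |c| > 1 enters.\<close>

lemma homogeneous_bound_landau:
  assumes c: "\<bar>c\<bar> > 1"
  shows "homogeneous_bound (- 1) (\<lambda>x. landau c x $ k)"
proof -
  define L where "L x = c * norm x + (-1) * x $ 1" for x :: "real^3"
  have L: "homogeneous_bound 1 L"
    unfolding L_def
    by (rule homogeneous_bound_add[OF homogeneous_bound_cmult[OF homogeneous_bound_norm] homogeneous_bound_cmult[OF homogeneous_bound_component]])
  have den: "homogeneous_bound 3 (\<lambda>x. norm x * (L x * L x))"
    using homogeneous_bound_mult[OF homogeneous_bound_norm homogeneous_bound_mult[OF L L]] by simp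
  have invden: "homogeneous_bound (- 3) (\<lambda>x. inverse (norm x * (L x * L x)))"
  proof (rule homogeneous_bound_inverse[OF den, of "(\<bar>c\<bar> - 1)\<^sup>2"])
    fix x :: "real^3" assume "x \<noteq> 0"
    have "\<bar>c\<bar> * norm x - norm x \<le> \<bar>L x\<bar>"
      using component_le_norm_cart[of x 1] abs_triangle_ineq2[of "c * norm x" "x $ 1"]
      by (simp add: L_def abs_mult)
    then have "(\<bar>c\<bar> - 1) * norm x \<le> \<bar>L x\<bar>" by (simp add: left_diff_distrib)
    moreover have "0 \<le> (\<bar>c\<bar> - 1) * norm x" using c by simp
    ultimately have "((\<bar>c\<bar> - 1) * norm x)\<^sup>2 \<le> \<bar>L x\<bar>\<^sup>2" by (rule power_mono)
    then have "norm x * ((\<bar>c\<bar> - 1) * norm x)\<^sup>2 \<le> norm x * \<bar>L x\<bar>\<^sup>2"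
      by (rule mult_left_mono) simp
    then show "(\<bar>c\<bar> - 1)\<^sup>2 * norm x powi 3 \<le> \<bar>norm x * (L x * L x)\<bar>"
      by (simp add: abs_mult power2_eq_square power_int_def eval_nat_numeral mult_ac)
  qed (use c in simp)
  have quot: "homogeneous_bound (- 1) (\<lambda>x. 2 * (N x * inverse (norm x * (L x * L x))))"
    if "homogeneous_bound 2 N" for N
    using homogeneous_bound_cmult[OF homogeneous_bound_mult[OF that invden], of 2] by simp
  have prod: "homogeneous_bound 2 (\<lambda>x. f x * g x)" if "homogeneous_bound 1 f" "homogeneous_bound 1 g" for f g
    using homogeneous_bound_mult[OF that] by (simp only: one_add_one)
  have N1: "homogeneous_bound 2 (\<lambda>x. (c * (norm x * norm x) + ((-2) * (x $ 1 * norm x))) + c * (x $ 1 * x $ 1))"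
    by (rule homogeneous_bound_add[OF homogeneous_bound_add[OF homogeneous_bound_cmult homogeneous_bound_cmult] homogeneous_bound_cmult])
      (auto intro!: prod homogeneous_bound_component homogeneous_bound_norm)
  have N2: "homogeneous_bound 2 (\<lambda>x. x $ i * (c * x $ 1 + (-1) * norm x))" for i
    by (rule prod[OF homogeneous_bound_component homogeneous_bound_add[OF homogeneous_bound_cmult[OF homogeneous_bound_component]
          homogeneous_bound_cmult[OF homogeneous_bound_norm]]])
  \<comment> \<open>Multiples by negative constants replace subtraction, and products replace
    squares, so that the closure lemmas apply literally.\<close>
  have eq: "landau c x $ 1 = 2 * (((c * (norm x * norm x) + ((-2) * (x $ 1 * norm x))) + c * (x $ 1 * x $ 1)) * inverse (norm x * (L x * L x)))"
    "landau c x $ 2 = 2 * (x $ 2 * (c * x $ 1 + (-1) * norm x) * inverse (norm x * (L x * L x)))"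
    "landau c x $ 3 = 2 * (x $ 3 * (c * x $ 1 + (-1) * norm x) * inverse (norm x * (L x * L x)))" for x
    by (simp_all add: landau_def L_def power2_eq_square divide_inverse mult.assoc)
  show ?thesis
    using exhaust_3[of k] quot[OF N1] quot[OF N2] by (auto simp: eq)
qed

lemma landau_bounds:
  assumes "\<bar>c\<bar> > 1"
  obtains C where "C \<ge> 0" "\<And>x. x \<noteq> 0 \<Longrightarrow> norm (landau c x) \<le> C / norm x"
    "\<And>x. x \<noteq> 0 \<Longrightarrow> norm (classical_grad (landau c) x) \<le> C / (norm x)\<^sup>2"
proof -
  have "\<forall>k. \<exists>C f'. C \<ge> 0 \<and> (\<forall>x. x \<noteq> 0 \<longrightarrow> \<bar>landau c x $ k\<bar> \<le> C * norm x powi - 1) \<and>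
    (\<forall>x. x \<noteq> 0 \<longrightarrow> ((\<lambda>x. landau c x $ k) has_derivative f' x) (at x)) \<and>
    (\<forall>x h. x \<noteq> 0 \<longrightarrow> \<bar>f' x h\<bar> \<le> C * norm x powi (- 1 - 1) * norm h)"
    using homogeneous_bound_landau[OF assms] unfolding homogeneous_bound_def by (rule allI)
  from choice[OF this] obtain C where "\<forall>k. \<exists>f'. C k \<ge> 0 \<and> (\<forall>x. x \<noteq> 0 \<longrightarrow> \<bar>landau c x $ k\<bar> \<le> C k * norm x powi - 1) \<and>
    (\<forall>x. x \<noteq> 0 \<longrightarrow> ((\<lambda>x. landau c x $ k) has_derivative f' x) (at x)) \<and>
    (\<forall>x h. x \<noteq> 0 \<longrightarrow> \<bar>f' x h\<bar> \<le> C k * norm x powi (- 1 - 1) * norm h)" ..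
  from choice[OF this] obtain f' where C': "\<forall>k. C k \<ge> 0 \<and> (\<forall>x. x \<noteq> 0 \<longrightarrow> \<bar>landau c x $ k\<bar> \<le> C k * norm x powi - 1) \<and>
    (\<forall>x. x \<noteq> 0 \<longrightarrow> ((\<lambda>x. landau c x $ k) has_derivative f' k x) (at x)) \<and>
    (\<forall>x h. x \<noteq> 0 \<longrightarrow> \<bar>f' k x h\<bar> \<le> C k * norm x powi (- 1 - 1) * norm h)" ..
  have C: "\<And>k. C k \<ge> 0" "\<And>k x. x \<noteq> 0 \<Longrightarrow> \<bar>landau c x $ k\<bar> \<le> C k * norm x powi - 1"
    "\<And>k x. x \<noteq> 0 \<Longrightarrow> ((\<lambda>x. landau c x $ k) has_derivative f' k x) (at x)"
    "\<And>k x h. x \<noteq> 0 \<Longrightarrow> \<bar>f' k x h\<bar> \<le> C k * norm x powi (- 1 - 1) * norm h"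
    using C' by (blast, blast, blast, blast)
  define B where "B = (\<Sum>k\<in>UNIV. C k)"
  have B: "B \<ge> 0" unfolding B_def by (intro sum_nonneg) (simp add: C)
  have 1: "norm (landau c x) \<le> B / norm x" if "x \<noteq> 0" for x
  proof -
    have "norm (landau c x) \<le> (\<Sum>k\<in>UNIV. \<bar>landau c x $ k\<bar>)" by (rule norm_le_l1_cart)
    also have "\<dots> \<le> (\<Sum>k\<in>UNIV. C k * norm x powi - 1)" by (intro sum_mono C(2) that)
    also have "\<dots> = B / norm x" by (simp add: B_def sum_distrib_right divide_inverse power_int_minus)
    finally show ?thesis .
  qed
  have 2: "norm (classical_grad (landau c) x) \<le> 3 * B / (norm x)\<^sup>2" if x: "x \<noteq> 0" for x
  proof -
    \<comment> \<open>The componentwise derivatives assemble to one of the field, so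
      \<open>frechet_derivative\<close> inside \<open>partial\<close> denotes it rather than an
      unspecified map.\<close>
    have "((\<lambda>x. \<chi> k. landau c x $ k) has_derivative (\<lambda>h. \<chi> k. f' k x h)) (at x)"
      using C(3)[OF x] by (subst has_derivative_componentwise_within)
        (auto simp: Basis_vec_def inner_axis intro!: derivative_eq_intros)
    then have "(landau c has_derivative (\<lambda>h. \<chi> k. f' k x h)) (at x)" by simp
    then have "frechet_derivative (landau c) (at x) = (\<lambda>h. \<chi> k. f' k x h)"
      by (rule frechet_derivative_at[symmetric])
    then have p: "partial j (landau c) x $ k = f' k x (axis j 1)" for j k
      by (simp add: partial_def)
    have row: "norm (partial j (landau c) x) \<le> B / (norm x)\<^sup>2" for j
    proof -
      have "norm (partial j (landau c) x) \<le> (\<Sum>k\<in>UNIV. \<bar>partial j (landau c) x $ k\<bar>)" by (rule norm_le_l1_cart)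
      also have "\<dots> \<le> (\<Sum>k\<in>UNIV. C k * norm x powi - 2)"
        unfolding p using C(4)[OF x, of _ "axis j 1"] by (intro sum_mono) (simp add: norm_axis_1)
      also have "\<dots> = B / (norm x)\<^sup>2" by (simp add: B_def sum_distrib_right divide_inverse power_int_minus)
      finally show ?thesis .
    qed
    have "norm (classical_grad (landau c) x) \<le> (\<Sum>j\<in>UNIV. norm (partial j (landau c) x))"
      unfolding norm_vec_def[of "classical_grad _ _"] classical_grad_row by (rule L2_set_le_sum) simp
    also have "\<dots> \<le> (\<Sum>j\<in>(UNIV::3 set). B / (norm x)\<^sup>2)" by (intro sum_mono row)
    also have "\<dots> = 3 * B / (norm x)\<^sup>2" by simp
    finally show ?thesis .
  qed
  show ?thesis
  \<comment> \<open>One constant for both bounds; the 3 counts the rows of the gradient.\<close>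
  proof (rule that[of "3 * B"])
    show "norm (landau c x) \<le> 3 * B / norm x" if "x \<noteq> 0" for x
    proof -
      have "B / norm x \<le> 3 * B / norm x" using B by (intro divide_right_mono) auto
      then show ?thesis using 1[OF that] by linarith
    qed
  qed (use B 2 in auto)
qed

section \<open>Estimates for the terms of the weak formulation\<close>

lemma Sobolev_inequality:
  assumes "in_dotH1 w"
  shows "(\<integral>\<^sup>+x. ennreal (norm (w x) ^ 6) \<partial>lebesgue) \<le> ennreal (1296 * dotH1_norm w ^ 6)"
proof -
  obtain \<phi> :: "nat \<Rightarrow> vfield" where test: "\<And>n. test_fun (\<phi> n)"
    and conv: "\<And>C. compact C \<Longrightarrow> (\<lambda>n. LINT x:C|lebesgue. norm (\<phi> n x - w x)) \<longlonglongrightarrow> 0"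
    and lim: "(\<lambda>n. l2_norm (classical_grad (\<phi> n))) \<longlonglongrightarrow> l2_norm (weak_grad w)"
    by (rule in_dotH1_approximation[OF assms]) (rule that, assumption+)
  have w: "loc_integrable w" using assms by (simp add: in_dotH1_def)
  have "(\<lambda>n. 1296 * l2_norm (classical_grad (\<phi> n)) ^ 6) \<longlonglongrightarrow> 1296 * l2_norm (weak_grad w) ^ 6"
    by (intro tendsto_intros lim)
  from Fatou_loc_L1[OF test w conv _ _ this, of "\<lambda>_. 1" 6] show ?thesis
    using Sobolev_test_fun[OF test] by (simp add: dotH1_norm_def)
qed

lemma L2_abs_integral_le_const:
  assumes f: "in_L2 f" and g: "in_L2 g" and C: "C \<ge> 0"
    and h: "AE x in lebesgue. \<bar>h x\<bar> \<le> C * (norm (f x) * norm (g x))"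
  shows "\<bar>LINT x|lebesgue. h x\<bar> \<le> C * (l2_norm f * l2_norm g)"
proof -
  have "\<bar>LINT x|lebesgue. h x\<bar> \<le> (LINT x|lebesgue. C * (norm (f x) * norm (g x)))"
    by (rule abs_integral_le[OF integrable_mult_right[OF L2_integrable_product[OF f g]] h])
  also have "\<dots> \<le> C * (l2_norm f * l2_norm g)"
    using mult_left_mono[OF L2_Cauchy_Schwarz[OF f g] C] by simp
  finally show ?thesis .
qed

lemma AE_lebesgue_nonzero: "AE x::'a::euclidean_space in lebesgue. x \<noteq> 0"
  using AE_lborel_singleton[of "0::'a"] by (simp add: AE_completion_iff)

lemma in_dotH1_weak_grad_in_L2: "in_dotH1 w \<Longrightarrow> in_L2 (weak_grad w)"
  by (erule in_dotH1_approximation)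

lemma dotH1_norm_nonneg: "0 \<le> dotH1_norm w"
  by (simp add: dotH1_norm_def l2_norm_nonneg)

text \<open>Young's inequality for the exponents 3, 2, 6, whose reciprocals add up to 1, with
  constants 1: split off Y, then compare X with Z^2 in the product X^2 Z^2.\<close>

lemma mult3_le_powers:
  fixes X Y Z :: real
  assumes "0 \<le> X" "0 \<le> Y" "0 \<le> Z"
  shows "X * Y * Z \<le> X ^ 3 + Y\<^sup>2 + Z ^ 6"
proof -
  have "2 * Y * (X * Z) \<le> Y\<^sup>2 + (X * Z)\<^sup>2" by (rule sum_squares_bound)
  moreover have "(X * Z)\<^sup>2 \<le> X ^ 3 + Z ^ 6"
  proof (cases "X \<le> Z\<^sup>2")
    case True
    have "(X * Z)\<^sup>2 = X\<^sup>2 * Z\<^sup>2" by (rule power_mult_distrib)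
    also have "\<dots> \<le> (Z\<^sup>2)\<^sup>2 * Z\<^sup>2" using True assms by (intro mult_right_mono power_mono) auto
    also have "\<dots> = Z ^ 6" by (simp flip: power_mult power_add)
    finally show ?thesis using assms by (simp add: add_increasing)
  next
    case False
    have "(X * Z)\<^sup>2 = X\<^sup>2 * Z\<^sup>2" by (rule power_mult_distrib)
    also have "\<dots> \<le> X\<^sup>2 * X" using False by (intro mult_left_mono) auto
    also have "\<dots> = X ^ 3" by (simp add: power2_eq_square power3_eq_cube)
    finally show ?thesis using assms by (simp add: add_increasing2)
  qed
  moreover have "0 \<le> X * Y * Z" "0 \<le> Y\<^sup>2" using assms by auto
  ultimately show ?thesis by (simp add: mult_ac)
qed

text \<open>Hoelder's inequality with exponents 3, 2, 6 for \<open>\<bar>w\<bar>\<^sup>2\<close>, \<open>\<bar>\<psi>\<bar>\<close>, \<open>\<bar>\<psi>\<bar>\<close>, combined with Sobolev's; the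
  strictly positive upper bounds avoid dividing by norms that may vanish.\<close>
lemma
  assumes w: "in_dotH1 w" and \<psi>: "in_dotH1 \<psi>" "in_L2 \<psi>"
    and A: "dotH1_norm w \<le> A" "0 < A" and N: "l2_norm \<psi> \<le> N" "0 < N" and E: "dotH1_norm \<psi> \<le> E" "0 < E"
  shows product_in_L2: "in_L2 (\<lambda>x. norm (w x) *\<^sub>R \<psi> x)"
    and l2_norm_product_le: "l2_norm (\<lambda>x. norm (w x) *\<^sub>R \<psi> x) \<le> 51 * A * sqrt (N * E)"
proof -
  have [measurable]: "w \<in> borel_measurable lebesgue" "\<psi> \<in> borel_measurable lebesgue"
    using w \<psi> by (auto simp: in_dotH1_def intro: loc_integrable_measurable)
  \<comment> \<open>The target square up to a constant. With |w|, |psi|, |psi| divided by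
    \<open>A\<close>, \<open>N\<close>, \<open>E\<close>, the three integrals left by Young's
    inequality are at most 1296, 1 and 1296.\<close>
  define Q where "Q = A\<^sup>2 * N * E"
  have Q: "Q > 0" using A N E by (simp add: Q_def)
  have pt: "(norm (norm (w x) *\<^sub>R \<psi> x))\<^sup>2 \<le> Q / A ^ 6 * norm (w x) ^ 6 + (Q / N\<^sup>2 * (norm (\<psi> x))\<^sup>2 + Q / E ^ 6 * norm (\<psi> x) ^ 6)" for x
  proof -
    have "(norm (norm (w x) *\<^sub>R \<psi> x))\<^sup>2 = Q * ((norm (w x))\<^sup>2 / A\<^sup>2 * (norm (\<psi> x) / N) * (norm (\<psi> x) / E))"
      using A N E by (simp add: Q_def power_mult_distrib power2_eq_square[of "norm (\<psi> x)"])
    also have "\<dots> \<le> Q * (((norm (w x))\<^sup>2 / A\<^sup>2) ^ 3 + (norm (\<psi> x) / N)\<^sup>2 + (norm (\<psi> x) / E) ^ 6)"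
      using A N E Q by (intro mult_left_mono mult3_le_powers) auto
    also have "\<dots> = Q / A ^ 6 * norm (w x) ^ 6 + (Q / N\<^sup>2 * (norm (\<psi> x))\<^sup>2 + Q / E ^ 6 * norm (\<psi> x) ^ 6)"
      by (simp add: power_divide distrib_left flip: power_mult)
    finally show ?thesis .
  qed
  have scale: "(\<integral>\<^sup>+x. ennreal (q / s * f x) \<partial>lebesgue) \<le> ennreal (q * b)"
    if "(\<integral>\<^sup>+x. ennreal (f x) \<partial>lebesgue) \<le> ennreal (b * s)" "q \<ge> 0" "s > 0" "f \<in> borel_measurable lebesgue" "b \<ge> 0"
    for q s b and f :: "real^3 \<Rightarrow> real"
  proof -
    have "ennreal (q / s * f x) = ennreal (q / s) * ennreal (f x)" for x
      using that by (intro ennreal_mult') simp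
    then have "(\<integral>\<^sup>+x. ennreal (q / s * f x) \<partial>lebesgue) = ennreal (q / s) * (\<integral>\<^sup>+x. ennreal (f x) \<partial>lebesgue)"
      using that by (simp only:) (rule nn_integral_cmult, simp)
    also have "\<dots> \<le> ennreal (q / s) * ennreal (b * s)" by (intro mult_left_mono that) auto
    also have "\<dots> = ennreal (q * b)" using that by (simp flip: ennreal_mult)
    finally show ?thesis .
  qed
  have s1: "(\<integral>\<^sup>+x. ennreal (Q / A ^ 6 * norm (w x) ^ 6) \<partial>lebesgue) \<le> ennreal (Q * 1296)"
  proof (rule scale)
    have "1296 * dotH1_norm w ^ 6 \<le> 1296 * A ^ 6"
      by (intro mult_left_mono power_mono A dotH1_norm_nonneg) auto
    then show "(\<integral>\<^sup>+x. ennreal (norm (w x) ^ 6) \<partial>lebesgue) \<le> ennreal (1296 * A ^ 6)"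
      using Sobolev_inequality[OF w] by (meson ennreal_leI order_trans)
  qed (use Q A in auto)
  have s2: "(\<integral>\<^sup>+x. ennreal (Q / N\<^sup>2 * (norm (\<psi> x))\<^sup>2) \<partial>lebesgue) \<le> ennreal (Q * 1)"
  proof (rule scale)
    have "(l2_norm \<psi>)\<^sup>2 \<le> N\<^sup>2" by (intro power_mono N l2_norm_nonneg)
    then show "(\<integral>\<^sup>+x. ennreal ((norm (\<psi> x))\<^sup>2) \<partial>lebesgue) \<le> ennreal (1 * N\<^sup>2)"
      unfolding nn_integral_L2[OF \<psi>(2)] by (simp add: ennreal_leI)
  qed (use Q N in auto)
  have s3: "(\<integral>\<^sup>+x. ennreal (Q / E ^ 6 * norm (\<psi> x) ^ 6) \<partial>lebesgue) \<le> ennreal (Q * 1296)"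
  proof (rule scale)
    have "1296 * dotH1_norm \<psi> ^ 6 \<le> 1296 * E ^ 6"
      by (intro mult_left_mono power_mono E dotH1_norm_nonneg) auto
    then show "(\<integral>\<^sup>+x. ennreal (norm (\<psi> x) ^ 6) \<partial>lebesgue) \<le> ennreal (1296 * E ^ 6)"
      using Sobolev_inequality[OF \<psi>(1)] by (meson ennreal_leI order_trans)
  qed (use Q E in auto)
  have "(\<integral>\<^sup>+x. ennreal ((norm (norm (w x) *\<^sub>R \<psi> x))\<^sup>2) \<partial>lebesgue)
      \<le> (\<integral>\<^sup>+x. ennreal (Q / A ^ 6 * norm (w x) ^ 6) + (ennreal (Q / N\<^sup>2 * (norm (\<psi> x))\<^sup>2) + ennreal (Q / E ^ 6 * norm (\<psi> x) ^ 6)) \<partial>lebesgue)"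
    using pt Q A N E by (intro nn_integral_mono) (auto simp flip: ennreal_plus intro!: ennreal_leI simp del: norm_scaleR)
  also have "\<dots> = (\<integral>\<^sup>+x. ennreal (Q / A ^ 6 * norm (w x) ^ 6) \<partial>lebesgue)
      + ((\<integral>\<^sup>+x. ennreal (Q / N\<^sup>2 * (norm (\<psi> x))\<^sup>2) \<partial>lebesgue) + (\<integral>\<^sup>+x. ennreal (Q / E ^ 6 * norm (\<psi> x) ^ 6) \<partial>lebesgue))"
    by (subst nn_integral_add, measurable, subst nn_integral_add, measurable)
  also have "\<dots> \<le> ennreal (Q * 1296) + (ennreal (Q * 1) + ennreal (Q * 1296))"
    by (intro add_mono s1 s2 s3)
  also have "\<dots> = ennreal (2593 * Q)" using Q by (simp flip: ennreal_plus)
  \<comment> \<open>1296 + 1 + 1296 = 2593 \<le> 2601 = 51^2.\<close>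
  also have "\<dots> \<le> ennreal ((51 * A * sqrt (N * E))\<^sup>2)"
    using Q N E by (intro ennreal_leI) (simp add: power_mult_distrib Q_def)
  finally show "in_L2 (\<lambda>x. norm (w x) *\<^sub>R \<psi> x)" "l2_norm (\<lambda>x. norm (w x) *\<^sub>R \<psi> x) \<le> 51 * A * sqrt (N * E)"
    using in_L2I_nn_integral[of "\<lambda>x. norm (w x) *\<^sub>R \<psi> x" "51 * A * sqrt (N * E)"] A N E by auto
qed

lemma trilinear_bound:
  assumes w: "in_dotH1 w" and \<psi>: "in_dotH1 \<psi>" "in_L2 \<psi>"
    and N: "l2_norm \<psi> \<le> N" "0 < N" and E: "dotH1_norm \<psi> \<le> E" "0 < E"
  shows "\<bar>l2_inner (advect w (weak_grad w)) \<psi>\<bar> \<le> 51 * sqrt (N * E) * (dotH1_norm w)\<^sup>2"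
proof -
  \<comment> \<open>If the gradient norm is 0, any positive value will do: the other factor
    \<open>dotH1_norm w\<close> then makes the product 0.\<close>
  define A where "A = (if dotH1_norm w = 0 then 1 else dotH1_norm w)"
  have A: "dotH1_norm w \<le> A" "0 < A" "dotH1_norm w * A = (dotH1_norm w)\<^sup>2"
    using dotH1_norm_nonneg[of w] by (auto simp: A_def power2_eq_square)
  have "\<bar>advect w (weak_grad w) x \<bullet> \<psi> x\<bar> \<le> norm (weak_grad w x) * norm (norm (w x) *\<^sub>R \<psi> x)" for x
    using mult_right_mono[OF norm_advect_le[of w "weak_grad w" x] norm_ge_zero[of "\<psi> x"]]
    by (intro order_trans[OF Cauchy_Schwarz_ineq2]) (simp add: mult_ac)
  then have "\<bar>l2_inner (advect w (weak_grad w)) \<psi>\<bar> \<le> l2_norm (weak_grad w) * l2_norm (\<lambda>x. norm (w x) *\<^sub>R \<psi> x)"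
    unfolding l2_inner_def
    by (intro L2_abs_integral_le in_dotH1_weak_grad_in_L2 w product_in_L2[OF w \<psi> A(1,2) N E]) simp
  also have "\<dots> \<le> dotH1_norm w * (51 * A * sqrt (N * E))"
    unfolding dotH1_norm_def[symmetric]
    by (intro mult_left_mono l2_norm_product_le[OF w \<psi> A(1,2) N E] dotH1_norm_nonneg)
  also have "\<dots> = 51 * sqrt (N * E) * (dotH1_norm w * A)" by simp
  finally show ?thesis unfolding A(3) .
qed

text \<open>The decay of \<open>v\<close> is spent on Hardy's inequality: the weight 1 / |x|^2 of
  its gradient is shared by \<open>w\<close> and \<open>\<psi>\<close>, which costs 2 times 2, while
  the weight 1 / |x| of \<open>v\<close> itself goes to \<open>\<psi>\<close> alone, which costs
  2.\<close>

lemma linear_terms_bound: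
  assumes w: "in_dotH1 w" and \<psi>: "in_dotH1 \<psi>" and C: "C \<ge> 0"
    and v: "\<And>x. x \<noteq> 0 \<Longrightarrow> norm (v x) \<le> C / norm x"
    and Dv: "\<And>x. x \<noteq> 0 \<Longrightarrow> norm (classical_grad v x) \<le> C / (norm x)\<^sup>2"
  shows "\<bar>l2_inner (weak_grad w) (weak_grad \<psi>)\<bar> \<le> dotH1_norm w * dotH1_norm \<psi>"
    and "\<bar>l2_inner (advect w (classical_grad v)) \<psi>\<bar> \<le> 4 * C * (dotH1_norm w * dotH1_norm \<psi>)"
    and "\<bar>l2_inner (advect v (weak_grad w)) \<psi>\<bar> \<le> 2 * C * (dotH1_norm w * dotH1_norm \<psi>)"
proof -
  show "\<bar>l2_inner (weak_grad w) (weak_grad \<psi>)\<bar> \<le> dotH1_norm w * dotH1_norm \<psi>"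
    unfolding l2_inner_def dotH1_norm_def
    by (intro L2_abs_integral_le in_dotH1_weak_grad_in_L2 w \<psi>) (simp add: Cauchy_Schwarz_ineq2)
  have inner_le: "\<bar>advect u G x \<bullet> \<psi> x\<bar> \<le> norm (u x) * norm (G x) * norm (\<psi> x)" for u G x
    using mult_right_mono[OF norm_advect_le[of u G x] norm_ge_zero[of "\<psi> x"]]
    by (intro order_trans[OF Cauchy_Schwarz_ineq2]) simp
  have "\<bar>l2_inner (advect w (classical_grad v)) \<psi>\<bar>
      \<le> C * (l2_norm (\<lambda>x. w x /\<^sub>R norm x) * l2_norm (\<lambda>x. \<psi> x /\<^sub>R norm x))"
    unfolding l2_inner_def
  proof (rule L2_abs_integral_le_const[OF Hardy_in_L2[OF w] Hardy_in_L2[OF \<psi>] C])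
    show "AE x in lebesgue. \<bar>advect w (classical_grad v) x \<bullet> \<psi> x\<bar> \<le> C * (norm (w x /\<^sub>R norm x) * norm (\<psi> x /\<^sub>R norm x))"
      using AE_lebesgue_nonzero
    proof eventually_elim
      case (elim x)
      have "norm (w x) * norm (classical_grad v x) * norm (\<psi> x) \<le> norm (w x) * (C / (norm x)\<^sup>2) * norm (\<psi> x)"
        by (intro mult_right_mono mult_left_mono Dv elim) auto
      also have "\<dots> = C * (norm (w x /\<^sub>R norm x) * norm (\<psi> x /\<^sub>R norm x))"
        by (simp add: divide_inverse power2_eq_square mult_ac)
      finally show ?case using inner_le[of w "classical_grad v" x] by linarith
    qed
  qed
  also have "\<dots> \<le> C * ((2 * dotH1_norm w) * (2 * dotH1_norm \<psi>))"
    by (intro mult_left_mono mult_mono Hardy_inequality w \<psi> C) (auto simp: dotH1_norm_nonneg l2_norm_nonneg)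
  finally show "\<bar>l2_inner (advect w (classical_grad v)) \<psi>\<bar> \<le> 4 * C * (dotH1_norm w * dotH1_norm \<psi>)"
    by (simp add: mult_ac)
  have "\<bar>l2_inner (advect v (weak_grad w)) \<psi>\<bar> \<le> C * (l2_norm (weak_grad w) * l2_norm (\<lambda>x. \<psi> x /\<^sub>R norm x))"
    unfolding l2_inner_def
  proof (rule L2_abs_integral_le_const[OF in_dotH1_weak_grad_in_L2[OF w] Hardy_in_L2[OF \<psi>] C])
    show "AE x in lebesgue. \<bar>advect v (weak_grad w) x \<bullet> \<psi> x\<bar> \<le> C * (norm (weak_grad w x) * norm (\<psi> x /\<^sub>R norm x))"
      using AE_lebesgue_nonzero
    proof eventually_elim
      case (elim x)
      have "norm (v x) * norm (weak_grad w x) * norm (\<psi> x) \<le> (C / norm x) * norm (weak_grad w x) * norm (\<psi> x)"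
        by (intro mult_right_mono v elim) auto
      also have "\<dots> = C * (norm (weak_grad w x) * norm (\<psi> x /\<^sub>R norm x))"
        by (simp add: divide_inverse mult_ac)
      finally show ?case using inner_le[of v "weak_grad w" x] by linarith
    qed
  qed
  also have "\<dots> \<le> C * (dotH1_norm w * (2 * dotH1_norm \<psi>))"
    unfolding dotH1_norm_def[of w, symmetric]
    by (intro mult_left_mono Hardy_inequality \<psi> C) (auto simp: dotH1_norm_nonneg)
  finally show "\<bar>l2_inner (advect v (weak_grad w)) \<psi>\<bar> \<le> 2 * C * (dotH1_norm w * dotH1_norm \<psi>)"
    by (simp add: mult_ac)
qed

text \<open>Inside the ball |g| \<le> R |g| / |x| and Hardy's inequality applies; outside only the
  tail of \<open>f\<close> counts. With \<open>f\<close> fixed, a large R makes the tail small,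
  after which a small gradient of \<open>g\<close> handles the rest.\<close>

lemma l2_inner_le_tail:
  fixes f g :: vfield
  assumes f: "in_L2 f" and g: "in_L2 g" "in_dotH1 g" and R: "0 \<le> R"
  shows "\<bar>l2_inner f g\<bar> \<le> 2 * R * l2_norm f * dotH1_norm g + l2_norm (\<lambda>x. indicator (- cball 0 R) x *\<^sub>R f x) * l2_norm g"
proof -
  let ?t = "\<lambda>x. indicator (- cball 0 R) x *\<^sub>R f x" and ?h = "\<lambda>x. g x /\<^sub>R norm x"
  have [measurable]: "f \<in> borel_measurable lebesgue" using f in_L2_measurable by auto
  have [measurable]: "- cball 0 R \<in> sets (lebesgue :: (real^3) measure)" by (simp flip: closed_def)
  have t: "in_L2 ?t"
  proof (rule in_L2_scale_bound(1)[OF f, of _ 1])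
    show "?t \<in> borel_measurable lebesgue" by measurable
  qed (auto simp: indicator_def)
  note int = L2_integrable_product[OF f Hardy_in_L2[OF g(2)]] L2_integrable_product[OF t g(1)]
  have "\<bar>l2_inner f g\<bar> \<le> (LINT x|lebesgue. R * (norm (f x) * norm (?h x)) + norm (?t x) * norm (g x))"
    unfolding l2_inner_def
  proof (rule abs_integral_le)
    show "integrable lebesgue (\<lambda>x. R * (norm (f x) * norm (?h x)) + norm (?t x) * norm (g x))"
      by (intro Bochner_Integration.integrable_add integrable_mult_right int)
    show "AE x in lebesgue. \<bar>f x \<bullet> g x\<bar> \<le> R * (norm (f x) * norm (?h x)) + norm (?t x) * norm (g x)"
      using AE_lebesgue_nonzero
    proof eventually_elim
      case (elim x)
      have cs: "\<bar>f x \<bullet> g x\<bar> \<le> norm (f x) * norm (g x)" by (rule Cauchy_Schwarz_ineq2)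
      show ?case
      proof (cases "norm x \<le> R")
        case True
        have "norm (f x) * norm (g x) = norm x * (norm (f x) * norm (?h x))" using elim by simp
        also have "\<dots> \<le> R * (norm (f x) * norm (?h x))" using True by (intro mult_right_mono) auto
        finally show ?thesis using cs True by simp
      next
        case False
        then show ?thesis using cs R by (simp add: add_increasing)
      qed
    qed
  qed
  also have "\<dots> = R * (LINT x|lebesgue. norm (f x) * norm (?h x)) + (LINT x|lebesgue. norm (?t x) * norm (g x))"
    by (subst Bochner_Integration.integral_add[OF integrable_mult_right[OF int(1)] int(2)]) (subst integral_mult_right_zero, rule refl)
  also have "\<dots> \<le> R * (l2_norm f * (2 * dotH1_norm g)) + l2_norm ?t * l2_norm g"
  proof (intro add_mono mult_left_mono R L2_Cauchy_Schwarz[OF t g(1)])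
    have "l2_norm f * l2_norm ?h \<le> l2_norm f * (2 * dotH1_norm g)"
      by (intro mult_left_mono Hardy_inequality g l2_norm_nonneg)
    then show "(LINT x|lebesgue. norm (f x) * norm (?h x)) \<le> l2_norm f * (2 * dotH1_norm g)"
      using L2_Cauchy_Schwarz[OF f Hardy_in_L2[OF g(2)]] by linarith
  qed
  finally show ?thesis by (simp add: mult_ac)
qed

lemma l2_norm_tail_tendsto_0:
  fixes f :: "real^3 \<Rightarrow> 'b::euclidean_space"
  assumes f: "in_L2 f"
  shows "(\<lambda>n. l2_norm (\<lambda>x. indicator (- cball 0 (real n)) x *\<^sub>R f x)) \<longlonglongrightarrow> 0"
proof -
  have [measurable]: "f \<in> borel_measurable lebesgue" using f in_L2_measurable by auto
  have [measurable]: "- cball 0 (real n) \<in> sets (lebesgue :: (real^3) measure)" for n by (simp flip: closed_def)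
  have "(\<lambda>n. LINT x|lebesgue. (norm (indicator (- cball 0 (real n)) x *\<^sub>R f x))\<^sup>2) \<longlonglongrightarrow> (LINT x::real^3|lebesgue. (0::real))"
  proof (rule integral_dominated_convergence)
    show "integrable lebesgue (\<lambda>x. (norm (f x))\<^sup>2)" using f by (simp add: in_L2_def)
    show "AE x in lebesgue. (\<lambda>n. (norm (indicator (- cball 0 (real n)) x *\<^sub>R f x))\<^sup>2) \<longlonglongrightarrow> 0"
    proof (rule AE_I2)
      fix x :: "real^3"
      obtain n0 where "norm x \<le> real n0" using real_arch_simple by blast
      then have "\<forall>\<^sub>F n in sequentially. (norm (indicator (- cball 0 (real n)) x *\<^sub>R f x))\<^sup>2 = 0"
        unfolding eventually_sequentially by (intro exI[of _ n0]) (auto simp: indicator_def)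
      then show "(\<lambda>n. (norm (indicator (- cball 0 (real n)) x *\<^sub>R f x))\<^sup>2) \<longlonglongrightarrow> 0"
        by (rule tendsto_eventually)
    qed
    show "AE x in lebesgue. norm ((norm (indicator (- cball 0 (real n)) x *\<^sub>R f x))\<^sup>2) \<le> (norm (f x))\<^sup>2" for n
      by (rule AE_I2) (auto simp: indicator_def)
  qed measurable
  then show ?thesis
    unfolding l2_norm_def using tendsto_real_sqrt[of _ 0] by fastforce
qed

section \<open>Decay of weak solutions\<close>

text \<open>The zero time derivative removes the term (w, phi_t) from the weak formulation.\<close>

lemma constant_test_field:
  assumes "H1_sigma \<psi>"
  shows "C_H1_sigma (\<lambda>_. \<psi>)" "C1_L2_sigma (\<lambda>_. \<psi>) (\<lambda>_ _. 0)"
proof -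
  have "H1_norm (\<lambda>x. 0) = 0"
    by (simp add: H1_norm_def l2_norm_zero l2_norm_weak_grad_zero)
  then show "C_H1_sigma (\<lambda>_. \<psi>)" using assms by (simp add: C_H1_sigma_def)
  have "L2_sigma (\<lambda>x. 0)" by (simp add: L2_sigma_def in_L2_zero div_free_def)
  then show "C1_L2_sigma (\<lambda>_. \<psi>) (\<lambda>_ _. 0)"
    using assms by (simp add: C1_L2_sigma_def l2_norm_zero H1_sigma_def in_H1_def L2_sigma_def)
qed

lemma l2_inner_self: "l2_inner f f = (l2_norm f)\<^sup>2"
  by (simp add: l2_inner_def l2_norm_power2 power2_norm_eq_inner)

section \<open>Integrals over time\<close>

lemma L2_dotH1_sigma_AE:
  assumes "L2_dotH1_sigma T w"
  shows "AE t in lebesgue. t \<in> {0..T} \<longrightarrow> dotH1_sigma (w t)"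
    and "set_integrable lebesgue {0..T} (\<lambda>t. (dotH1_norm (w t))\<^sup>2)"
  using assms by (auto simp: L2_dotH1_sigma_def AE_restrict_space_iff integrable_restrict_space set_integrable_def)

text \<open>Otherwise \<open>D t > \<kappa> / t\<close> for almost all \<open>t \<ge> T\<close>, and the integral of \<open>D\<close> would diverge logarithmically.\<close>
lemma exists_time_with_small_value:
  fixes D :: "real \<Rightarrow> real"
  assumes int: "\<And>T. set_integrable lebesgue {0..T} D" and D: "\<And>t. 0 \<le> D t"
    and M: "\<And>T. T \<ge> 0 \<Longrightarrow> (LINT t:{0..T}|lebesgue. D t) \<le> M"
    and P: "AE t in lebesgue. t \<ge> 0 \<longrightarrow> P t" and "\<kappa> > 0" "T > 0"
  obtains t where "t \<ge> T" "P t" "t * D t \<le> \<kappa>"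
proof (rule ccontr)
  assume "\<not> thesis"
  with that have neg: "\<And>t. t \<ge> T \<Longrightarrow> P t \<Longrightarrow> t * D t > \<kappa>" by force
  \<comment> \<open>Chosen so that \<kappa> / t integrates over [T, S] to |M| + 1, which exceeds
    \<open>M\<close>.\<close>
  define S where "S = T * exp ((\<bar>M\<bar> + 1) / \<kappa>)"
  have S: "S \<ge> T" using \<open>T > 0\<close> \<open>\<kappa> > 0\<close> by (simp add: S_def)
  have fi: "has_bochner_integral lborel (\<lambda>t. \<kappa> / t * indicator {T..S} t) (\<kappa> * ln S - \<kappa> * ln T)"
    using \<open>T > 0\<close> S by (intro has_bochner_integral_FTC_Icc_real) (auto intro!: derivative_eq_intros continuous_intros)
  have "ln S = ln T + (\<bar>M\<bar> + 1) / \<kappa>" using \<open>T > 0\<close> by (simp add: S_def ln_mult)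
  then have "\<kappa> * ln S - \<kappa> * ln T = \<kappa> * ((\<bar>M\<bar> + 1) / \<kappa>)" by (simp only: distrib_left)
  also have "\<dots> = \<bar>M\<bar> + 1" using \<open>\<kappa> > 0\<close> by simp
  finally have "\<kappa> * ln S - \<kappa> * ln T = \<bar>M\<bar> + 1" .
  with fi have fi: "integrable lborel (\<lambda>t. \<kappa> / t * indicator {T..S} t)" "(LINT t|lborel. \<kappa> / t * indicator {T..S} t) = \<bar>M\<bar> + 1"
    by (auto simp: has_bochner_integral_iff)
  then have int1: "integrable lebesgue (\<lambda>t. \<kappa> / t * indicator {T..S} t)"
    and eq: "(LINT t|lebesgue. \<kappa> / t * indicator {T..S} t) = \<bar>M\<bar> + 1"
    using integrable_completion[OF borel_measurable_integrable[OF fi(1)]] integral_completion[OF borel_measurable_integrable[OF fi(1)]]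
    by simp_all
  have "(LINT t|lebesgue. \<kappa> / t * indicator {T..S} t) \<le> (LINT t|lebesgue. indicator {0..S} t *\<^sub>R D t)"
  proof (rule integral_mono_AE[OF int1])
    show "integrable lebesgue (\<lambda>t. indicator {0..S} t *\<^sub>R D t)"
      using int[of S] by (simp add: set_integrable_def)
    show "AE t in lebesgue. \<kappa> / t * indicator {T..S} t \<le> indicator {0..S} t *\<^sub>R D t"
      using P
    proof eventually_elim
      case (elim t)
      show ?case
      proof (cases "t \<in> {T..S}")
        case True
        then have "t > 0" "t * D t > \<kappa>" using \<open>T > 0\<close> elim neg[of t] by auto
        then have "\<kappa> / t \<le> D t" by (simp add: divide_le_eq mult.commute)
        then show ?thesis using True \<open>T > 0\<close> by (auto simp: indicator_def)
      qed (simp add: D)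
    qed
  qed
  also have "\<dots> \<le> M" using M[of S] S \<open>T > 0\<close> by (simp add: set_lebesgue_integral_def)
  finally show False using eq by linarith
qed

text \<open>Rests on \<open>abs_integral_le\<close>, so that the measurability in time of the terms
  of the weak formulation never has to be established.\<close>

lemma abs_set_integral_le_affine:
  fixes F D :: "real \<Rightarrow> real"
  assumes t: "0 \<le> t" and D: "set_integrable lebesgue {0..t} D"
    and F: "AE \<tau> in lebesgue. \<tau> \<in> {0..t} \<longrightarrow> \<bar>F \<tau>\<bar> \<le> \<alpha> + \<beta> * D \<tau>"
  shows "\<bar>LINT \<tau>:{0..t}|lebesgue. F \<tau>\<bar> \<le> \<alpha> * t + \<beta> * (LINT \<tau>:{0..t}|lebesgue. D \<tau>)"
proof -
  have int1: "integrable lebesgue (\<lambda>\<tau>. indicator {0..t} \<tau> * \<alpha>)"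
    using t by (intro integrable_mult_left integrable_real_indicator) simp_all
  have int2: "integrable lebesgue (\<lambda>\<tau>. indicator {0..t} \<tau> *\<^sub>R D \<tau>)"
    using D by (simp add: set_integrable_def)
  have "\<bar>LINT \<tau>:{0..t}|lebesgue. F \<tau>\<bar> \<le> (LINT \<tau>|lebesgue. indicator {0..t} \<tau> * \<alpha> + \<beta> * (indicator {0..t} \<tau> *\<^sub>R D \<tau>))"
    unfolding set_lebesgue_integral_def
  proof (rule abs_integral_le)
    show "integrable lebesgue (\<lambda>\<tau>. indicator {0..t} \<tau> * \<alpha> + \<beta> * (indicator {0..t} \<tau> *\<^sub>R D \<tau>))"
      by (intro Bochner_Integration.integrable_add integrable_mult_right int1 int2)
    show "AE \<tau> in lebesgue. \<bar>indicator {0..t} \<tau> *\<^sub>R F \<tau>\<bar> \<le> indicator {0..t} \<tau> * \<alpha> + \<beta> * (indicator {0..t} \<tau> *\<^sub>R D \<tau>)"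
      using F by eventually_elim (auto simp: indicator_def)
  qed
  also have "\<dots> = \<alpha> * t + \<beta> * (LINT \<tau>:{0..t}|lebesgue. D \<tau>)"
    unfolding set_lebesgue_integral_def using int1 int2 t by (simp add: mult.commute)
  finally show ?thesis .
qed

text \<open>Stands in for Cauchy-Schwarz in time: with r = sqrt t it bounds the integral of ||grad
  w|| over [0, t] by (1 + M) sqrt t / 2.\<close>

lemma le_weighted_square:
  fixes r a :: real
  assumes "r > 0"
  shows "a \<le> 1 / (2 * r) + r * a\<^sup>2 / 2"
proof -
  have "2 * 1 * (r * a) \<le> 1\<^sup>2 + (r * a)\<^sup>2" by (rule sum_squares_bound)
  then have "2 * (r * a) / (2 * r) \<le> (1 + (r * a)\<^sup>2) / (2 * r)"
    using assms by (intro divide_right_mono) auto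
  moreover have "(r * a)\<^sup>2 / (2 * r) = r * a\<^sup>2 / 2"
    using assms by (simp add: power2_eq_square)
  ultimately show ?thesis using assms by (simp add: add_divide_distrib)
qed

lemma weak_solution_energy_bound:
  assumes c: "\<bar>c\<bar> > 1"
    and sol: "weak_solution c w0 w"
    and N: "N > 0" "\<And>t. t \<ge> 0 \<Longrightarrow> l2_norm (w t) \<le> N"
    and M: "\<And>t. t \<ge> 0 \<Longrightarrow> (LINT \<tau>:{0..t}|lebesgue. (dotH1_norm (w \<tau>))\<^sup>2) \<le> M"
  obtains B where "B \<ge> 0" "\<And>t \<delta>. t \<ge> 1 \<Longrightarrow> dotH1_sigma (w t) \<Longrightarrow> \<delta> > 0 \<Longrightarrow> sqrt t * dotH1_norm (w t) \<le> \<delta>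
    \<Longrightarrow> (l2_norm (w t))\<^sup>2 \<le> \<bar>l2_inner (w 0) (w t)\<bar> + B * \<delta> + 51 * sqrt (N * \<delta>) * M"
proof -
  obtain C where C: "C \<ge> 0" "\<And>x. x \<noteq> 0 \<Longrightarrow> norm (landau c x) \<le> C / norm x"
    "\<And>x. x \<noteq> 0 \<Longrightarrow> norm (classical_grad (landau c) x) \<le> C / (norm x)\<^sup>2"
    using landau_bounds[OF c] by blast
  have L2s: "L2_sigma (w t)" if "t \<ge> 0" for t using sol that by (simp add: weak_solution_def)
  have M0: "0 \<le> M"
    by (rule order_trans[OF _ M[of 0]]) (auto simp: set_lebesgue_integral_def intro!: integral_nonneg_AE)
  \<comment> \<open>1 + 6 C = 1 + 4 C + 2 C adds the constants of the three linear terms; (1 + M) /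
    2 comes from \<open>le_weighted_square\<close>.\<close>
  define B where "B = (1 + 6 * C) * (1 + M) / 2"
  show ?thesis
  proof (rule that[of B])
    show "B \<ge> 0" unfolding B_def using C(1) M0 by simp
    fix t \<delta> :: real
    assume t: "t \<ge> 1" and dot: "dotH1_sigma (w t)" and \<delta>: "\<delta> > 0" and small: "sqrt t * dotH1_norm (w t) \<le> \<delta>"
    define \<psi> where "\<psi> = w t"
    define e where "e = dotH1_norm \<psi>"
    have e0: "e \<ge> 0" by (simp add: e_def dotH1_norm_nonneg)
    have st: "sqrt t \<ge> 1" "sqrt t > 0" using t by auto
    have "1 * e \<le> sqrt t * e" using st e0 by (intro mult_right_mono)
    then have e\<delta>: "e \<le> \<delta>" using small by (simp add: e_def \<psi>_def)
    have \<psi>: "in_dotH1 \<psi>" "in_L2 \<psi>" "div_free \<psi>"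
      using dot L2s[of t] t by (auto simp: \<psi>_def dotH1_sigma_def L2_sigma_def)
    \<comment> \<open>A field both in L^2 and in the homogeneous space lies in H^1, so
      \<open>\<psi>\<close> is an admissible test field.\<close>
    have "has_weak_grad \<psi> (weak_grad \<psi>)" by (rule in_dotH1_approximation[OF \<psi>(1)])
    then have "H1_sigma \<psi>"
      using in_dotH1_weak_grad_in_L2[OF \<psi>(1)] \<psi> by (auto simp: H1_sigma_def in_H1_def)
    note test = constant_test_field[OF this]
    define F where "F \<tau> = l2_inner (weak_grad (w \<tau>)) (weak_grad \<psi>)
               + l2_inner (advect (w \<tau>) (weak_grad (w \<tau>))) \<psi>
               + l2_inner (advect (w \<tau>) (classical_grad (landau c))) \<psi>
               + l2_inner (advect (landau c) (weak_grad (w \<tau>))) \<psi>" for \<tau>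
    have "l2_inner (w t) \<psi> + (LINT \<tau>:{0..t}|lebesgue. F \<tau>) = l2_inner (w 0) \<psi> + (LINT \<tau>:{0..t}|lebesgue. l2_inner (w \<tau>) (\<lambda>_. 0))"
      unfolding F_def
      by (rule sol[unfolded weak_solution_def, THEN conjunct2, THEN conjunct2, THEN conjunct2, rule_format,
            OF conjI[OF test] conjI[OF order_refl]]) (use t in simp)
    then have id: "(l2_norm \<psi>)\<^sup>2 + (LINT \<tau>:{0..t}|lebesgue. F \<tau>) = l2_inner (w 0) \<psi>"
      by (simp add: \<psi>_def[symmetric] l2_inner_self) (simp add: l2_inner_def set_lebesgue_integral_def)
    have X: "L2_dotH1_sigma t w" using sol t by (simp add: weak_solution_def X_space_def)
    \<comment> \<open>The weight r = sqrt t balances the two parts: \<open>\<alpha> * t\<close> and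
      the linear part of \<open>\<beta>\<close> are both (1 + 6 C) e sqrt t / 2.\<close>
    define \<alpha> where "\<alpha> = (1 + 6 * C) * e / (2 * sqrt t)"
    define \<beta> where "\<beta> = (1 + 6 * C) * e * sqrt t / 2 + 51 * sqrt (N * \<delta>)"
    have "\<bar>LINT \<tau>:{0..t}|lebesgue. F \<tau>\<bar> \<le> \<alpha> * t + \<beta> * (LINT \<tau>:{0..t}|lebesgue. (dotH1_norm (w \<tau>))\<^sup>2)"
    proof (rule abs_set_integral_le_affine)
      show "set_integrable lebesgue {0..t} (\<lambda>\<tau>. (dotH1_norm (w \<tau>))\<^sup>2)" by (rule L2_dotH1_sigma_AE(2)[OF X])
      show "AE \<tau> in lebesgue. \<tau> \<in> {0..t} \<longrightarrow> \<bar>F \<tau>\<bar> \<le> \<alpha> + \<beta> * (dotH1_norm (w \<tau>))\<^sup>2"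
        using L2_dotH1_sigma_AE(1)[OF X]
      proof eventually_elim
        case (elim \<tau>)
        show ?case
        proof
          assume \<tau>: "\<tau> \<in> {0..t}"
          then have w\<tau>: "in_dotH1 (w \<tau>)" using elim by (simp add: dotH1_sigma_def)
          define a where "a = dotH1_norm (w \<tau>)"
          note lin = linear_terms_bound[OF w\<tau> \<psi>(1) C, folded a_def e_def]
          have tri: "\<bar>l2_inner (advect (w \<tau>) (weak_grad (w \<tau>))) \<psi>\<bar> \<le> 51 * sqrt (N * \<delta>) * a\<^sup>2"
            unfolding a_def by (rule trilinear_bound[OF w\<tau> \<psi>(1,2) _ N(1) _ \<delta>])
              (use N(2)[of t] t e\<delta> in \<open>auto simp: \<psi>_def e_def\<close>)
          have "\<bar>F \<tau>\<bar> \<le> (1 + 6 * C) * (a * e) + 51 * sqrt (N * \<delta>) * a\<^sup>2"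
            unfolding F_def using lin tri by (simp add: distrib_right)
          moreover have "(1 + 6 * C) * e * a \<le> (1 + 6 * C) * e * (1 / (2 * sqrt t) + sqrt t * a\<^sup>2 / 2)"
            by (rule mult_left_mono[OF le_weighted_square[OF st(2)]]) (use C(1) e0 in simp)
          moreover have "(1 + 6 * C) * (a * e) = (1 + 6 * C) * e * a" by simp
          moreover have "(1 + 6 * C) * e * (1 / (2 * sqrt t) + sqrt t * a\<^sup>2 / 2) + 51 * sqrt (N * \<delta>) * a\<^sup>2 = \<alpha> + \<beta> * a\<^sup>2"
            by (simp add: \<alpha>_def \<beta>_def distrib_left distrib_right)
          ultimately show "\<bar>F \<tau>\<bar> \<le> \<alpha> + \<beta> * (dotH1_norm (w \<tau>))\<^sup>2"
            unfolding a_def[symmetric] by linarith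
        qed
      qed
    qed (use t in simp)
    also have "\<dots> \<le> \<alpha> * t + \<beta> * M"
    proof (intro add_left_mono mult_left_mono M)
      show "0 \<le> \<beta>"
        unfolding \<beta>_def using C(1) e0 N(1) \<delta> st by (intro add_nonneg_nonneg) auto
    qed (use t in simp)
    also have "\<dots> = B * (sqrt t * e) + 51 * sqrt (N * \<delta>) * M"
    proof -
      define k where "k = (1 + 6 * C) * e * sqrt t / 2"
      have "\<alpha> * t = (1 + 6 * C) * e / 2 * (t / sqrt t)" by (simp add: \<alpha>_def)
      also have "t / sqrt t = sqrt t" using t by (simp add: real_div_sqrt)
      finally have "\<alpha> * t = k" by (simp add: k_def)
      moreover have "B * (sqrt t * e) = k * (1 + M)" by (simp add: B_def k_def)
      moreover have "\<beta> = k + 51 * sqrt (N * \<delta>)" by (simp add: \<beta>_def k_def)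
      ultimately show ?thesis by (simp only: distrib_left distrib_right mult_1_right add.assoc)
    qed
    also have "\<dots> \<le> B * \<delta> + 51 * sqrt (N * \<delta>) * M"
      using small \<open>B \<ge> 0\<close> by (intro add_right_mono mult_left_mono) (auto simp: e_def \<psi>_def)
    finally show "(l2_norm (w t))\<^sup>2 \<le> \<bar>l2_inner (w 0) (w t)\<bar> + B * \<delta> + 51 * sqrt (N * \<delta>) * M"
      using id unfolding \<psi>_def by linarith
  qed
qed

theorem theorem2p2:
  fixes K :: "real \<Rightarrow> real" and c0 c :: real
    and w0 :: "real^3 \<Rightarrow> real^3" and w :: "real \<Rightarrow> real^3 \<Rightarrow> real^3"
  assumes "hardy_type K"
    and "c0 > 1"
    and "\<forall>b. \<bar>b\<bar> \<ge> c0 \<longrightarrow> K b < 1"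
    and "\<bar>c\<bar> > c0"
    and "L2_sigma w0"
    and "weak_solution c w0 w"
    and "strong_energy_inequality (K c) w"
  shows "((\<lambda>t. l2_norm (w t)) \<longlongrightarrow> 0) at_top"
proof -
  note sol = assms(6)
  have c: "\<bar>c\<bar> > 1" and K: "K c < 1" using assms by auto
  define D where "D \<tau> = (dotH1_norm (w \<tau>))\<^sup>2" for \<tau>
  define En where "En s \<longleftrightarrow> (\<forall>t\<ge>s. (l2_norm (w t))\<^sup>2 + 2 * (1 - K c) * (LINT \<tau>:{s..t}|lebesgue. D \<tau>) \<le> (l2_norm (w s))\<^sup>2)" for s
  have E0: "En 0" and EAE: "AE s in lebesgue. s \<ge> 0 \<longrightarrow> En s"
    using assms(7) unfolding strong_energy_inequality_def Let_def En_def D_def by blast+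
  have D0: "0 \<le> D \<tau>" for \<tau> by (simp add: D_def)
  have Dint0: "0 \<le> (LINT \<tau>:A|lebesgue. D \<tau>)" for A
    unfolding set_lebesgue_integral_def by (intro integral_nonneg_AE) (simp add: D0)
  have mono: "l2_norm (w t) \<le> l2_norm (w s)" if "En s" "s \<le> t" for s t
  proof (rule power2_le_imp_le)
    have "0 \<le> 2 * (1 - K c) * (LINT \<tau>:{s..t}|lebesgue. D \<tau>)" using K Dint0 by simp
    moreover have "(l2_norm (w t))\<^sup>2 + 2 * (1 - K c) * (LINT \<tau>:{s..t}|lebesgue. D \<tau>) \<le> (l2_norm (w s))\<^sup>2"
      using that by (simp add: En_def)
    ultimately show "(l2_norm (w t))\<^sup>2 \<le> (l2_norm (w s))\<^sup>2" by linarith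
  qed (rule l2_norm_nonneg)
  \<comment> \<open>The added 1 keeps \<open>N\<close> positive even if w(0) vanishes, since the
    Hoelder estimate divides by it.\<close>
  define N where "N = l2_norm (w 0) + 1"
  have N: "N > 0" "\<And>t. t \<ge> 0 \<Longrightarrow> l2_norm (w t) \<le> N"
    using mono[OF E0] l2_norm_nonneg[of "w 0"] by (auto simp: N_def intro: add_increasing2)
  define M where "M = (l2_norm (w 0))\<^sup>2 / (2 * (1 - K c))"
  have M: "(LINT \<tau>:{0..t}|lebesgue. D \<tau>) \<le> M" if "t \<ge> 0" for t
  proof -
    have "(l2_norm (w t))\<^sup>2 + 2 * (1 - K c) * (LINT \<tau>:{0..t}|lebesgue. D \<tau>) \<le> (l2_norm (w 0))\<^sup>2"
      using E0 that by (simp add: En_def)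
    then have "(LINT \<tau>:{0..t}|lebesgue. D \<tau>) * (2 * (1 - K c)) \<le> (l2_norm (w 0))\<^sup>2"
      using zero_le_power2[of "l2_norm (w t)"] by (simp only: mult.commute)
    then show ?thesis using K by (simp add: M_def le_divide_eq)
  qed
  obtain B where "B \<ge> 0" and B: "\<And>t \<delta>. t \<ge> 1 \<Longrightarrow> dotH1_sigma (w t) \<Longrightarrow> \<delta> > 0 \<Longrightarrow> sqrt t * dotH1_norm (w t) \<le> \<delta>
    \<Longrightarrow> (l2_norm (w t))\<^sup>2 \<le> \<bar>l2_inner (w 0) (w t)\<bar> + B * \<delta> + 51 * sqrt (N * \<delta>) * M"
    using weak_solution_energy_bound[OF c sol N M[unfolded D_def]] by blast
  have X: "L2_dotH1_sigma T w" if "T > 0" for T using sol that by (simp add: weak_solution_def X_space_def)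
  \<comment> \<open>Each interval [0, n + 1] has its own exceptional null set; their countable union
    serves all t \<ge> 0.\<close>
  have "AE t in lebesgue. \<forall>n::nat. t \<in> {0..real (Suc n)} \<longrightarrow> dotH1_sigma (w t)"
    unfolding AE_all_countable using L2_dotH1_sigma_AE(1)[OF X] by simp
  then have good: "AE t in lebesgue. t \<ge> 0 \<longrightarrow> dotH1_sigma (w t) \<and> En t"
    using EAE
  proof eventually_elim
    case (elim t)
    obtain n where "t \<le> real n" using real_arch_simple by blast
    then have "t \<le> real (Suc n)" by simp
    then show ?case using elim by auto
  qed
  have Dint: "set_integrable lebesgue {0..T} D" for T
  proof (rule set_integrable_subset)
    show "set_integrable lebesgue {0..\<bar>T\<bar> + 1} D"
      unfolding D_def[abs_def] by (rule L2_dotH1_sigma_AE(2)[OF X]) simp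
  qed auto
  have L2: "in_L2 (w t)" if "t \<ge> 0" for t using sol that by (simp add: weak_solution_def L2_sigma_def)
  show ?thesis
  proof (rule tendstoI)
    \<comment> \<open>The order of choices matters: first the radius \<open>n\<close> for the tail
      of w(0), then \<open>\<delta>\<close> depending on \<open>n\<close>, and last the time
      \<open>s\<close>.\<close>
    fix \<epsilon> :: real assume "\<epsilon> > 0"
    let ?tail = "\<lambda>n. l2_norm (\<lambda>x. indicator (- cball 0 (real n)) x *\<^sub>R w 0 x)"
    have "(\<lambda>n. ?tail n * N) \<longlonglongrightarrow> 0"
      by (rule tendsto_mult_left_zero[OF l2_norm_tail_tendsto_0[OF L2]]) simp
    then have "\<forall>\<^sub>F n in sequentially. ?tail n * N < \<epsilon>\<^sup>2 / 2"
      using \<open>\<epsilon> > 0\<close> by (intro order_tendstoD(2)) auto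
    then obtain n where n: "?tail n * N < \<epsilon>\<^sup>2 / 2"
      using eventually_happens'[OF sequentially_bot] by blast
    \<comment> \<open>All that vanishes with \<open>\<delta>\<close> once \<open>n\<close> is fixed:
      the part of (w(0), w(s)) inside the ball and the remainder of the energy bound.\<close>
    define rest where "rest \<delta> = 2 * real n * l2_norm (w 0) * \<delta> + B * \<delta> + 51 * sqrt (N * \<delta>) * M" for \<delta>
    have "(rest \<longlongrightarrow> 2 * real n * l2_norm (w 0) * 0 + B * 0 + 51 * sqrt (N * 0) * M) (at_right 0)"
      unfolding rest_def by (intro tendsto_intros)
    then have "\<forall>\<^sub>F \<delta> in at_right 0. rest \<delta> < \<epsilon>\<^sup>2 / 2"
      using \<open>\<epsilon> > 0\<close> by (intro order_tendstoD(2)) auto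
    then have "\<forall>\<^sub>F \<delta> in at_right 0. rest \<delta> < \<epsilon>\<^sup>2 / 2 \<and> \<delta> > 0"
      using eventually_at_right_less by (rule eventually_conj)
    then obtain \<delta> where \<delta>: "rest \<delta> < \<epsilon>\<^sup>2 / 2" "\<delta> > 0"
      using eventually_happens'[OF trivial_limit_at_right_real] by blast
    \<comment> \<open>Besides the smallness, \<open>s\<close> must avoid the null set of times at
      which w(s) is not in the homogeneous space or the energy inequality cannot be
      restarted.\<close>
    obtain s where s: "s \<ge> 1" "dotH1_sigma (w s) \<and> En s" "s * D s \<le> \<delta>\<^sup>2"
      by (rule exists_time_with_small_value[OF Dint D0 M good, of "\<delta>\<^sup>2" 1]) (use \<delta> in auto)
    have "(sqrt s * dotH1_norm (w s))\<^sup>2 \<le> \<delta>\<^sup>2"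
      using s by (simp add: power_mult_distrib D_def)
    then have small: "sqrt s * dotH1_norm (w s) \<le> \<delta>"
      by (rule power2_le_imp_le) (use \<delta>(2) in simp)
    have "1 * dotH1_norm (w s) \<le> sqrt s * dotH1_norm (w s)"
      using s(1) by (intro mult_right_mono dotH1_norm_nonneg) simp
    then have le\<delta>: "dotH1_norm (w s) \<le> \<delta>" using small by linarith
    have "\<bar>l2_inner (w 0) (w s)\<bar> \<le> 2 * real n * l2_norm (w 0) * dotH1_norm (w s) + ?tail n * l2_norm (w s)"
      using s by (intro l2_inner_le_tail L2) (auto simp: dotH1_sigma_def)
    also have "\<dots> \<le> 2 * real n * l2_norm (w 0) * \<delta> + ?tail n * N"
      using s N(2)[of s] le\<delta> by (intro add_mono mult_left_mono) (auto simp: l2_norm_nonneg)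
    finally have "(l2_norm (w s))\<^sup>2 < \<epsilon>\<^sup>2"
      using B[OF s(1) _ \<delta>(2) small] s(2) n \<delta>(1) unfolding rest_def by linarith
    then have ws: "l2_norm (w s) < \<epsilon>"
      by (rule power2_less_imp_less) (use \<open>\<epsilon> > 0\<close> in simp)
    show "\<forall>\<^sub>F t in at_top. dist (l2_norm (w t)) 0 < \<epsilon>"
      using eventually_ge_at_top[of s]
    proof eventually_elim
      case (elim t)
      then show ?case using mono[of s t] s(2) ws l2_norm_nonneg[of "w t"] by simp
    qed
  qed
qed

end
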